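(* Let $t\ge 0$ be an integer. For any multiplicative terms $M_0,M_1,\dots,M_m$ of parameter matrices $\{g_{t,1}^b,g_{t,2}^b\}$ and constant matrices $\{W_{t,1}^b,W_{t,2}^b,W_1^*,W_2^*\}$, with degrees $d_0,\dots,d_m$ respectively ($M_1,\dots,M_m$ being square so that their traces are defined), put $$M=\Big(\prod_{i=1}^m \operatorname{tr}(M_i)\Big)M_0,\quad d=\sum_{i=0}^m d_i,\quad d'=\sum_{i=0}^m\big(\deg(W_{t,1}^b;M_i)+\deg(W_{t,2}^b;M_i)\big).$$ Then there exists a set of multiplicative terms $\{M_{ij}^k: 1\le i\le m_k,\ 0\le j\le m_{ki},\ 0\le k\le q\}$ of parameter matrices $\{W_{0,1}^b,W_{0,2}^b\}$ and constant matrices $\{W_1^*,W_2^*\}$ such that $$\mathbb{E}[M\mid\mathcal{F}_0]=N_0+N_1\frac1b+\cdots+N_q\frac1{b^q},$$ where $$N_k=\sum_{i=1}^{m_k}\Big(\prod_{j=1}^{m_{ki}}\operatorname{tr}(M_{ij}^k)\Big)M_{i0}^k,\qquad k\in\{0,\dots,q\}.$$ Here $m_k$, $m_{ki}$ and $q\le \tfrac12(3^{t+1}-1)\,d+\tfrac12(3^{t}-1)\,d'$ are constants independent of $b$, and $\sum_{j=0}^{m_{ki}}\deg(M_{ij}^k)\le 3^t(3d+d')$.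
   Context: Online SGD on a two-layer linear network. Fixed ground-truth (teacher) matrices $W_1^*,W_2^*$ and student weights $W_1\in\mathbb{R}^{p_1\times p}$, $W_2\in\mathbb{R}^{p_2\times p_1}$ (with $W_2^*W_1^*\in\mathbb{R}^{p_2\times p}$); the loss is $\mathbb{E}_{x\sim N(0,I_p)}[\frac12\|W_2W_1x-W_2^*W_1^*x\|^2]$. For mini-batch size $b$, start from fixed initial weights $W_{0,1}^b=W_{0,1}$, $W_{0,2}^b=W_{0,2}$ (the same for all $b$). At each iteration $t\ge0$ draw fresh samples $x_{t,1},\dots,x_{t,b}$ i.i.d. from $N(0,I_p)$ (independent across iterations) and set $W_{t+1,i}^b=W_{t,i}^b-\alpha_t g_{t,i}^b$ for $i=1,2$, where, with $\mathcal{W}_t^b=W_{t,2}^bW_{t,1}^b-W_2^*W_1^*$, $$g_{t,1}^b=\frac1b\sum_{i=1}^b (W_{t,2}^b)^\top\mathcal{W}_t^b x_{t,i}x_{t,i}^\top,\qquad g_{t,2}^b=\frac1b\sum_{i=1}^b \mathcal{W}_t^b x_{t,i}x_{t,i}^\top (W_{t,1}^b)^\top .$$ The learning rates $\alpha_t>0$ are independent of $b$. $\mathcal{F}_0$ is the information consisting of the initial weights only. Multiplicative terms: for a set of matrices $\mathcal{S}$ let $\overline{\mathcal{S}}=\mathcal{S}\cup\{M^\top:M\in\mathcal{S}\}$. Given parameter matrices $\mathcal{X}=\{X_1,\dots,X_{n_v}\}$ and constant matrices $\mathcal{C}=\{C_1,\dots,C_{n_c}\}$, a matrix $M$ is a multiplicative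 term of parameter matrices $\mathcal{X}$ and constant matrices $\mathcal{C}$ if it can be written as $M=\prod_{i=1}^kA_i$ with $A_i\in\overline{\mathcal{X}}\cup\overline{\mathcal{C}}$. For a parameter or constant matrix $Y$, $\deg(Y;M)=\sum_{i=1}^k(\mathbf{1}\{Y=A_i\}+\mathbf{1}\{Y=A_i^\top\})$, i.e. the number of appearances of $Y$ and $Y^\top$ in the product. The degree of $M$ is $\deg(M)=\sum_{i=1}^k\mathbf{1}\{A_i\in\overline{\mathcal{X}}\}=\sum_{j=1}^{n_v}\deg(X_j;M)$, the total degree of the parameter matrices in $M$.
   Formalization: Each summand of N_k carries a real coefficient depending only on dimensions, learning rates, t and the given terms, not on b or the weights (without it the claim fails: E[g_{0,1}] can be -1 with all weights positive); empty products (identity matrices) count as multiplicative terms. *)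

theory Defs
  imports "HOL-Probability.Probability" "Jordan_Normal_Form.Matrix"
begin

hide_const (open) Finite_Cartesian_Product.mat Finite_Cartesian_Product.vec

text \<open>Matrices of type \<^typ>\<open>real mat\<close> carry their dimensions as data, so a finite sum of
  matrices needs the common dimensions as arguments (the empty sum is the zero matrix).\<close>

definition mat_sum :: "nat \<Rightarrow> nat \<Rightarrow> ('i \<Rightarrow> real mat) \<Rightarrow> 'i set \<Rightarrow> real mat" where
  "mat_sum nr nc A I = mat nr nc (\<lambda>(i, j). \<Sum>k\<in>I. A k $$ (i, j))"

definition mat_trace :: "real mat \<Rightarrow> real" where
  "mat_trace A = (\<Sum>i<dim_row A. A $$ (i, i))"

definition outer :: "real vec \<Rightarrow> real mat" where
  "outer x = mat (dim_vec x) (dim_vec x) (\<lambda>(i, j). x $ i * x $ j)"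

definition mat_cond_exp ::
  "'a measure \<Rightarrow> 'a measure \<Rightarrow> nat \<Rightarrow> nat \<Rightarrow> ('a \<Rightarrow> real mat) \<Rightarrow> 'a \<Rightarrow> real mat" where
  "mat_cond_exp \<Omega> F nr nc X \<omega> =
     mat nr nc (\<lambda>(i, j). real_cond_exp \<Omega> F (\<lambda>\<omega>'. X \<omega>' $$ (i, j)) \<omega>)"

text \<open>A multiplicative term is a formal product whose factors are matrix symbols of type
  \<open>'s\<close>, possibly transposed.  It is kept formal, so that degrees are well defined even when
  different symbols happen to denote the same matrix, and so that one term can be evaluated for
  different batch sizes, weights and samples.  The empty product \<open>Id n\<close> is the identity matrix of
  size \<open>n\<close>; it is also the right end of every nonempty product.\<close>

datatype 's factor = Plain 's | Transp 's

datatype 's mterm = Id nat | Times "'s factor" "'s mterm"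

primrec symbol :: "'s factor \<Rightarrow> 's" where
  "symbol (Plain s) = s"
| "symbol (Transp s) = s"

primrec symbols :: "'s mterm \<Rightarrow> 's list" where
  "symbols (Id n) = []"
| "symbols (Times A M) = symbol A # symbols M"

definition deg :: "'s \<Rightarrow> 's mterm \<Rightarrow> nat" where
  "deg Y M = length (filter (\<lambda>s. s = Y) (symbols M))"

definition degree :: "'s set \<Rightarrow> 's mterm \<Rightarrow> nat" where
  "degree X M = length (filter (\<lambda>s. s \<in> X) (symbols M))"

text \<open>The argument \<open>D\<close> assigns to each symbol its numbers of rows and columns.\<close>

primrec factor_dims :: "('s \<Rightarrow> nat \<times> nat) \<Rightarrow> 's factor \<Rightarrow> nat \<times> nat" where
  "factor_dims D (Plain s) = D s"
| "factor_dims D (Transp s) = (snd (D s), fst (D s))"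

primrec term_rows :: "('s \<Rightarrow> nat \<times> nat) \<Rightarrow> 's mterm \<Rightarrow> nat" where
  "term_rows D (Id n) = n"
| "term_rows D (Times A M) = fst (factor_dims D A)"

primrec term_cols :: "'s mterm \<Rightarrow> nat" where
  "term_cols (Id n) = n"
| "term_cols (Times A M) = term_cols M"

primrec compatible :: "('s \<Rightarrow> nat \<times> nat) \<Rightarrow> 's mterm \<Rightarrow> bool" where
  "compatible D (Id n) \<longleftrightarrow> True"
| "compatible D (Times A M) \<longleftrightarrow> snd (factor_dims D A) = term_rows D M \<and> compatible D M"

definition mult_term :: "('s \<Rightarrow> nat \<times> nat) \<Rightarrow> 's set \<Rightarrow> 's set \<Rightarrow> 's mterm \<Rightarrow> bool" where
  "mult_term D X C M \<longleftrightarrow> set (symbols M) \<subseteq> X \<union> C \<and> compatible D M"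

definition square_term :: "('s \<Rightarrow> nat \<times> nat) \<Rightarrow> 's mterm \<Rightarrow> bool" where
  "square_term D M \<longleftrightarrow> term_rows D M = term_cols M"

primrec factor_val :: "('s \<Rightarrow> real mat) \<Rightarrow> 's factor \<Rightarrow> real mat" where
  "factor_val V (Plain s) = V s"
| "factor_val V (Transp s) = (V s)\<^sup>T"

primrec term_val :: "('s \<Rightarrow> real mat) \<Rightarrow> 's mterm \<Rightarrow> real mat" where
  "term_val V (Id n) = 1\<^sub>m n"
| "term_val V (Times A M) = factor_val V A * term_val V M"

definition trace_product :: "('s \<Rightarrow> real mat) \<Rightarrow> nat \<Rightarrow> (nat \<Rightarrow> 's mterm) \<Rightarrow> real mat" where
  "trace_product V m T =
     (\<Prod>i\<in>{1..m}. mat_trace (term_val V (T i))) \<cdot>\<^sub>m term_val V (T 0)"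

datatype layer = First | Second

text \<open>Input dimension \<open>p\<close>, hidden dimension \<open>h\<close>, output dimension \<open>p2\<close>.\<close>

primrec net_dims :: "nat \<Rightarrow> nat \<Rightarrow> nat \<Rightarrow> layer \<Rightarrow> nat \<times> nat" where
  "net_dims p h p2 First = (h, p)"
| "net_dims p h p2 Second = (p2, h)"

definition net_weights :: "nat \<Rightarrow> nat \<Rightarrow> nat \<Rightarrow> (layer \<Rightarrow> real mat) \<Rightarrow> bool" where
  "net_weights p h p2 W \<longleftrightarrow>
     (\<forall>l. W l \<in> carrier_mat (fst (net_dims p h p2 l)) (snd (net_dims p h p2 l)))"

primrec gradient ::
  "nat \<Rightarrow> nat \<Rightarrow> nat \<Rightarrow> nat \<Rightarrow> (layer \<Rightarrow> real mat) \<Rightarrow> (layer \<Rightarrow> real mat) \<Rightarrow>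
   (nat \<Rightarrow> real vec) \<Rightarrow> layer \<Rightarrow> real mat" where
  "gradient p p1 p2 b Wstar W x First =
     (1 / real b) \<cdot>\<^sub>m mat_sum p1 p
       (\<lambda>i. (W Second)\<^sup>T * (W Second * W First - Wstar Second * Wstar First) * outer (x i)) {1..b}"
| "gradient p p1 p2 b Wstar W x Second =
     (1 / real b) \<cdot>\<^sub>m mat_sum p2 p1
       (\<lambda>i. (W Second * W First - Wstar Second * Wstar First) * outer (x i) * (W First)\<^sup>T) {1..b}"

text \<open>Here \<open>x s i\<close> is the \<open>i\<close>-th sample of the mini-batch of iteration \<open>s\<close>.\<close>

primrec sgd ::
  "nat \<Rightarrow> nat \<Rightarrow> nat \<Rightarrow> nat \<Rightarrow> (nat \<Rightarrow> real) \<Rightarrow> (layer \<Rightarrow> real mat) \<Rightarrow> (layer \<Rightarrow> real mat) \<Rightarrow>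
   (nat \<Rightarrow> nat \<Rightarrow> real vec) \<Rightarrow> nat \<Rightarrow> layer \<Rightarrow> real mat" where
  "sgd p p1 p2 b \<alpha> Wstar W0 x 0 = W0"
| "sgd p p1 p2 b \<alpha> Wstar W0 x (Suc t) =
     (\<lambda>l. sgd p p1 p2 b \<alpha> Wstar W0 x t l -
        \<alpha> t \<cdot>\<^sub>m gradient p p1 p2 b Wstar (sgd p p1 p2 b \<alpha> Wstar W0 x t) (x t) l)"

text \<open>The standard Gaussian distribution on \<open>p\<close>-dimensional space, with vectors represented as
  extensional functions on \<open>{..<p}\<close>.\<close>

definition std_gaussian :: "nat \<Rightarrow> (nat \<Rightarrow> real) measure" where
  "std_gaussian p = Pi\<^sub>M {..<p} (\<lambda>_. density lborel std_normal_density)"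

definition gaussian_samples ::
  "'a measure \<Rightarrow> nat \<Rightarrow> nat \<Rightarrow> (nat \<Rightarrow> nat \<Rightarrow> 'a \<Rightarrow> nat \<Rightarrow> real) \<Rightarrow> bool" where
  "gaussian_samples \<Omega> p b x \<longleftrightarrow>
     prob_space.indep_vars \<Omega> (\<lambda>_. Pi\<^sub>M {..<p} (\<lambda>_. borel)) (\<lambda>(s, i). x s i) (UNIV \<times> {1..b}) \<and>
     (\<forall>s. \<forall>i\<in>{1..b}. distr \<Omega> (Pi\<^sub>M {..<p} (\<lambda>_. borel)) (x s i) = std_gaussian p)"

definition sample_path ::
  "nat \<Rightarrow> (nat \<Rightarrow> nat \<Rightarrow> 'a \<Rightarrow> nat \<Rightarrow> real) \<Rightarrow> 'a \<Rightarrow> nat \<Rightarrow> nat \<Rightarrow> real vec" where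
  "sample_path p x \<omega> s i = vec p (x s i \<omega>)"

text \<open>The sigma-algebra generated by the initial weights.  These are deterministic, so it does not
  depend on the sigma-algebra chosen on the space of weights.\<close>

definition initial_info ::
  "'a measure \<Rightarrow> ('a \<Rightarrow> nat \<Rightarrow> layer \<Rightarrow> real mat) \<Rightarrow> 'a measure" where
  "initial_info \<Omega> W = vimage_algebra (space \<Omega>) (\<lambda>\<omega>. W \<omega> 0) (count_space UNIV)"

datatype step_symbol = Grad layer | Weight layer | Teacher layer

datatype init_symbol = Init layer | Teacher0 layer

text \<open>\<open>r\<close> is the hidden dimension of the teacher network, which may differ from \<open>p1\<close>.\<close>

primrec step_dims :: "nat \<Rightarrow> nat \<Rightarrow> nat \<Rightarrow> nat \<Rightarrow> step_symbol \<Rightarrow> nat \<times> nat" where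
  "step_dims p p1 p2 r (Grad l) = net_dims p p1 p2 l"
| "step_dims p p1 p2 r (Weight l) = net_dims p p1 p2 l"
| "step_dims p p1 p2 r (Teacher l) = net_dims p r p2 l"

primrec init_dims :: "nat \<Rightarrow> nat \<Rightarrow> nat \<Rightarrow> nat \<Rightarrow> init_symbol \<Rightarrow> nat \<times> nat" where
  "init_dims p p1 p2 r (Init l) = net_dims p p1 p2 l"
| "init_dims p p1 p2 r (Teacher0 l) = net_dims p r p2 l"

primrec step_val ::
  "(layer \<Rightarrow> real mat) \<Rightarrow> (layer \<Rightarrow> real mat) \<Rightarrow> (layer \<Rightarrow> real mat) \<Rightarrow> step_symbol \<Rightarrow> real mat" where
  "step_val g W Wstar (Grad l) = g l"
| "step_val g W Wstar (Weight l) = W l"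
| "step_val g W Wstar (Teacher l) = Wstar l"

primrec init_val :: "(layer \<Rightarrow> real mat) \<Rightarrow> (layer \<Rightarrow> real mat) \<Rightarrow> init_symbol \<Rightarrow> real mat" where
  "init_val W0 Wstar (Init l) = W0 l"
| "init_val W0 Wstar (Teacher0 l) = Wstar l"

definition sgd_term ::
  "nat \<Rightarrow> nat \<Rightarrow> nat \<Rightarrow> nat \<Rightarrow> (nat \<Rightarrow> real) \<Rightarrow> (layer \<Rightarrow> real mat) \<Rightarrow> (layer \<Rightarrow> real mat) \<Rightarrow>
   nat \<Rightarrow> nat \<Rightarrow> (nat \<Rightarrow> step_symbol mterm) \<Rightarrow> (nat \<Rightarrow> nat \<Rightarrow> real vec) \<Rightarrow> real mat" where
  "sgd_term p p1 p2 b \<alpha> Wstar W0 t m T x =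
     (let W = sgd p p1 p2 b \<alpha> Wstar W0 x t
      in trace_product (step_val (gradient p p1 p2 b Wstar W (x t)) W Wstar) m T)"

end

theory Submission
  imports Defs
begin

text \<open>A matrix entry is a trace: the \<open>(i, j)\<close> entry of \<open>M\<^sub>0\<close> is the trace of \<open>M\<^sub>0\<close> times a matrix unit, kept as
  an extra symbol, the hole.  So every term is a product of traces of cyclic words.  Substituting the
  gradients, a word of iteration \<open>t\<close> becomes a word in the weights, the teacher and the sample
  covariance \<open>S = (1/b) \<Sum> x\<^sub>i x\<^sub>i\<^sup>T\<close>.  Gaussian integration by parts in the samples gives
  \<open>E[S\<^sub>a\<^sub>c F] = \<delta>\<^sub>a\<^sub>c E[F] + (1/b) E[F']\<close>, where \<open>F'\<close> contracts this \<open>S\<close> with each other occurrence of \<open>S\<close> in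
  \<open>F\<close>; on cyclic words a contraction merely cuts and rejoins words.  Hence one factor \<open>S\<close> disappears at
  the price of at most one factor \<open>1/b\<close>.  Writing the remaining weights of iteration \<open>t\<close> as weights
  minus \<open>\<alpha>\<close> times gradients of iteration \<open>t - 1\<close>, one iterates; a gradient contains at most three weights
  and one \<open>S\<close>, which yields the powers of 3 in the bounds.\<close>

section \<open>Words and their entries\<close>

text \<open>The expansion must be fixed before the batch size, the weights, the teacher and the
  probability space are known. Each existence statement therefore first produces a list of
  coefficients, powers of 1/b and words, and only then quantifies over a whole \<open>run\<close>.
  The position of the hole belongs to the run as well, so that one list serves all entries of the
  matrix.

  Independence of different iterations does not enter through conditioning. The weights of iteration
  \<open>t\<close> have derivative 0 along every sample of iteration \<open>t\<close> or later, so
  integration by parts in these samples treats them as constants although they are random.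

  The obstacle in integration by parts is that integrability and the identity itself are needed for
  large polynomials in the samples; \<open>derivation\<close> packages both into one property that
  is closed under sums and products.

  A contraction can split a word, hence traces appear even if there were none at the start, and it
  can transpose a word, hence the hole may come back transposed. The final coefficients are products
  of signs and learning rates.\<close>

primrec factor_entry :: "('s \<Rightarrow> nat \<Rightarrow> nat \<Rightarrow> real) \<Rightarrow> 's factor \<Rightarrow> nat \<Rightarrow> nat \<Rightarrow> real" where
  "factor_entry V (Plain s) i j = V s i j"
| "factor_entry V (Transp s) i j = V s j i"

text \<open>Values are real functions of two indices, with the sizes kept apart in \<open>D\<close>,
  so that single entries can be differentiated and integrated. \<open>Id n\<close> does not test its
  indices against \<open>n\<close>; statements about entries therefore restrict them to the range
  where this matters.\<close>

primrec entry ::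
  "('s \<Rightarrow> nat \<times> nat) \<Rightarrow> ('s \<Rightarrow> nat \<Rightarrow> nat \<Rightarrow> real) \<Rightarrow> 's mterm \<Rightarrow> nat \<Rightarrow> nat \<Rightarrow> real" where
  "entry D V (Id n) i j = of_bool (i = j)"
| "entry D V (Times A M) i j =
     (\<Sum>k<snd (factor_dims D A). factor_entry V A i k * entry D V M k j)"

definition word_trace :: "('s \<Rightarrow> nat \<times> nat) \<Rightarrow> ('s \<Rightarrow> nat \<Rightarrow> nat \<Rightarrow> real) \<Rightarrow> 's mterm \<Rightarrow> real" where
  "word_trace D V M = (\<Sum>i<term_rows D M. entry D V M i i)"

definition traces :: "('s \<Rightarrow> nat \<times> nat) \<Rightarrow> ('s \<Rightarrow> nat \<Rightarrow> nat \<Rightarrow> real) \<Rightarrow> 's mterm list \<Rightarrow> real" where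
  "traces D V w = (\<Prod>M\<leftarrow>w. word_trace D V M)"

text \<open>The end marker of the first word is dropped, so concatenation represents the product
  only if it matches the rows of the second word.\<close>

primrec app :: "'s mterm \<Rightarrow> 's mterm \<Rightarrow> 's mterm" where
  "app (Id n) N = N"
| "app (Times A M) N = Times A (app M N)"

primrec flip :: "'s factor \<Rightarrow> 's factor" where
  "flip (Plain s) = Transp s"
| "flip (Transp s) = Plain s"

primrec word_transp :: "('s \<Rightarrow> nat \<times> nat) \<Rightarrow> 's mterm \<Rightarrow> 's mterm" where
  "word_transp D (Id n) = Id n"
| "word_transp D (Times A M) = app (word_transp D M) (Times (flip A) (Id (fst (factor_dims D A))))"

text \<open>An identity valid for all \<open>f\<close> records the whole multiset of symbols at
  once. Integers are used so that bounds can be negated and occurrences subtracted.\<close>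

definition weight :: "('s \<Rightarrow> int) \<Rightarrow> 's mterm \<Rightarrow> int" where
  "weight f M = (\<Sum>s\<leftarrow>symbols M. f s)"

definition weights :: "('s \<Rightarrow> int) \<Rightarrow> 's mterm list \<Rightarrow> int" where
  "weights f w = (\<Sum>M\<leftarrow>w. weight f M)"

definition closed_words :: "('s \<Rightarrow> nat \<times> nat) \<Rightarrow> 's mterm list \<Rightarrow> bool" where
  "closed_words D w \<longleftrightarrow> (\<forall>M\<in>set w. compatible D M \<and> square_term D M)"

lemma factor_dims_flip [simp]: "factor_dims D (flip A) = (snd (factor_dims D A), fst (factor_dims D A))"
  by (cases A) auto

lemma factor_entry_flip [simp]: "factor_entry V (flip A) i j = factor_entry V A j i"
  by (cases A) auto

lemma symbol_flip [simp]: "symbol (flip A) = symbol A"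
  by (cases A) auto

lemma term_rows_app: "term_cols M = term_rows D N \<Longrightarrow> term_rows D (app M N) = term_rows D M"
  by (cases M) auto

lemma term_cols_app [simp]: "term_cols (app M N) = term_cols N"
  by (induction M) auto

lemma compatible_app:
  "compatible D M \<Longrightarrow> compatible D N \<Longrightarrow> term_cols M = term_rows D N \<Longrightarrow> compatible D (app M N)"
  by (induction M) (auto simp: term_rows_app)

lemma symbols_app [simp]: "symbols (app M N) = symbols M @ symbols N"
  by (induction M) auto

lemma sum_delta_lessThan:
  "(\<Sum>k<n. f k * of_bool (k = j)) = (if (j::nat) < n then f j else (0::real))"
  "(\<Sum>k<n. of_bool (j = k) * f k) = (if (j::nat) < n then f j else (0::real))"
  by (cases "j < n"; auto simp: of_bool_def if_distrib[of "\<lambda>x. _ * x"] if_distrib[of "\<lambda>x. x * _"]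
      sum.delta sum.delta' cong: if_cong)+

lemma entry_app:
  assumes "compatible D M" "i < term_rows D M"
  shows "entry D V (app M N) i j = (\<Sum>k<term_cols M. entry D V M i k * entry D V N k j)"
  using assms
proof (induction M arbitrary: i)
  case (Id n)
  then show ?case by (simp add: sum_delta_lessThan)
next
  case (Times A M)
  have "entry D V (app (Times A M) N) i j =
      (\<Sum>k<snd (factor_dims D A). factor_entry V A i k *
        (\<Sum>l<term_cols M. entry D V M k l * entry D V N l j))"
    using Times by auto
  also have "\<dots> = (\<Sum>k<snd (factor_dims D A). \<Sum>l<term_cols M.
      factor_entry V A i k * entry D V M k l * entry D V N l j)"
    by (simp add: sum_distrib_left mult.assoc)
  also have "\<dots> = (\<Sum>l<term_cols M. \<Sum>k<snd (factor_dims D A).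
      factor_entry V A i k * entry D V M k l * entry D V N l j)"
    by (rule sum.swap)
  finally show ?case by (simp add: sum_distrib_right)
qed

lemma term_cols_transp [simp]: "compatible D M \<Longrightarrow> term_cols (word_transp D M) = term_rows D M"
  by (cases M) auto

lemma term_rows_transp: "compatible D M \<Longrightarrow> term_rows D (word_transp D M) = term_cols M"
  by (induction M) (auto simp: term_rows_app)

lemma compatible_transp: "compatible D M \<Longrightarrow> compatible D (word_transp D M)"
  by (induction M) (auto intro!: compatible_app)

lemma symbols_transp [simp]: "symbols (word_transp D M) = rev (symbols M)"
  by (induction M) auto

lemma entry_transp:
  assumes "compatible D M" "i < term_cols M" "j < term_rows D M"
  shows "entry D V (word_transp D M) i j = entry D V M j i"
  using assms
proof (induction M arbitrary: j)
  case (Id n)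
  then show ?case by auto
next
  case (Times A M)
  then have "entry D V (word_transp D (Times A M)) i j =
      (\<Sum>k<term_rows D M. entry D V (word_transp D M) i k * factor_entry V A j k)"
    by (simp add: entry_app compatible_transp term_rows_transp sum_delta_lessThan)
  also have "\<dots> = (\<Sum>k<term_rows D M. entry D V M k i * factor_entry V A j k)"
    using Times by (intro sum.cong) auto
  finally show ?case using Times by (simp add: mult.commute)
qed

lemma entry_cong:
  assumes "compatible D M" "i < term_rows D M" "j < term_cols M"
    and "\<And>s u v. s \<in> set (symbols M) \<Longrightarrow> u < fst (D s) \<Longrightarrow> v < snd (D s) \<Longrightarrow> V s u v = V' s u v"
  shows "entry D V M i j = entry D V' M i j"
  using assms
proof (induction M arbitrary: i)
  case (Id n)
  then show ?case by simp
next
  case (Times A M)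
  have "factor_entry V A i k = factor_entry V' A i k" if "k < snd (factor_dims D A)" for k
    using Times.prems that by (cases A) auto
  moreover have "entry D V M k j = entry D V' M k j" if "k < snd (factor_dims D A)" for k
    using Times that by auto
  ultimately show ?case by simp
qed

lemma trace_app:
  assumes "compatible D M" "term_cols M = term_rows D N"
  shows "word_trace D V (app M N) =
    (\<Sum>i<term_rows D M. \<Sum>k<term_cols M. entry D V M i k * entry D V N k i)"
proof -
  have "word_trace D V (app M N) = (\<Sum>i<term_rows D M. entry D V (app M N) i i)"
    using assms by (simp add: word_trace_def term_rows_app)
  also have "\<dots> = (\<Sum>i<term_rows D M. \<Sum>k<term_cols M. entry D V M i k * entry D V N k i)"
    using assms by (intro sum.cong entry_app) auto
  finally show ?thesis .
qed

text \<open>Cyclic invariance of the trace: it is what permits reading closed words as cyclic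
  ones.\<close>

lemma trace_app_commute:
  assumes "compatible D M" "compatible D N" "term_cols M = term_rows D N" "term_cols N = term_rows D M"
  shows "word_trace D V (app M N) = word_trace D V (app N M)"
proof -
  have "word_trace D V (app M N) =
      (\<Sum>k<term_rows D N. \<Sum>i<term_cols N. entry D V N k i * entry D V M i k)"
    using assms by (simp add: trace_app mult.commute) (rule sum.swap)
  then show ?thesis using assms by (simp add: trace_app)
qed

lemma weight_simps [simp]:
  "weight f (Id n) = 0"
  "weight f (Times A M) = f (symbol A) + weight f M"
  "weight f (app M N) = weight f M + weight f N"
  "weight f (word_transp D M) = weight f M"
  by (auto simp: weight_def sum_list_rev simp flip: rev_map)

lemma weights_simps [simp]:
  "weights f [] = 0" "weights f (M # w) = weight f M + weights f w"
  "weights f (v @ w) = weights f v + weights f w"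
  by (auto simp: weights_def)

lemma traces_simps [simp]:
  "traces D V [] = 1" "traces D V (M # w) = word_trace D V M * traces D V w"
  "traces D V (v @ w) = traces D V v * traces D V w"
  by (auto simp: traces_def)

lemma closed_simps [simp]:
  "closed_words D []" "closed_words D (M # w) \<longleftrightarrow> compatible D M \<and> square_term D M \<and> closed_words D w"
  "closed_words D (v @ w) \<longleftrightarrow> closed_words D v \<and> closed_words D w"
  by (auto simp: closed_words_def)

section \<open>Substitution\<close>

primrec orient :: "('s \<Rightarrow> nat \<times> nat) \<Rightarrow> 's factor \<Rightarrow> 's mterm \<Rightarrow> 's mterm" where
  "orient D (Plain s) N = N"
| "orient D (Transp s) N = word_transp D N"

text \<open>A product of linear combinations of words, multiplied out. An empty list in
  \<open>\<sigma>\<close> stands for the zero matrix and erases every word that contains the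
  symbol.\<close>

primrec subst_term ::
  "('s \<Rightarrow> nat \<times> nat) \<Rightarrow> ('s \<Rightarrow> (real \<times> 's mterm) list) \<Rightarrow> 's mterm \<Rightarrow> (real \<times> 's mterm) list" where
  "subst_term D \<sigma> (Id n) = [(1, Id n)]"
| "subst_term D \<sigma> (Times A M) =
     map (\<lambda>((c, N), (c', N')). (c * c', app (orient D A N) N'))
       (List.product (\<sigma> (symbol A)) (subst_term D \<sigma> M))"

primrec subst_terms ::
  "('s \<Rightarrow> nat \<times> nat) \<Rightarrow> ('s \<Rightarrow> (real \<times> 's mterm) list) \<Rightarrow> 's mterm list \<Rightarrow> (real \<times> 's mterm list) list" where
  "subst_terms D \<sigma> [] = [(1, [])]"
| "subst_terms D \<sigma> (M # w) =
     map (\<lambda>((c, N), (c', v)). (c * c', N # v)) (List.product (subst_term D \<sigma> M) (subst_terms D \<sigma> w))"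

definition wf_subst :: "('s \<Rightarrow> nat \<times> nat) \<Rightarrow> ('s \<Rightarrow> (real \<times> 's mterm) list) \<Rightarrow> bool" where
  "wf_subst D \<sigma> \<longleftrightarrow> (\<forall>s. \<forall>(c, N)\<in>set (\<sigma> s).
     compatible D N \<and> term_rows D N = fst (D s) \<and> term_cols N = snd (D s))"

lemma sum_list_product:
  "(\<Sum>z\<leftarrow>List.product xs ys. f (fst z) * g (snd z)) = (\<Sum>x\<leftarrow>xs. f x) * (\<Sum>y\<leftarrow>ys. (g y :: real))"
  by (induction xs) (auto simp: sum_list_const_mult algebra_simps comp_def)

lemma sum_list_sum_swap: "(\<Sum>x\<leftarrow>xs. \<Sum>k\<in>A. f x k) = (\<Sum>k\<in>A. \<Sum>x\<leftarrow>xs. (f x k :: real))"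
  by (induction xs) (auto simp: sum.distrib)

lemma subst_term_wf:
  assumes "wf_subst D \<sigma>" "compatible D M" "(c, N) \<in> set (subst_term D \<sigma> M)"
  shows "compatible D N \<and> term_rows D N = term_rows D M \<and> term_cols N = term_cols M"
  using assms(2,3)
proof (induction M arbitrary: c N)
  case (Id n)
  then show ?case by simp
next
  case (Times A M)
  then obtain c1 N1 c2 N2 where N: "(c1, N1) \<in> set (\<sigma> (symbol A))"
    "(c2, N2) \<in> set (subst_term D \<sigma> M)" "N = app (orient D A N1) N2" by auto
  have 1: "compatible D N1 \<and> term_rows D N1 = fst (D (symbol A)) \<and> term_cols N1 = snd (D (symbol A))"
    using assms(1) N(1) by (fastforce simp: wf_subst_def)
  have 2: "compatible D N2 \<and> term_rows D N2 = term_rows D M \<and> term_cols N2 = term_cols M"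
    using Times N by auto
  have "compatible D (orient D A N1)" "term_rows D (orient D A N1) = fst (factor_dims D A)"
    "term_cols (orient D A N1) = snd (factor_dims D A)"
    using 1 by (cases A; simp add: compatible_transp term_rows_transp)+
  then show ?case using 2 Times.prems N(3) by (simp add: compatible_app term_rows_app)
qed

text \<open>Matrix products are bilinear: the first factor and, by induction, the rest are expanded,
  and the sum over the inner index is then moved inside the sum over all pairs of summands.\<close>

lemma entry_subst_term:
  assumes "wf_subst D \<sigma>"
    and V: "\<And>s u v. u < fst (D s) \<Longrightarrow> v < snd (D s) \<Longrightarrow>
      V s u v = (\<Sum>(c, N)\<leftarrow>\<sigma> s. c * entry D V' N u v)"
    and "compatible D M" "i < term_rows D M" "j < term_cols M"
  shows "entry D V M i j = (\<Sum>(c, N)\<leftarrow>subst_term D \<sigma> M. c * entry D V' N i j)"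
  using assms(3-)
proof (induction M arbitrary: i)
  case (Id n)
  then show ?case by simp
next
  case (Times A M)
  let ?n = "snd (factor_dims D A)"
  have fac: "factor_entry V A i k = (\<Sum>(c, N)\<leftarrow>\<sigma> (symbol A). c * entry D V' (orient D A N) i k)"
    if "k < ?n" for k
  proof (cases A)
    case (Plain s)
    then show ?thesis using V[of i s k] that Times.prems by simp
  next
    case (Transp s)
    have "entry D V' (word_transp D N) i k = entry D V' N k i" if "(c, N) \<in> set (\<sigma> s)" for c N
      using assms(1) that \<open>k < ?n\<close> Times.prems Transp
      by (intro entry_transp) (fastforce simp: wf_subst_def)+
    then show ?thesis using V[of k s i] that Times.prems Transp
      by (auto intro!: arg_cong[where f=sum_list] map_cong)
  qed
  have app: "entry D V' (app (orient D A N) N') i j =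
      (\<Sum>k<?n. entry D V' (orient D A N) i k * entry D V' N' k j)"
    if "(c, N) \<in> set (\<sigma> (symbol A))" for c N N'
  proof -
    have "compatible D N \<and> term_rows D N = fst (D (symbol A)) \<and> term_cols N = snd (D (symbol A))"
      using assms(1) that by (fastforce simp: wf_subst_def)
    then show ?thesis using Times.prems
      by (cases A; simp add: entry_app compatible_transp term_rows_transp)
  qed
  have "entry D V (Times A M) i j = (\<Sum>k<?n. (\<Sum>(c, N)\<leftarrow>\<sigma> (symbol A). c * entry D V' (orient D A N) i k) *
      (\<Sum>(c, N)\<leftarrow>subst_term D \<sigma> M. c * entry D V' N k j))"
    using Times fac by simp
  also have "\<dots> = (\<Sum>k<?n. (\<Sum>(x, y)\<leftarrow>List.product (\<sigma> (symbol A)) (subst_term D \<sigma> M).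
      (fst x * entry D V' (orient D A (snd x)) i k) * (fst y * entry D V' (snd y) k j)))"
    by (simp add: case_prod_unfold flip: sum_list_product)
  also have "\<dots> = (\<Sum>(x, y)\<leftarrow>List.product (\<sigma> (symbol A)) (subst_term D \<sigma> M). \<Sum>k<?n.
      (fst x * entry D V' (orient D A (snd x)) i k) * (fst y * entry D V' (snd y) k j))"
    by (simp add: sum_list_sum_swap case_prod_unfold)
  also have "\<dots> = (\<Sum>(x, y)\<leftarrow>List.product (\<sigma> (symbol A)) (subst_term D \<sigma> M).
      fst x * fst y * entry D V' (app (orient D A (snd x)) (snd y)) i j)"
  proof (intro arg_cong[where f=sum_list] map_cong refl)
    fix xy assume "xy \<in> set (List.product (\<sigma> (symbol A)) (subst_term D \<sigma> M))"
    then obtain x y where "xy = (x, y)" "x \<in> set (\<sigma> (symbol A))" by auto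
    then show "(case xy of (x, y) \<Rightarrow> \<Sum>k<?n.
        (fst x * entry D V' (orient D A (snd x)) i k) * (fst y * entry D V' (snd y) k j)) =
      (case xy of (x, y) \<Rightarrow> fst x * fst y * entry D V' (app (orient D A (snd x)) (snd y)) i j)"
      using app[of "fst x" "snd x" "snd y"] by (simp add: sum_distrib_left mult_ac)
  qed
  finally show ?case by (simp add: comp_def case_prod_unfold)
qed

lemma subst_terms_closed:
  assumes "wf_subst D \<sigma>" "closed_words D w" "(c, v) \<in> set (subst_terms D \<sigma> w)"
  shows "closed_words D v"
  using assms(2,3)
proof (induction w arbitrary: c v)
  case Nil
  then show ?case by simp
next
  case (Cons M w)
  then show ?case using subst_term_wf[OF assms(1), of M] by (auto simp: square_term_def)
qed

lemma traces_subst_terms: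
  assumes "wf_subst D \<sigma>"
    and V: "\<And>s u v. u < fst (D s) \<Longrightarrow> v < snd (D s) \<Longrightarrow>
      V s u v = (\<Sum>(c, N)\<leftarrow>\<sigma> s. c * entry D V' N u v)"
    and "closed_words D w"
  shows "traces D V w = (\<Sum>(c, v)\<leftarrow>subst_terms D \<sigma> w. c * traces D V' v)"
  using assms(3)
proof (induction w)
  case Nil
  then show ?case by simp
next
  case (Cons M w)
  have "word_trace D V M = (\<Sum>i<term_rows D M. \<Sum>(c, N)\<leftarrow>subst_term D \<sigma> M. c * entry D V' N i i)"
    using Cons.prems by (auto simp: word_trace_def square_term_def intro!: sum.cong entry_subst_term[OF assms(1) V])
  also have "\<dots> = (\<Sum>(c, N)\<leftarrow>subst_term D \<sigma> M. \<Sum>i<term_rows D M. c * entry D V' N i i)"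
    by (simp add: sum_list_sum_swap case_prod_unfold)
  also have "\<dots> = (\<Sum>(c, N)\<leftarrow>subst_term D \<sigma> M. c * word_trace D V' N)"
    using subst_term_wf[OF assms(1)] Cons.prems
    by (fastforce simp: word_trace_def sum_distrib_left intro!: arg_cong[where f=sum_list] map_cong)
  finally have "traces D V (M # w) = (\<Sum>(x, y)\<leftarrow>List.product (subst_term D \<sigma> M) (subst_terms D \<sigma> w).
      (fst x * word_trace D V' (snd x)) * (fst y * traces D V' (snd y)))"
    using Cons by (simp add: case_prod_unfold flip: sum_list_product)
  then show ?case by (simp add: comp_def case_prod_unfold mult_ac)
qed

text \<open>The bound holds per symbol and adds up along the word; the orientation of a factor does
  not affect its count.\<close>

lemma weight_subst_term:
  assumes "\<And>s c N. (c, N) \<in> set (\<sigma> s) \<Longrightarrow> weight f N \<le> g s"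
    and "(c, N) \<in> set (subst_term D \<sigma> M)"
  shows "weight f N \<le> weight g M"
  using assms(2)
proof (induction M arbitrary: c N)
  case (Id n)
  then show ?case by simp
next
  case (Times A M)
  have "weight f (orient D A P) = weight f P" for P by (cases A) auto
  then show ?case using Times assms(1) by (fastforce intro: add_mono)
qed

lemma weights_subst_terms:
  assumes "\<And>s c N. (c, N) \<in> set (\<sigma> s) \<Longrightarrow> weight f N \<le> g s"
    and "(c, v) \<in> set (subst_terms D \<sigma> w)"
  shows "weights f v \<le> weights g w"
  using assms(2)
proof (induction w arbitrary: c v)
  case Nil
  then show ?case by simp
next
  case (Cons M w)
  then show ?case using weight_subst_term[OF assms(1)] by (fastforce intro: add_mono)
qed

section \<open>Contractions\<close>

text \<open>The Leibniz rule for a matrix product, where \<open>dV\<close> is the derivative of the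
  symbol values in a direction that is left open.\<close>

primrec dentry ::
  "('s \<Rightarrow> nat \<times> nat) \<Rightarrow> ('s \<Rightarrow> nat \<Rightarrow> nat \<Rightarrow> real) \<Rightarrow> ('s \<Rightarrow> nat \<Rightarrow> nat \<Rightarrow> real) \<Rightarrow>
   's mterm \<Rightarrow> nat \<Rightarrow> nat \<Rightarrow> real" where
  "dentry D V dV (Id n) i j = 0"
| "dentry D V dV (Times A M) i j = (\<Sum>k<snd (factor_dims D A).
     factor_entry dV A i k * entry D V M k j + factor_entry V A i k * dentry D V dV M k j)"

definition dtrace where
  "dtrace D V dV M = (\<Sum>i<term_rows D M. dentry D V dV M i i)"

primrec dtraces where
  "dtraces D V dV [] = 0"
| "dtraces D V dV (M # w) = dtrace D V dV M * traces D V w + word_trace D V M * dtraces D V dV w"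

text \<open>Linearity in \<open>dV\<close> allows a sum over samples of partial derivatives to be
  replaced by one derivative along the averaged direction.\<close>

lemma dentry_linear:
  "(\<Sum>l\<in>I. c l * dentry D V (dV l) M i j) = dentry D V (\<lambda>s u v. \<Sum>l\<in>I. c l * dV l s u v) M i j"
proof (induction M arbitrary: i)
  case (Id n)
  then show ?case by simp
next
  case (Times A M)
  let ?n = "snd (factor_dims D A)"
  let ?dV = "\<lambda>s u v. \<Sum>l\<in>I. c l * dV l s u v"
  have fac: "factor_entry ?dV A i k = (\<Sum>l\<in>I. c l * factor_entry (dV l) A i k)" for k
    by (cases A) auto
  have "(\<Sum>l\<in>I. c l * dentry D V (dV l) (Times A M) i j) = (\<Sum>l\<in>I. \<Sum>k<?n.
      c l * factor_entry (dV l) A i k * entry D V M k j +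
      factor_entry V A i k * (c l * dentry D V (dV l) M k j))"
    by (simp add: sum_distrib_left algebra_simps)
  also have "\<dots> = (\<Sum>k<?n. \<Sum>l\<in>I.
      c l * factor_entry (dV l) A i k * entry D V M k j +
      factor_entry V A i k * (c l * dentry D V (dV l) M k j))"
    by (rule sum.swap)
  also have "\<dots> = (\<Sum>k<?n. (\<Sum>l\<in>I. c l * factor_entry (dV l) A i k) * entry D V M k j +
      factor_entry V A i k * (\<Sum>l\<in>I. c l * dentry D V (dV l) M k j))"
    by (simp only: sum.distrib sum_distrib_left sum_distrib_right)
  also have "\<dots> = dentry D V ?dV (Times A M) i j"
    by (simp only: fac Times.IH dentry.simps)
  finally show ?case .
qed

lemma dtrace_linear:
  "(\<Sum>l\<in>I. c l * dtrace D V (dV l) M) = dtrace D V (\<lambda>s u v. \<Sum>l\<in>I. c l * dV l s u v) M"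
proof -
  have "(\<Sum>l\<in>I. c l * dtrace D V (dV l) M) = (\<Sum>l\<in>I. \<Sum>i<term_rows D M. c l * dentry D V (dV l) M i i)"
    by (simp add: dtrace_def sum_distrib_left)
  also have "\<dots> = (\<Sum>i<term_rows D M. \<Sum>l\<in>I. c l * dentry D V (dV l) M i i)"
    by (rule sum.swap)
  finally show ?thesis by (simp add: dentry_linear dtrace_def)
qed

lemma dtraces_linear:
  "(\<Sum>l\<in>I. c l * dtraces D V (dV l) w) = dtraces D V (\<lambda>s u v. \<Sum>l\<in>I. c l * dV l s u v) w"
proof (induction w)
  case Nil
  then show ?case by simp
next
  case (Cons M w)
  have "(\<Sum>l\<in>I. c l * dtraces D V (dV l) (M # w)) =
      (\<Sum>l\<in>I. c l * dtrace D V (dV l) M) * traces D V w +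
      word_trace D V M * (\<Sum>l\<in>I. c l * dtraces D V (dV l) w)"
    by (simp add: sum_distrib_left sum_distrib_right sum.distrib algebra_simps)
  then show ?case by (simp add: Cons dtrace_linear)
qed

section \<open>Cutting and rejoining cyclic words at a symmetric symbol\<close>

locale square_symbol =
  fixes D :: "'s \<Rightarrow> nat \<times> nat" and S :: 's and p :: nat
  assumes D_S [simp]: "D S = (p, p)"
begin

text \<open>Lists the decompositions of a word as \<open>P S Q\<close>. A transposed
  \<open>S\<close> is treated like a plain one, which is sound only for valuations with symmetric
  \<open>S\<close>.\<close>

primrec splits :: "'s mterm \<Rightarrow> ('s mterm \<times> 's mterm) list" where
  "splits (Id n) = []"
| "splits (Times A M) = (if symbol A = S then [(Id p, M)] else []) @
     map (\<lambda>(P, Q). (Times A P, Q)) (splits M)"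

abbreviation S1 :: "'s mterm" where
  "S1 \<equiv> Times (Plain S) (Id p)"

abbreviation SQ :: "'s mterm \<Rightarrow> 's mterm" where
  "SQ Q \<equiv> Times (Plain S) Q"

lemma factor_dims_S: "symbol A = S \<Longrightarrow> factor_dims D A = (p, p)"
  by (cases A; simp)

lemma splits_wf:
  assumes "compatible D M" "(P, Q) \<in> set (splits M)"
  shows "compatible D P" "compatible D Q" "term_rows D P = term_rows D M" "term_cols P = p"
    "term_rows D Q = p" "term_cols Q = term_cols M"
    "weight f P + f S + weight f Q = weight f M"
proof -
  have "compatible D P \<and> compatible D Q \<and> term_rows D P = term_rows D M \<and> term_cols P = p \<and>
    term_rows D Q = p \<and> term_cols Q = term_cols M \<and> weight f P + f S + weight f Q = weight f M"
    using assms
  proof (induction M arbitrary: P Q)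
    case (Id n)
    then show ?case by simp
  next
    case (Times A M)
    show ?case
    proof (cases "symbol A = S \<and> (P, Q) = (Id p, M)")
      case True
      then show ?thesis using Times.prems by (auto simp: factor_dims_S)
    next
      case False
      then obtain P' where "(P', Q) \<in> set (splits M)" "P = Times A P'"
        using Times.prems by (auto split: if_splits)
      moreover have "compatible D M" "snd (factor_dims D A) = term_rows D M"
        using Times.prems by auto
      ultimately show ?thesis using Times.IH[of P' Q] by simp
    qed
  qed
  then show "compatible D P" "compatible D Q" "term_rows D P = term_rows D M" "term_cols P = p"
    "term_rows D Q = p" "term_cols Q = term_cols M" "weight f P + f S + weight f Q = weight f M"
    by auto
qed

text \<open>Up to the factor \<open>1 / b\<close>, this is what becomes of \<open>S\<close> when it is differentiated along the
  \<open>a\<close>-th coordinate of a sample and the remaining free coordinate is averaged against the \<open>c\<close>-th one.\<close>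

definition contraction :: "('s \<Rightarrow> nat \<Rightarrow> nat \<Rightarrow> real) \<Rightarrow> nat \<Rightarrow> nat \<Rightarrow> 's \<Rightarrow> nat \<Rightarrow> nat \<Rightarrow> real" where
  "contraction V a c s u v =
     (if s = S then of_bool (a = u) * V S c v + of_bool (a = v) * V S c u else 0)"

lemma entry_S1: "i < p \<Longrightarrow> c < p \<Longrightarrow> entry D V S1 i c = V S i c"
  by (simp add: sum_delta_lessThan)

text \<open>At each occurrence \<open>P S Q\<close> the matrix \<open>S\<close> is replaced by two
  matrices of rank one: the unit vector at \<open>a\<close> times row \<open>c\<close> of
  \<open>S\<close>, and column \<open>c\<close> of \<open>S\<close> times the transposed unit
  vector. Both break the word in two, with the surviving \<open>S\<close> going to the right or to
  the left part.\<close>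

lemma dentry_contraction:
  assumes V: "\<And>u v. V S u v = V S v u" and "a < p" "c < p"
    and "compatible D M" "i < term_rows D M"
  shows "dentry D V (contraction V a c) M i j = (\<Sum>(P, Q)\<leftarrow>splits M.
    entry D V P i a * entry D V (SQ Q) c j + entry D V (app P S1) i c * entry D V Q a j)"
  using assms(4,5)
proof (induction M arbitrary: i)
  case (Id n)
  then show ?case by simp
next
  case (Times A M)
  let ?n = "snd (factor_dims D A)"
  let ?g = "\<lambda>i P Q. entry D V P i a * entry D V (SQ Q) c j + entry D V (app P S1) i c * entry D V Q a j"
  \<comment> \<open>The derivative falls behind \<open>A\<close>: both summands of the induction
    hypothesis are linear in the left part \<open>P\<close>, which is prolonged by
    \<open>A\<close>.\<close>
  have 1: "(\<Sum>k<?n. factor_entry V A i k * dentry D V (contraction V a c) M k j) =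
      (\<Sum>(P, Q)\<leftarrow>splits M. ?g i (Times A P) Q)"
  proof -
    have "(\<Sum>k<?n. factor_entry V A i k * dentry D V (contraction V a c) M k j) =
        (\<Sum>k<?n. \<Sum>(P, Q)\<leftarrow>splits M. factor_entry V A i k * ?g k P Q)"
      using Times by (intro sum.cong refl) (simp add: case_prod_unfold sum_list_const_mult del: entry.simps)
    also have "\<dots> = (\<Sum>(P, Q)\<leftarrow>splits M. \<Sum>k<?n. factor_entry V A i k * ?g k P Q)"
      by (simp add: case_prod_unfold sum_list_sum_swap)
    also have "\<dots> = (\<Sum>(P, Q)\<leftarrow>splits M. ?g i (Times A P) Q)"
    proof -
      have "(\<Sum>k<n. f k * (x k * s + y k * t)) = (\<Sum>k<n. f k * x k) * s + (\<Sum>k<n. f k * y k) * t"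
        for n :: nat and f x y and s t :: real
        by (simp add: sum_distrib_right sum.distrib distrib_left mult.assoc)
      then show ?thesis
        by (simp only: app.simps entry.simps(2)[of D V A])
    qed
    finally show ?thesis .
  qed
  \<comment> \<open>The derivative falls on \<open>A\<close> itself. This accounts for the split
    with empty left part; symmetry turns \<open>V S c i\<close> into an entry of
    \<open>S1\<close>.\<close>
  have 2: "(\<Sum>k<?n. factor_entry (contraction V a c) A i k * entry D V M k j) =
      (if symbol A = S then ?g i (Id p) M else 0)"
  proof (cases "symbol A = S")
    case True
    have n: "?n = p" "i < p" using True Times.prems by (auto simp: factor_dims_S)
    have fac: "factor_entry (contraction V a c) A i k = of_bool (a = i) * V S c k + of_bool (a = k) * V S c i" for k
      using True by (cases A) (auto simp: contraction_def)
    have "(\<Sum>k<p. factor_entry (contraction V a c) A i k * entry D V M k j) =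
        of_bool (a = i) * (\<Sum>k<p. V S c k * entry D V M k j) +
        (\<Sum>k<p. of_bool (a = k) * (V S c i * entry D V M k j))"
      by (simp only: fac distrib_right sum.distrib sum_distrib_left mult.assoc)
    also have "\<dots> = ?g i (Id p) M"
      using n \<open>a < p\<close> \<open>c < p\<close> V[of c i] by (simp only: sum_delta_lessThan entry_S1 app.simps) auto
    finally show ?thesis using True n by simp
  next
    case False
    then have "factor_entry (contraction V a c) A i k = 0" for k
      by (cases A) (auto simp: contraction_def)
    then show ?thesis using False by simp
  qed
  have "dentry D V (contraction V a c) (Times A M) i j =
      (\<Sum>k<?n. factor_entry (contraction V a c) A i k * entry D V M k j) +
      (\<Sum>k<?n. factor_entry V A i k * dentry D V (contraction V a c) M k j)"
    by (simp only: dentry.simps sum.distrib)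
  then show ?case
    unfolding 1 2 by (simp add: comp_def case_prod_unfold del: entry.simps)
qed

lemma sum_list_concat_pairs:
  "(\<Sum>v\<leftarrow>concat (map (\<lambda>(P, Q). [f P Q, g P Q]) xs). h v) = (\<Sum>(P, Q)\<leftarrow>xs. h (f P Q) + (h (g P Q) :: real))"
  by (induction xs) auto

text \<open>For tr(S A) with \<open>A = P S Q\<close>, one contraction reconnects the cycle to a
  single one with \<open>P\<close> reversed, the other cuts it into tr(P S) and tr(Q). The second is
  the source of additional traces.\<close>

definition self_contractions :: "'s mterm \<Rightarrow> 's mterm list list" where
  "self_contractions A = concat (map (\<lambda>(P, Q).
     [[app (word_transp D P) (SQ Q)], [app P S1, Q]]) (splits A))"

text \<open>For tr(S A) and another cycle \<open>P S Q\<close>, both contractions merge the two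
  cycles: \<open>A\<close> is inserted either transposed in front of \<open>S\<close> or as it
  stands behind \<open>S\<close>.\<close>

primrec cross_contractions :: "'s mterm \<Rightarrow> 's mterm list \<Rightarrow> 's mterm list list" where
  "cross_contractions A [] = []"
| "cross_contractions A (M # w) = concat (map (\<lambda>(P, Q).
     [app (SQ Q) (app P (word_transp D A)) # w, app (app P S1) (app A Q) # w]) (splits M)) @
     map ((#) M) (cross_contractions A w)"

definition contractions :: "'s mterm \<Rightarrow> 's mterm list \<Rightarrow> 's mterm list list" where
  "contractions A w = map (\<lambda>v. v @ w) (self_contractions A) @ cross_contractions A w"

lemma self_contractions_wf:
  assumes "compatible D A" "term_rows D A = p" "term_cols A = p" "v \<in> set (self_contractions A)"
  shows "closed_words D v" "weights f v = weight f A"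
proof -
  from assms(4) obtain P Q where PQ: "(P, Q) \<in> set (splits A)"
    and v: "v = [app (word_transp D P) (SQ Q)] \<or> v = [app P S1, Q]"
    by (auto simp: self_contractions_def)
  note wf = splits_wf[OF assms(1) PQ]
  show "closed_words D v"
    using v wf assms(2,3)
    by (auto simp: square_term_def compatible_app compatible_transp term_rows_app term_rows_transp)
  show "weights f v = weight f A"
    using v wf(7)[of f] by auto
qed

lemma cross_contractions_wf:
  assumes "compatible D A" "term_rows D A = p" "term_cols A = p" "closed_words D w"
    and "v \<in> set (cross_contractions A w)"
  shows "closed_words D v \<and> weights f v = weight f A + weights f w"
  using assms(4,5)
proof (induction w arbitrary: v)
  case Nil
  then show ?case by simp
next
  case (Cons M w)
  then consider (rest) v' where "v' \<in> set (cross_contractions A w)" "v = M # v'"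
    | (split) P Q where "(P, Q) \<in> set (splits M)"
      "v = app (SQ Q) (app P (word_transp D A)) # w \<or> v = app (app P S1) (app A Q) # w"
    by fastforce
  then show ?case
  proof cases
    case rest
    then show ?thesis using Cons.IH[of v'] Cons.prems(1) by simp
  next
    case split
    note PQ = split(1) and v = split(2)
    have M: "compatible D M" "square_term D M" "closed_words D w" using Cons.prems(1) by simp_all
    note wf = splits_wf[OF M(1) PQ]
    have sq: "term_rows D M = term_cols M" using M by (simp add: square_term_def)
    have v': "closed_words D (app (SQ Q) (app P (word_transp D A)) # w)"
      "closed_words D (app (app P S1) (app A Q) # w)"
      using wf(1-6) assms(1-3) M(3) sq
      by (simp_all add: square_term_def compatible_app compatible_transp term_rows_app term_rows_transp)
    have "weights f v = f S + weight f P + weight f Q + weight f A + weights f w"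
      using v by (elim disjE) simp_all
    then have "weights f v = weight f A + weights f (M # w)"
      using wf(7)[of f] by simp
    moreover have "closed_words D v" using v v' by blast
    ultimately show ?thesis by simp
  qed
qed

text \<open>The leading \<open>S\<close> of tr(S A) is absent from the right-hand count: exactly one
  \<open>S\<close> is used up, and every other symbol survives. This makes the elimination terminate
  and keeps the degrees under control.\<close>

lemma contractions_wf:
  assumes "compatible D A" "term_rows D A = p" "term_cols A = p" "closed_words D w"
    and "v \<in> set (contractions A w)"
  shows "closed_words D v" "weights f v = weight f A + weights f w"
  using assms self_contractions_wf[OF assms(1-3)] cross_contractions_wf[OF assms(1-4)]
  by (auto simp: contractions_def)

text \<open>Summation over \<open>a\<close> and \<open>c\<close> closes the loose ends of
  \<open>dentry_contraction\<close>. The product of P at (c, a) and S Q at (c, a) becomes a trace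
  once \<open>P\<close> is transposed, while P S at (c, c) and Q at (a, a) separate into two
  traces.\<close>

lemma self_contractions:
  assumes V: "\<And>u v. V S u v = V S v u"
    and A: "compatible D A" "term_rows D A = p" "term_cols A = p"
  shows "(\<Sum>a<p. \<Sum>c<p. dentry D V (contraction V a c) A c a) =
    (\<Sum>v\<leftarrow>self_contractions A. traces D V v)"
proof -
  let ?g = "\<lambda>a c P Q. entry D V P c a * entry D V (SQ Q) c a + entry D V (app P S1) c c * entry D V Q a a"
  have PQ: "(\<Sum>a<p. \<Sum>c<p. ?g a c P Q) =
      traces D V [app (word_transp D P) (SQ Q)] + traces D V [app P S1, Q]"
    if "(P, Q) \<in> set (splits A)" for P Q
  proof -
    note wf = splits_wf[OF A(1) that]
    have "word_trace D V (app (word_transp D P) (SQ Q)) =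
        (\<Sum>a<p. \<Sum>c<p. entry D V (word_transp D P) a c * entry D V (SQ Q) c a)"
      using wf A by (simp add: trace_app compatible_transp term_rows_transp)
    also have "\<dots> = (\<Sum>a<p. \<Sum>c<p. entry D V P c a * entry D V (SQ Q) c a)"
      using wf A by (intro sum.cong) (auto simp: entry_transp)
    finally have 1: "word_trace D V (app (word_transp D P) (SQ Q)) =
        (\<Sum>a<p. \<Sum>c<p. entry D V P c a * entry D V (SQ Q) c a)" .
    have 2: "word_trace D V (app P S1) * word_trace D V Q =
        (\<Sum>a<p. \<Sum>c<p. entry D V (app P S1) c c * entry D V Q a a)"
      using wf A by (simp add: word_trace_def term_rows_app sum_distrib_left sum_distrib_right)
    show ?thesis using 1 2 by (simp add: sum.distrib)
  qed
  have "(\<Sum>a<p. \<Sum>c<p. dentry D V (contraction V a c) A c a) =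
      (\<Sum>a<p. \<Sum>c<p. \<Sum>(P, Q)\<leftarrow>splits A. ?g a c P Q)"
    using A by (intro sum.cong refl dentry_contraction[of V, OF V]) auto
  also have "\<dots> = (\<Sum>(P, Q)\<leftarrow>splits A. \<Sum>a<p. \<Sum>c<p. ?g a c P Q)"
    by (simp only: case_prod_unfold sum_list_sum_swap)
  also have "\<dots> = (\<Sum>(P, Q)\<leftarrow>splits A.
      traces D V [app (word_transp D P) (SQ Q)] + traces D V [app P S1, Q])"
    using PQ by (intro arg_cong[where f=sum_list] map_cong) auto
  also have "\<dots> = (\<Sum>v\<leftarrow>self_contractions A. traces D V v)"
    by (simp only: self_contractions_def sum_list_concat_pairs)
  finally show ?thesis .
qed

text \<open>Here the entry of \<open>A\<close> at (c, a) links the loose ends left in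
  \<open>M\<close>. The order of the four nested sums is all that has to be rearranged.\<close>

lemma cross_contractions:
  assumes V: "\<And>u v. V S u v = V S v u"
    and A: "compatible D A" "term_rows D A = p" "term_cols A = p" and "closed_words D w"
  shows "(\<Sum>a<p. \<Sum>c<p. entry D V A c a * dtraces D V (contraction V a c) w) =
    (\<Sum>v\<leftarrow>cross_contractions A w. traces D V v)"
  using assms(5)
proof (induction w)
  case Nil
  then show ?case by simp
next
  case (Cons M w)
  then have M: "compatible D M" "term_cols M = term_rows D M" by (auto simp: square_term_def)
  let ?n = "term_rows D M"
  let ?g = "\<lambda>a c i P Q. entry D V P i a * entry D V (SQ Q) c i + entry D V (app P S1) i c * entry D V Q a i"
  have PQ: "(\<Sum>a<p. \<Sum>c<p. \<Sum>i<?n. entry D V A c a * ?g a c i P Q) =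
      word_trace D V (app (SQ Q) (app P (word_transp D A))) + word_trace D V (app (app P S1) (app A Q))"
    if "(P, Q) \<in> set (splits M)" for P Q
  proof -
    note wf = splits_wf[OF M(1) that]
    have "word_trace D V (app (SQ Q) (app P (word_transp D A))) =
        (\<Sum>c<p. \<Sum>i<?n. entry D V (SQ Q) c i * entry D V (app P (word_transp D A)) i c)"
      using wf A M by (subst trace_app) (auto simp: compatible_app compatible_transp term_rows_app term_rows_transp)
    also have "\<dots> = (\<Sum>c<p. \<Sum>i<?n. \<Sum>a<p. entry D V A c a * (entry D V P i a * entry D V (SQ Q) c i))"
    proof (intro sum.cong refl)
      fix c i assume "c \<in> {..<p}" "i \<in> {..<?n}"
      then have "entry D V (app P (word_transp D A)) i c = (\<Sum>a<p. entry D V P i a * entry D V A c a)"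
        using wf A by (simp add: entry_app entry_transp)
      then show "entry D V (SQ Q) c i * entry D V (app P (word_transp D A)) i c =
          (\<Sum>a<p. entry D V A c a * (entry D V P i a * entry D V (SQ Q) c i))"
        by (simp add: sum_distrib_left mult_ac)
    qed
    also have "\<dots> = (\<Sum>c<p. \<Sum>a<p. \<Sum>i<?n. entry D V A c a * (entry D V P i a * entry D V (SQ Q) c i))"
      by (intro sum.cong refl sum.swap)
    also have "\<dots> = (\<Sum>a<p. \<Sum>c<p. \<Sum>i<?n. entry D V A c a * (entry D V P i a * entry D V (SQ Q) c i))"
      by (rule sum.swap)
    finally have 1: "word_trace D V (app (SQ Q) (app P (word_transp D A))) = \<dots>" .
    have "word_trace D V (app (app P S1) (app A Q)) =
        (\<Sum>i<?n. \<Sum>c<p. entry D V (app P S1) i c * entry D V (app A Q) c i)"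
      using wf A M by (subst trace_app) (auto simp: compatible_app term_rows_app)
    also have "\<dots> = (\<Sum>i<?n. \<Sum>c<p. \<Sum>a<p. entry D V A c a * (entry D V (app P S1) i c * entry D V Q a i))"
    proof (intro sum.cong refl)
      fix c i assume "c \<in> {..<p}" "i \<in> {..<?n}"
      then have "entry D V (app A Q) c i = (\<Sum>a<p. entry D V A c a * entry D V Q a i)"
        using wf A by (simp add: entry_app)
      then show "entry D V (app P S1) i c * entry D V (app A Q) c i =
          (\<Sum>a<p. entry D V A c a * (entry D V (app P S1) i c * entry D V Q a i))"
        by (simp add: sum_distrib_left mult_ac)
    qed
    also have "\<dots> = (\<Sum>i<?n. \<Sum>a<p. \<Sum>c<p. entry D V A c a * (entry D V (app P S1) i c * entry D V Q a i))"
      by (intro sum.cong refl sum.swap)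
    also have "\<dots> = (\<Sum>a<p. \<Sum>i<?n. \<Sum>c<p. entry D V A c a * (entry D V (app P S1) i c * entry D V Q a i))"
      by (rule sum.swap)
    also have "\<dots> = (\<Sum>a<p. \<Sum>c<p. \<Sum>i<?n. entry D V A c a * (entry D V (app P S1) i c * entry D V Q a i))"
      by (intro sum.cong refl sum.swap)
    finally have 2: "word_trace D V (app (app P S1) (app A Q)) = \<dots>" .
    show ?thesis using 1 2 by (simp only: distrib_left sum.distrib)
  qed
  have "(\<Sum>a<p. \<Sum>c<p. entry D V A c a * dtrace D V (contraction V a c) M) =
      (\<Sum>a<p. \<Sum>c<p. \<Sum>i<?n. \<Sum>(P, Q)\<leftarrow>splits M. entry D V A c a * ?g a c i P Q)"
  proof (intro sum.cong refl)
    fix a c assume "a \<in> {..<p}" "c \<in> {..<p}"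
    then have "dentry D V (contraction V a c) M i i = (\<Sum>(P, Q)\<leftarrow>splits M. ?g a c i P Q)"
      if "i < ?n" for i
      using that M(1) by (intro dentry_contraction[of V, OF V]) auto
    then show "entry D V A c a * dtrace D V (contraction V a c) M =
        (\<Sum>i<?n. \<Sum>(P, Q)\<leftarrow>splits M. entry D V A c a * ?g a c i P Q)"
      by (simp add: dtrace_def sum_distrib_left case_prod_unfold flip: sum_list_const_mult)
  qed
  also have "\<dots> = (\<Sum>(P, Q)\<leftarrow>splits M. \<Sum>a<p. \<Sum>c<p. \<Sum>i<?n. entry D V A c a * ?g a c i P Q)"
    by (simp only: case_prod_unfold sum_list_sum_swap)
  also have "\<dots> = (\<Sum>(P, Q)\<leftarrow>splits M.
      word_trace D V (app (SQ Q) (app P (word_transp D A))) + word_trace D V (app (app P S1) (app A Q)))"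
    using PQ by (intro arg_cong[where f=sum_list] map_cong) auto
  finally have 3: "(\<Sum>a<p. \<Sum>c<p. entry D V A c a * dtrace D V (contraction V a c) M) * traces D V w =
      (\<Sum>(P, Q)\<leftarrow>splits M. (word_trace D V (app (SQ Q) (app P (word_transp D A))) +
         word_trace D V (app (app P S1) (app A Q))) * traces D V w)"
    by (simp add: sum_list_mult_const case_prod_unfold)
  have 4: "\<dots> = (\<Sum>v\<leftarrow>concat (map (\<lambda>(P, Q).
     [app (SQ Q) (app P (word_transp D A)) # w, app (app P S1) (app A Q) # w]) (splits M)). traces D V v)"
    by (simp only: sum_list_concat_pairs traces_simps distrib_right)
  have "(\<Sum>a<p. \<Sum>c<p. entry D V A c a * dtraces D V (contraction V a c) (M # w)) =
      (\<Sum>a<p. \<Sum>c<p. entry D V A c a * dtrace D V (contraction V a c) M) * traces D V w +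
      word_trace D V M * (\<Sum>a<p. \<Sum>c<p. entry D V A c a * dtraces D V (contraction V a c) w)"
    by (simp add: sum_distrib_left sum_distrib_right sum.distrib algebra_simps)
  also have "(\<Sum>a<p. \<Sum>c<p. entry D V A c a * dtraces D V (contraction V a c) w) =
      (\<Sum>v\<leftarrow>cross_contractions A w. traces D V v)"
    using Cons by simp
  finally show ?case
    unfolding 3 4 by (simp add: comp_def sum_list_const_mult)
qed

lemma contractions:
  assumes V: "\<And>u v. V S u v = V S v u"
    and A: "compatible D A" "term_rows D A = p" "term_cols A = p" and "closed_words D w"
  shows "(\<Sum>a<p. \<Sum>c<p. dentry D V (contraction V a c) A c a * traces D V w +
      entry D V A c a * dtraces D V (contraction V a c) w) =
    (\<Sum>v\<leftarrow>contractions A w. traces D V v)"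
proof -
  have "(\<Sum>v\<leftarrow>contractions A w. traces D V v) =
      (\<Sum>v\<leftarrow>self_contractions A. traces D V v) * traces D V w +
      (\<Sum>v\<leftarrow>cross_contractions A w. traces D V v)"
    by (simp add: contractions_def comp_def sum_list_mult_const)
  then show ?thesis
    by (simp add: self_contractions[of V, OF V A, symmetric] cross_contractions[of V, OF V A assms(5), symmetric]
        sum.distrib sum_distrib_right)
qed

end

section \<open>Gaussian integration by parts\<close>

definition gauss_moment :: "nat \<Rightarrow> real" where
  "gauss_moment n = integral\<^sup>L (density lborel std_normal_density) (\<lambda>x. x ^ n)"

lemma gauss_moment_even: "gauss_moment (2 * k) = fact (2 * k) / (2 ^ k * fact k)"
  using integral_normal_moment_even[of 1 0 k] by (simp add: gauss_moment_def integral_density)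

lemma gauss_moment_odd: "gauss_moment (2 * k + 1) = 0"
  using integral_normal_moment_odd[of 1 0 k] by (simp add: gauss_moment_def integral_density)

lemma integrable_gauss_power: "integrable (density lborel std_normal_density) (\<lambda>x. x ^ n)"
  using integrable_normal_moment[of 1 0 n] by (simp add: integrable_density)

lemma gauss_moment_0 [simp]: "gauss_moment 0 = 1"
  using gauss_moment_even[of 0] by simp

text \<open>Stein's identity on powers, read off from the closed form of the moments by parity. At
  \<open>n = 0\<close> the truncated index \<open>n - 1\<close> is harmless because of the factor
  \<open>real n\<close>.\<close>

lemma gauss_moment_Suc: "gauss_moment (Suc n) = real n * gauss_moment (n - 1)"
proof (cases "even n")
  case True
  then obtain k where "n = 2 * k" by (elim evenE)
  moreover have "gauss_moment (n - 1) = 0 \<or> n = 0"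
  proof (cases k)
    case (Suc l)
    then have "n - 1 = 2 * l + 1" using \<open>n = 2 * k\<close> by simp
    then show ?thesis using gauss_moment_odd[of l] by simp
  qed (simp add: \<open>n = 2 * k\<close>)
  ultimately show ?thesis using gauss_moment_odd[of k] by auto
next
  case False
  then obtain k where n: "n = 2 * k + 1" by (elim oddE)
  then have "gauss_moment (Suc n) = gauss_moment (2 * Suc k)" by simp
  also have "\<dots> = real n * gauss_moment (2 * k)"
  proof -
    \<comment> \<open>The common factor 2(k+1) is isolated in numerator and denominator, so that it
      cancels and \<open>n = 2 * k + 1\<close> remains.\<close>
    have "(fact (2 * Suc k) :: real) = (2 * real (Suc k)) * (real n * fact (2 * k))"
      by (simp add: n algebra_simps)
    moreover have "(2::real) ^ Suc k * fact (Suc k) = (2 * real (Suc k)) * (2 ^ k * fact k)"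
      by (simp add: algebra_simps)
    ultimately show ?thesis
      unfolding gauss_moment_even by (simp only: mult_divide_mult_cancel_left_if) simp
  qed
  finally show ?thesis using n by simp
qed

lemma prod_list_count:
  fixes f :: "'b \<Rightarrow> real"
  assumes "finite B" "set zs \<subseteq> B"
  shows "(\<Prod>z\<leftarrow>zs. f z) = (\<Prod>z\<in>B. f z ^ count_list zs z)"
  using assms(2)
proof (induction zs)
  case Nil
  then show ?case by simp
next
  case (Cons w zs)
  have "(\<Prod>z\<in>B. f z ^ count_list (w # zs) z) = (\<Prod>z\<in>B. (if z = w then f z else 1) * f z ^ count_list zs z)"
    by (intro prod.cong) auto
  also have "\<dots> = f w * (\<Prod>z\<in>B. f z ^ count_list zs z)"
    using Cons.prems assms(1) by (simp add: prod.distrib)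
  finally show ?case using Cons by simp
qed

lemma count_list_remove1: "count_list (remove1 z zs) u = count_list zs u - of_bool (u = z)"
  by (induction zs) auto

locale gaussian_family = prob_space \<Omega>
  for \<Omega> :: "'a measure" +
  fixes p b :: nat and x :: "nat \<Rightarrow> nat \<Rightarrow> 'a \<Rightarrow> nat \<Rightarrow> real"
  assumes samples: "gaussian_samples \<Omega> p b x"
begin

text \<open>The triple consists of iteration, position in the mini-batch, and coordinate of the
  sample.\<close>

definition coord :: "nat \<times> nat \<times> nat \<Rightarrow> 'a \<Rightarrow> real" where
  "coord z \<omega> = x (fst z) (fst (snd z)) \<omega> (snd (snd z))"

definition Vars :: "(nat \<times> nat \<times> nat) set" where
  "Vars = UNIV \<times> {1..b} \<times> {..<p}"

definition monomial :: "(nat \<times> nat \<times> nat) list \<Rightarrow> 'a \<Rightarrow> real" where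
  "monomial zs \<omega> = (\<Prod>z\<leftarrow>zs. coord z \<omega>)"

lemma monomial_simps [simp]: "monomial [] = (\<lambda>_. 1)" "monomial (z # zs) \<omega> = coord z \<omega> * monomial zs \<omega>"
  by (auto simp: monomial_def)

lemma sample_measurable: "i \<in> {1..b} \<Longrightarrow> x s i \<in> measurable \<Omega> (Pi\<^sub>M {..<p} (\<lambda>_. borel))"
  using samples unfolding gaussian_samples_def indep_vars_def by (auto split: prod.splits)

lemma sample_moment:
  fixes n :: "nat \<Rightarrow> nat"
  assumes "i \<in> {1..b}"
  shows "integrable \<Omega> (\<lambda>\<omega>. \<Prod>j<p. x s i \<omega> j ^ n j)"
    and "expectation (\<lambda>\<omega>. \<Prod>j<p. x s i \<omega> j ^ n j) = (\<Prod>j<p. gauss_moment (n j))"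
proof -
  let ?N = "density lborel std_normal_density"
  interpret N: prob_space ?N by (rule prob_space_normal_density) simp
  interpret P: product_sigma_finite "\<lambda>_::nat. ?N" ..
  have meas: "(\<lambda>y :: nat \<Rightarrow> real. \<Prod>j<p. y j ^ n j) \<in> borel_measurable (Pi\<^sub>M {..<p} (\<lambda>_. borel))"
    by (intro borel_measurable_prod borel_measurable_power measurable_component_singleton) auto
  have dist: "distr \<Omega> (Pi\<^sub>M {..<p} (\<lambda>_. borel)) (x s i) = Pi\<^sub>M {..<p} (\<lambda>_. ?N)"
    using samples assms by (simp add: gaussian_samples_def std_gaussian_def)
  have "integrable (Pi\<^sub>M {..<p} (\<lambda>_. ?N)) (\<lambda>y. \<Prod>j<p. y j ^ n j)"
    by (rule P.product_integrable_prod) (auto intro: integrable_gauss_power)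
  then show "integrable \<Omega> (\<lambda>\<omega>. \<Prod>j<p. x s i \<omega> j ^ n j)"
    using integrable_distr_eq[OF sample_measurable[OF assms, of s] meas] by (simp add: dist)
  have "expectation (\<lambda>\<omega>. \<Prod>j<p. x s i \<omega> j ^ n j) = integral\<^sup>L (Pi\<^sub>M {..<p} (\<lambda>_. ?N)) (\<lambda>y. \<Prod>j<p. y j ^ n j)"
    using integral_distr[OF sample_measurable[OF assms, of s] meas] by (simp add: dist)
  also have "\<dots> = (\<Prod>j<p. gauss_moment (n j))"
    unfolding gauss_moment_def
    by (rule P.product_integral_prod) (auto intro: integrable_gauss_power)
  finally show "expectation (\<lambda>\<omega>. \<Prod>j<p. x s i \<omega> j ^ n j) = (\<Prod>j<p. gauss_moment (n j))" .
qed

text \<open>The factors are grouped by sample: samples are independent, and within one sample the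
  coordinates have a product law. \<open>B\<close> may be any finite superset, because absent
  coordinates contribute \<open>gauss_moment 0 = 1\<close>.\<close>

lemma monomial_moment:
  assumes "set zs \<subseteq> Vars"
  shows "integrable \<Omega> (monomial zs)"
    and "finite B \<Longrightarrow> set zs \<subseteq> B \<Longrightarrow> expectation (monomial zs) = (\<Prod>z\<in>B. gauss_moment (count_list zs z))"
proof -
  define J where "J = (\<lambda>(s, i, j). (s, i)) ` set zs"
  let ?n = "\<lambda>si j. count_list zs (fst si, snd si, j)"
  let ?Y = "\<lambda>si \<omega>. \<Prod>j<p. x (fst si) (snd si) \<omega> j ^ ?n si j"
  define C where "C = (\<lambda>((s, i), j). (s, i, j)) ` (J \<times> {..<p})"
  have J: "finite J" "J \<subseteq> UNIV \<times> {1..b}"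
    using assms by (auto simp: J_def Vars_def)
  have inj: "inj_on (\<lambda>((s, i), j). (s, i, j)) (J \<times> {..<p})"
    by (auto simp: inj_on_def)
  have C: "finite C" "set zs \<subseteq> C"
    using J assms by (force simp: C_def J_def Vars_def image_iff)+
  have prodC: "(\<Prod>z\<in>C. f z) = (\<Prod>si\<in>J. \<Prod>j<p. f (fst si, snd si, j))" for f :: "_ \<Rightarrow> real"
    unfolding C_def prod.reindex[OF inj] by (simp add: prod.cartesian_product case_prod_unfold comp_def)
  have monomial: "monomial zs = (\<lambda>\<omega>. \<Prod>si\<in>J. ?Y si \<omega>)"
    by (rule ext) (simp add: monomial_def prod_list_count[OF C] prodC coord_def)
  have "indep_vars (\<lambda>_. Pi\<^sub>M {..<p} (\<lambda>_. borel)) (\<lambda>(s, i). x s i) J"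
    using samples J(2) unfolding gaussian_samples_def by (blast intro: indep_vars_subset)
  then have "indep_vars (\<lambda>_. borel) (\<lambda>si \<omega>. (\<lambda>y. \<Prod>j<p. y j ^ ?n si j) ((case si of (s, i) \<Rightarrow> x s i) \<omega>)) J"
    by (rule indep_vars_compose2)
       (intro borel_measurable_prod borel_measurable_power measurable_component_singleton, auto)
  then have ind: "indep_vars (\<lambda>_. borel) ?Y J"
    by (simp add: case_prod_unfold)
  have int: "integrable \<Omega> (?Y si)" if "si \<in> J" for si
    using that J(2) by (intro sample_moment) auto
  show "integrable \<Omega> (monomial zs)"
    unfolding monomial by (rule indep_vars_integrable[OF J(1) ind int])
  have "expectation (monomial zs) = (\<Prod>si\<in>J. expectation (?Y si))"
    unfolding monomial by (rule indep_vars_lebesgue_integral[OF J(1) ind int])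
  also have "\<dots> = (\<Prod>si\<in>J. \<Prod>j<p. gauss_moment (?n si j))"
    using J(2) by (intro prod.cong refl sample_moment) auto
  also have "\<dots> = (\<Prod>z\<in>C. gauss_moment (count_list zs z))"
    by (simp add: prodC)
  also have "\<dots> = (\<Prod>z\<in>set zs. gauss_moment (count_list zs z))"
    using C by (intro prod.mono_neutral_right) (auto simp: count_list_0_iff)
  finally have *: "expectation (monomial zs) = (\<Prod>z\<in>set zs. gauss_moment (count_list zs z))" .
  show "expectation (monomial zs) = (\<Prod>z\<in>B. gauss_moment (count_list zs z))"
    if "finite B" "set zs \<subseteq> B" for B
    unfolding * using that by (intro prod.mono_neutral_left) (auto simp: count_list_0_iff)
qed

primrec dmonomial :: "nat \<times> nat \<times> nat \<Rightarrow> (nat \<times> nat \<times> nat) list \<Rightarrow> 'a \<Rightarrow> real" where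
  "dmonomial z [] \<omega> = 0"
| "dmonomial z (w # zs) \<omega> = of_bool (w = z) * monomial zs \<omega> + coord w \<omega> * dmonomial z zs \<omega>"

lemma dmonomial_eq: "dmonomial z zs \<omega> = real (count_list zs z) * monomial (remove1 z zs) \<omega>"
proof (induction zs)
  case Nil
  then show ?case by simp
next
  case (Cons w zs)
  have "coord z \<omega> * monomial (remove1 z zs) \<omega> = monomial zs \<omega>" if "z \<in> set zs"
    using that by (induction zs) (auto simp: mult_ac)
  moreover have "count_list zs z = 0" if "z \<notin> set zs"
    using that by (simp add: count_list_0_iff)
  ultimately show ?case using Cons by (cases "z \<in> set zs") (auto simp: algebra_simps)
qed

text \<open>Only the exponent of \<open>z\<close> differs between the two sides, so the
  one-dimensional identity applied to that factor suffices.\<close>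

lemma isserlis:
  assumes "z \<in> Vars" "set zs \<subseteq> Vars"
  shows "expectation (\<lambda>\<omega>. coord z \<omega> * monomial zs \<omega>) = expectation (dmonomial z zs)"
proof -
  let ?B = "insert z (set zs)"
  let ?R = "\<Prod>u\<in>?B - {z}. gauss_moment (count_list zs u)"
  have rem: "set (remove1 z zs) \<subseteq> set zs" by (rule set_remove1_subset)
  have "expectation (\<lambda>\<omega>. coord z \<omega> * monomial zs \<omega>) = expectation (monomial (z # zs))"
    by (intro arg_cong[where f=expectation] ext) simp
  also have "\<dots> = (\<Prod>u\<in>?B. gauss_moment (count_list (z # zs) u))"
    using assms by (intro monomial_moment(2)) auto
  also have "\<dots> = gauss_moment (Suc (count_list zs z)) * ?R"
    by (subst prod.remove[of _ z]) (auto intro!: prod.cong split: if_splits)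
  also have "\<dots> = real (count_list zs z) * (gauss_moment (count_list zs z - 1) * ?R)"
    by (simp add: gauss_moment_Suc)
  also have "gauss_moment (count_list zs z - 1) * ?R = (\<Prod>u\<in>?B. gauss_moment (count_list (remove1 z zs) u))"
    by (subst prod.remove[of ?B z]) (auto simp: count_list_remove1 intro!: prod.cong split: if_splits)
  also have "\<dots> = expectation (monomial (remove1 z zs))"
    using assms rem by (intro monomial_moment(2)[symmetric]) auto
  also have "real (count_list zs z) * \<dots> = expectation (dmonomial z zs)"
    by (simp add: dmonomial_eq[abs_def])
  finally show ?thesis .
qed

text \<open>Here \<open>h'\<close> plays the role of the derivative of \<open>h\<close> in direction \<open>z\<close>.  Integration by parts for
  \<open>h\<close> alone is not stable under multiplication of \<open>h\<close> by a coordinate, so all monomials are included.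
  For \<open>z\<close> outside \<open>Vars\<close> the statement reduces to integrability.\<close>

definition parts :: "nat \<times> nat \<times> nat \<Rightarrow> ('a \<Rightarrow> real) \<Rightarrow> ('a \<Rightarrow> real) \<Rightarrow> bool" where
  "parts z h h' \<longleftrightarrow> (\<forall>zs. set zs \<subseteq> Vars \<longrightarrow>
     integrable \<Omega> (\<lambda>\<omega>. monomial zs \<omega> * h \<omega>) \<and> integrable \<Omega> (\<lambda>\<omega>. monomial zs \<omega> * h' \<omega>) \<and>
     (z \<in> Vars \<longrightarrow> expectation (\<lambda>\<omega>. coord z \<omega> * (monomial zs \<omega> * h \<omega>)) =
        expectation (\<lambda>\<omega>. dmonomial z zs \<omega> * h \<omega> + monomial zs \<omega> * h' \<omega>)))"

lemma parts_integrable: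
  assumes "parts z h h'" "set zs \<subseteq> Vars"
  shows "integrable \<Omega> (\<lambda>\<omega>. monomial zs \<omega> * h \<omega>)" "integrable \<Omega> (\<lambda>\<omega>. monomial zs \<omega> * h' \<omega>)"
    "w \<in> Vars \<Longrightarrow> integrable \<Omega> (\<lambda>\<omega>. coord w \<omega> * (monomial zs \<omega> * h \<omega>))"
    "integrable \<Omega> (\<lambda>\<omega>. dmonomial w zs \<omega> * h \<omega>)"
proof -
  show "integrable \<Omega> (\<lambda>\<omega>. monomial zs \<omega> * h \<omega>)" "integrable \<Omega> (\<lambda>\<omega>. monomial zs \<omega> * h' \<omega>)"
    using assms by (auto simp: parts_def)
  show "integrable \<Omega> (\<lambda>\<omega>. coord w \<omega> * (monomial zs \<omega> * h \<omega>))" if "w \<in> Vars"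
  proof -
    have "set (w # zs) \<subseteq> Vars" using assms that by simp
    then have "integrable \<Omega> (\<lambda>\<omega>. monomial (w # zs) \<omega> * h \<omega>)" using assms(1) unfolding parts_def by blast
    then show ?thesis by (simp add: mult.assoc)
  qed
  have "set (remove1 w zs) \<subseteq> Vars" using assms set_remove1_subset[of w zs] by auto
  then have "integrable \<Omega> (\<lambda>\<omega>. monomial (remove1 w zs) \<omega> * h \<omega>)" using assms(1) unfolding parts_def by blast
  then show "integrable \<Omega> (\<lambda>\<omega>. dmonomial w zs \<omega> * h \<omega>)" by (simp add: dmonomial_eq mult.assoc)
qed

lemma parts_one: "parts z (\<lambda>_. 1) (\<lambda>_. 0)"
  using monomial_moment isserlis by (auto simp: parts_def)

lemma parts_add:
  assumes "parts z h h'" "parts z k k'"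
  shows "parts z (\<lambda>\<omega>. h \<omega> + k \<omega>) (\<lambda>\<omega>. h' \<omega> + k' \<omega>)"
  unfolding parts_def
proof (intro allI impI conjI)
  fix zs assume zs: "set zs \<subseteq> Vars"
  note i = parts_integrable[OF assms(1) zs] parts_integrable[OF assms(2) zs]
  show "integrable \<Omega> (\<lambda>\<omega>. monomial zs \<omega> * (h \<omega> + k \<omega>))" "integrable \<Omega> (\<lambda>\<omega>. monomial zs \<omega> * (h' \<omega> + k' \<omega>))"
    using i by (simp_all add: distrib_left)
  show "expectation (\<lambda>\<omega>. coord z \<omega> * (monomial zs \<omega> * (h \<omega> + k \<omega>))) =
      expectation (\<lambda>\<omega>. dmonomial z zs \<omega> * (h \<omega> + k \<omega>) + monomial zs \<omega> * (h' \<omega> + k' \<omega>))" if "z \<in> Vars"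
  proof -
    have "expectation (\<lambda>\<omega>. coord z \<omega> * (monomial zs \<omega> * h \<omega>)) =
        expectation (\<lambda>\<omega>. dmonomial z zs \<omega> * h \<omega> + monomial zs \<omega> * h' \<omega>)"
      "expectation (\<lambda>\<omega>. coord z \<omega> * (monomial zs \<omega> * k \<omega>)) =
        expectation (\<lambda>\<omega>. dmonomial z zs \<omega> * k \<omega> + monomial zs \<omega> * k' \<omega>)"
      using assms zs that by (auto simp: parts_def)
    then show ?thesis using i i(3,7)[OF that] by (simp add: distrib_left)
  qed
qed

lemma parts_scale:
  assumes "parts z h h'"
  shows "parts z (\<lambda>\<omega>. c * h \<omega>) (\<lambda>\<omega>. c * h' \<omega>)"
  unfolding parts_def
proof (intro allI impI conjI)
  fix zs assume zs: "set zs \<subseteq> Vars"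
  note i = parts_integrable[OF assms zs]
  show "integrable \<Omega> (\<lambda>\<omega>. monomial zs \<omega> * (c * h \<omega>))" "integrable \<Omega> (\<lambda>\<omega>. monomial zs \<omega> * (c * h' \<omega>))"
    using i(1,2) by (simp_all add: mult.left_commute[of _ c])
  show "expectation (\<lambda>\<omega>. coord z \<omega> * (monomial zs \<omega> * (c * h \<omega>))) =
      expectation (\<lambda>\<omega>. dmonomial z zs \<omega> * (c * h \<omega>) + monomial zs \<omega> * (c * h' \<omega>))" if "z \<in> Vars"
  proof -
    have "expectation (\<lambda>\<omega>. c * (coord z \<omega> * (monomial zs \<omega> * h \<omega>))) =
        expectation (\<lambda>\<omega>. c * (dmonomial z zs \<omega> * h \<omega> + monomial zs \<omega> * h' \<omega>))"
      using assms zs that by (simp add: parts_def)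
    then show ?thesis by (simp add: algebra_simps)
  qed
qed

text \<open>The coordinate is absorbed into the monomial: the assumption at \<open>w # zs\<close> is
  the claim at \<open>zs\<close>, with the recursion of \<open>dmonomial\<close> acting as the
  product rule.\<close>

lemma parts_coord:
  assumes "w \<in> Vars" "parts z h h'"
  shows "parts z (\<lambda>\<omega>. coord w \<omega> * h \<omega>) (\<lambda>\<omega>. of_bool (w = z) * h \<omega> + coord w \<omega> * h' \<omega>)"
  unfolding parts_def
proof (intro allI impI conjI)
  fix zs assume zs: "set zs \<subseteq> Vars"
  have wzs: "set (w # zs) \<subseteq> Vars" using zs assms(1) by simp
  note i = parts_integrable[OF assms(2) zs] and j = parts_integrable[OF assms(2) wzs]
  show "integrable \<Omega> (\<lambda>\<omega>. monomial zs \<omega> * (coord w \<omega> * h \<omega>))"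
    using j(1) by (simp add: mult_ac)
  have "integrable \<Omega> (\<lambda>\<omega>. of_bool (w = z) * (monomial zs \<omega> * h \<omega>) + monomial (w # zs) \<omega> * h' \<omega>)"
    using i j by (intro Bochner_Integration.integrable_add) auto
  then show "integrable \<Omega> (\<lambda>\<omega>. monomial zs \<omega> * (of_bool (w = z) * h \<omega> + coord w \<omega> * h' \<omega>))"
    by (simp add: algebra_simps)
  show "expectation (\<lambda>\<omega>. coord z \<omega> * (monomial zs \<omega> * (coord w \<omega> * h \<omega>))) =
      expectation (\<lambda>\<omega>. dmonomial z zs \<omega> * (coord w \<omega> * h \<omega>) +
        monomial zs \<omega> * (of_bool (w = z) * h \<omega> + coord w \<omega> * h' \<omega>))" if "z \<in> Vars"
  proof -
    have "expectation (\<lambda>\<omega>. coord z \<omega> * (monomial (w # zs) \<omega> * h \<omega>)) =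
        expectation (\<lambda>\<omega>. dmonomial z (w # zs) \<omega> * h \<omega> + monomial (w # zs) \<omega> * h' \<omega>)"
      using assms(2) wzs that unfolding parts_def by blast
    then show ?thesis by (simp add: algebra_simps)
  qed
qed

text \<open>\<open>f\<close> is characterised by its action as a multiplier on pairs satisfying
  \<open>parts\<close>, not as a polynomial. The product rule is then mere composition of
  multipliers, and integrability of all products comes along.\<close>

definition derivation :: "nat \<times> nat \<times> nat \<Rightarrow> ('a \<Rightarrow> real) \<Rightarrow> ('a \<Rightarrow> real) \<Rightarrow> bool" where
  "derivation z f f' \<longleftrightarrow>
     (\<forall>h h'. parts z h h' \<longrightarrow> parts z (\<lambda>\<omega>. f \<omega> * h \<omega>) (\<lambda>\<omega>. f' \<omega> * h \<omega> + f \<omega> * h' \<omega>))"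

lemma derivation_const: "derivation z (\<lambda>_. c) (\<lambda>_. 0)"
  using parts_scale by (simp add: derivation_def)

lemma derivation_coord: "w \<in> Vars \<Longrightarrow> derivation z (coord w) (\<lambda>_. of_bool (w = z))"
  using parts_coord by (simp add: derivation_def)

lemma derivation_add:
  assumes "derivation z f f'" "derivation z g g'"
  shows "derivation z (\<lambda>\<omega>. f \<omega> + g \<omega>) (\<lambda>\<omega>. f' \<omega> + g' \<omega>)"
  unfolding derivation_def
proof (intro allI impI)
  fix h h' assume h: "parts z h h'"
  have "parts z (\<lambda>\<omega>. f \<omega> * h \<omega> + g \<omega> * h \<omega>)
      (\<lambda>\<omega>. (f' \<omega> * h \<omega> + f \<omega> * h' \<omega>) + (g' \<omega> * h \<omega> + g \<omega> * h' \<omega>))"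
    using assms h unfolding derivation_def by (intro parts_add) auto
  then show "parts z (\<lambda>\<omega>. (f \<omega> + g \<omega>) * h \<omega>) (\<lambda>\<omega>. (f' \<omega> + g' \<omega>) * h \<omega> + (f \<omega> + g \<omega>) * h' \<omega>)"
    by (simp add: algebra_simps)
qed

lemma derivation_mult:
  assumes "derivation z f f'" "derivation z g g'"
  shows "derivation z (\<lambda>\<omega>. f \<omega> * g \<omega>) (\<lambda>\<omega>. f' \<omega> * g \<omega> + f \<omega> * g' \<omega>)"
  unfolding derivation_def
proof (intro allI impI)
  fix h h' assume h: "parts z h h'"
  then have "parts z (\<lambda>\<omega>. g \<omega> * h \<omega>) (\<lambda>\<omega>. g' \<omega> * h \<omega> + g \<omega> * h' \<omega>)"
    using assms(2) unfolding derivation_def by blast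
  then have "parts z (\<lambda>\<omega>. f \<omega> * (g \<omega> * h \<omega>))
      (\<lambda>\<omega>. f' \<omega> * (g \<omega> * h \<omega>) + f \<omega> * (g' \<omega> * h \<omega> + g \<omega> * h' \<omega>))"
    using assms(1) unfolding derivation_def by blast
  then show "parts z (\<lambda>\<omega>. f \<omega> * g \<omega> * h \<omega>)
      (\<lambda>\<omega>. (f' \<omega> * g \<omega> + f \<omega> * g' \<omega>) * h \<omega> + f \<omega> * g \<omega> * h' \<omega>)"
    by (simp add: algebra_simps)
qed

lemma derivation_cmult: "derivation z f f' \<Longrightarrow> derivation z (\<lambda>\<omega>. c * f \<omega>) (\<lambda>\<omega>. c * f' \<omega>)"
  using derivation_mult[OF derivation_const] by simp

lemma derivation_sum:
  "(\<And>k. k \<in> K \<Longrightarrow> derivation z (f k) (f' k)) \<Longrightarrow>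
   derivation z (\<lambda>\<omega>. \<Sum>k\<in>K. f k \<omega>) (\<lambda>\<omega>. \<Sum>k\<in>K. f' k \<omega>)"
  by (induction K rule: infinite_finite_induct) (auto intro: derivation_const derivation_add)

lemma derivation_sum_list:
  "(\<And>k. k \<in> set ks \<Longrightarrow> derivation z (f k) (f' k)) \<Longrightarrow>
   derivation z (\<lambda>\<omega>. \<Sum>k\<leftarrow>ks. f k \<omega>) (\<lambda>\<omega>. \<Sum>k\<leftarrow>ks. f' k \<omega>)"
  by (induction ks) (auto intro: derivation_const derivation_add)

lemma derivation_parts: "derivation z f f' \<Longrightarrow> parts z f f'"
  using parts_one unfolding derivation_def by fastforce

lemma derivation_integrable:
  assumes "derivation z f f'"
  shows "integrable \<Omega> f" "integrable \<Omega> f'" "w \<in> Vars \<Longrightarrow> integrable \<Omega> (\<lambda>\<omega>. coord w \<omega> * f \<omega>)"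
  using parts_integrable[OF derivation_parts[OF assms], where zs="[]"] by simp_all

lemma integration_by_parts:
  assumes "derivation z f f'" "z \<in> Vars"
  shows "expectation (\<lambda>\<omega>. coord z \<omega> * f \<omega>) = expectation f'"
proof -
  have "set [] \<subseteq> Vars" by simp
  then have "expectation (\<lambda>\<omega>. coord z \<omega> * (monomial [] \<omega> * f \<omega>)) =
      expectation (\<lambda>\<omega>. dmonomial z [] \<omega> * f \<omega> + monomial [] \<omega> * f' \<omega>)"
    using derivation_parts[OF assms(1)] assms(2) unfolding parts_def by blast
  then show ?thesis by simp
qed

end

section \<open>Differentiating words along Gaussian coordinates\<close>

lemma dentry_zero: "dentry D V (\<lambda>_ _ _. 0) M i j = 0"
proof (induction M arbitrary: i)
  case (Times A M)
  have "factor_entry (\<lambda>_ _ _. 0) A i k = 0" for i k by (cases A) auto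
  then show ?case using Times by simp
qed simp

lemma dentry_scale: "dentry D V (\<lambda>s u v. c * dV s u v) M i j = c * dentry D V dV M i j"
  using dentry_linear[of "\<lambda>_. c" D V "\<lambda>_. dV" M i j "{0::nat}"] by simp

lemma dtraces_scale: "dtraces D V (\<lambda>s u v. c * dV s u v) w = c * dtraces D V dV w"
  using dtraces_linear[of "\<lambda>_. c" D V "\<lambda>_. dV" w "{0::nat}"] by simp

lemma integral_sum_list:
  fixes f :: "'i \<Rightarrow> 'a \<Rightarrow> real"
  assumes "\<And>v. integrable M (f v)"
  shows "integral\<^sup>L M (\<lambda>\<omega>. \<Sum>v\<leftarrow>vs. f v \<omega>) = (\<Sum>v\<leftarrow>vs. integral\<^sup>L M (f v))"
    and "integrable M (\<lambda>\<omega>. \<Sum>v\<leftarrow>vs. f v \<omega>)"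
proof -
  show int: "integrable M (\<lambda>\<omega>. \<Sum>v\<leftarrow>vs. f v \<omega>)" for vs
  proof (induction vs)
    case (Cons v vs)
    show ?case using Bochner_Integration.integrable_add[OF assms[of v] Cons.IH] by simp
  qed simp
  show "integral\<^sup>L M (\<lambda>\<omega>. \<Sum>v\<leftarrow>vs. f v \<omega>) = (\<Sum>v\<leftarrow>vs. integral\<^sup>L M (f v))"
  proof (induction vs)
    case (Cons v vs)
    show ?case using Bochner_Integration.integral_add[OF assms[of v] int[of vs]] Cons.IH by simp
  qed simp
qed

lemma integral_double_sum:
  fixes f :: "nat \<Rightarrow> nat \<Rightarrow> 'a \<Rightarrow> real"
  assumes "\<And>a c. a < m \<Longrightarrow> c < n \<Longrightarrow> integrable M (f a c)"
  shows "integral\<^sup>L M (\<lambda>\<omega>. \<Sum>a<m. \<Sum>c<n. f a c \<omega>) = (\<Sum>a<m. \<Sum>c<n. integral\<^sup>L M (f a c))"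
proof -
  have "integral\<^sup>L M (\<lambda>\<omega>. \<Sum>a<m. \<Sum>c<n. f a c \<omega>) = (\<Sum>a<m. integral\<^sup>L M (\<lambda>\<omega>. \<Sum>c<n. f a c \<omega>))"
    by (rule Bochner_Integration.integral_sum) (rule Bochner_Integration.integrable_sum, simp add: assms)
  also have "\<dots> = (\<Sum>a<m. \<Sum>c<n. integral\<^sup>L M (f a c))"
    by (intro sum.cong refl Bochner_Integration.integral_sum) (simp add: assms)
  finally show ?thesis .
qed

context gaussian_family
begin

lemma derivation_entry:
  assumes "\<And>s u v. derivation z (\<lambda>\<omega>. V \<omega> s u v) (\<lambda>\<omega>. dV \<omega> s u v)"
  shows "derivation z (\<lambda>\<omega>. entry D (V \<omega>) M i j) (\<lambda>\<omega>. dentry D (V \<omega>) (dV \<omega>) M i j)"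
proof (induction M arbitrary: i)
  case (Id n)
  then show ?case by (simp add: derivation_const)
next
  case (Times A M)
  have "derivation z (\<lambda>\<omega>. factor_entry (V \<omega>) A i k) (\<lambda>\<omega>. factor_entry (dV \<omega>) A i k)" for k
    using assms by (cases A) auto
  then show ?case using Times by (auto intro!: derivation_sum derivation_mult)
qed

lemma derivation_word_trace:
  assumes "\<And>s u v. derivation z (\<lambda>\<omega>. V \<omega> s u v) (\<lambda>\<omega>. dV \<omega> s u v)"
  shows "derivation z (\<lambda>\<omega>. word_trace D (V \<omega>) M) (\<lambda>\<omega>. dtrace D (V \<omega>) (dV \<omega>) M)"
  unfolding word_trace_def dtrace_def by (intro derivation_sum derivation_entry assms)

lemma derivation_traces:
  assumes "\<And>s u v. derivation z (\<lambda>\<omega>. V \<omega> s u v) (\<lambda>\<omega>. dV \<omega> s u v)"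
  shows "derivation z (\<lambda>\<omega>. traces D (V \<omega>) w) (\<lambda>\<omega>. dtraces D (V \<omega>) (dV \<omega>) w)"
  by (induction w) (auto intro!: derivation_const derivation_mult derivation_word_trace assms)

text \<open>Set to 0 outside the \<open>p\<close> by \<open>p\<close> block because
  \<open>derivation_entry\<close> asks for a derivative at all indices, whereas coordinates outside
  \<open>Vars\<close> are not controlled.\<close>

definition cov :: "nat \<Rightarrow> 'a \<Rightarrow> nat \<Rightarrow> nat \<Rightarrow> real" where
  "cov t \<omega> u v = (if u < p \<and> v < p then (\<Sum>i\<in>{1..b}. coord (t, i, u) \<omega> * coord (t, i, v) \<omega>) / real b else 0)"

definition dcov :: "nat \<times> nat \<times> nat \<Rightarrow> nat \<Rightarrow> 'a \<Rightarrow> nat \<Rightarrow> nat \<Rightarrow> real" where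
  "dcov z t \<omega> u v = (if u < p \<and> v < p then (1 / real b) *
     (\<Sum>i\<in>{1..b}. of_bool ((t, i, u) = z) * coord (t, i, v) \<omega> + coord (t, i, u) \<omega> * of_bool ((t, i, v) = z)) else 0)"

lemma cov_sym: "cov t \<omega> u v = cov t \<omega> v u"
  by (simp add: cov_def mult.commute)

lemma derivation_cov: "derivation z (\<lambda>\<omega>. cov t \<omega> u v) (\<lambda>\<omega>. dcov z t \<omega> u v)"
proof (cases "u < p \<and> v < p")
  case True
  then have "derivation z (\<lambda>\<omega>. (1 / real b) * (\<Sum>i\<in>{1..b}. coord (t, i, u) \<omega> * coord (t, i, v) \<omega>))
      (\<lambda>\<omega>. (1 / real b) * (\<Sum>i\<in>{1..b}. of_bool ((t, i, u) = z) * coord (t, i, v) \<omega> +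
         coord (t, i, u) \<omega> * of_bool ((t, i, v) = z)))"
    by (intro derivation_cmult derivation_sum derivation_mult derivation_coord) (auto simp: Vars_def)
  then show ?thesis using True by (simp add: cov_def dcov_def)
next
  case False
  then have "(\<lambda>\<omega>. cov t \<omega> u v) = (\<lambda>_. 0)" "(\<lambda>\<omega>. dcov z t \<omega> u v) = (\<lambda>_. 0)"
    by (auto simp: cov_def dcov_def)
  then show ?thesis using derivation_const[of z 0] by simp
qed

lemma dcov_other: "fst z \<noteq> t \<Longrightarrow> dcov z t \<omega> u v = 0"
  by (cases z) (auto simp: dcov_def)

text \<open>Two factors 1/b meet here: one from the average over the mini-batch and one inside
  \<open>dcov\<close>. One of them turns the sum of products of coordinates back into
  \<open>cov\<close>, the other survives as the price of the contraction.\<close>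

lemma dcov_average:
  assumes "a < p" "c < p"
  shows "(\<Sum>i\<in>{1..b}. (1 / real b * coord (t, i, c) \<omega>) * dcov (t, i, a) t \<omega> u v) =
    1 / real b * (of_bool (a = u) * cov t \<omega> c v + of_bool (a = v) * cov t \<omega> c u)"
proof (cases "u < p \<and> v < p")
  case True
  have "dcov (t, i, a) t \<omega> u v = 1 / real b *
      (of_bool (a = u) * coord (t, i, v) \<omega> + of_bool (a = v) * coord (t, i, u) \<omega>)"
    if "i \<in> {1..b}" for i
  proof -
    \<comment> \<open>Of the \<open>b\<close> samples only the differentiated one,
      \<open>k = i\<close>, contributes.\<close>
    have "(\<Sum>k\<in>{1..b}. of_bool ((t, k, u) = (t, i, a)) * coord (t, k, v) \<omega> +
        coord (t, k, u) \<omega> * of_bool ((t, k, v) = (t, i, a))) =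
      (\<Sum>k\<in>{1..b}. if k = i then of_bool (a = u) * coord (t, k, v) \<omega> + of_bool (a = v) * coord (t, k, u) \<omega> else 0)"
      by (intro sum.cong) auto
    then show ?thesis using True that by (simp add: dcov_def)
  qed
  then have "(\<Sum>i\<in>{1..b}. (1 / real b * coord (t, i, c) \<omega>) * dcov (t, i, a) t \<omega> u v) =
      (\<Sum>i\<in>{1..b}. 1 / real b * (of_bool (a = u) * (coord (t, i, c) \<omega> * coord (t, i, v) \<omega> / real b) +
        of_bool (a = v) * (coord (t, i, c) \<omega> * coord (t, i, u) \<omega> / real b)))"
    by (intro sum.cong refl) (simp add: algebra_simps)
  also have "\<dots> = 1 / real b * (of_bool (a = u) * cov t \<omega> c v + of_bool (a = v) * cov t \<omega> c u)"
    using True assms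
    by (simp only: sum.distrib cov_def sum_divide_distrib flip: sum_distrib_left) simp
  finally show ?thesis .
next
  case False
  then show ?thesis using assms by (auto simp: dcov_def cov_def)
qed

text \<open>Each summand of the covariance is a product of two coordinates of one sample.
  Integration by parts removes the coordinate \<open>a\<close>, while the coordinate
  \<open>c\<close> stays as a multiplier: if the derivative meets it, the \<open>b\<close> equal
  terms cancel the factor 1/b; otherwise the derivative meets another \<open>S\<close>, and the
  multiplier enters \<open>dcov_average\<close>. All remaining symbols must be constant along the
  samples of iteration \<open>t\<close>.\<close>

lemma wishart:
  fixes V :: "'a \<Rightarrow> 's \<Rightarrow> nat \<Rightarrow> nat \<Rightarrow> real"
  assumes S: "D S = (p, p)" "\<And>\<omega>. V \<omega> S = cov t \<omega>"
    and V: "\<And>z s u v. s \<noteq> S \<Longrightarrow> fst z = t \<Longrightarrow> derivation z (\<lambda>\<omega>. V \<omega> s u v) (\<lambda>_. 0)"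
    and b: "1 \<le> b"
    and A: "compatible D A" "term_rows D A = p" "term_cols A = p" "closed_words D w"
  shows "expectation (\<lambda>\<omega>. traces D (V \<omega>) (Times (Plain S) A # w)) =
    expectation (\<lambda>\<omega>. traces D (V \<omega>) (A # w)) +
    1 / real b * (\<Sum>v\<leftarrow>square_symbol.contractions D S p A w. expectation (\<lambda>\<omega>. traces D (V \<omega>) v))"
proof -
  interpret square_symbol D S p using S(1) by unfold_locales
  define dV where "dV z \<omega> s u v = (if s = S then dcov z t \<omega> u v else 0)" for z \<omega> s u v
  have dV: "derivation z (\<lambda>\<omega>. V \<omega> s u v) (\<lambda>\<omega>. dV z \<omega> s u v)" if "fst z = t" for z s u v
    using V[OF _ that] derivation_cov[of z t u v] S(2) by (cases "s = S") (auto simp: dV_def)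
  have int: "integrable \<Omega> (\<lambda>\<omega>. traces D (V \<omega>) v)" for v
  proof -
    \<comment> \<open>Positions in a mini-batch start at 1, so this index lies outside
      \<open>Vars\<close>; only the integrability contained in \<open>derivation\<close> is
      wanted.\<close>
    have "derivation (t, 0, 0) (\<lambda>\<omega>. traces D (V \<omega>) v) (\<lambda>\<omega>. dtraces D (V \<omega>) (dV (t, 0, 0) \<omega>) v)"
      by (rule derivation_traces) (simp add: dV)
    then show ?thesis by (rule derivation_integrable(1))
  qed
  define F where "F a c \<omega> = entry D (V \<omega>) A c a * traces D (V \<omega>) w" for a c \<omega>
  define F' where "F' z a c \<omega> = dentry D (V \<omega>) (dV z \<omega>) A c a * traces D (V \<omega>) w +
      entry D (V \<omega>) A c a * dtraces D (V \<omega>) (dV z \<omega>) w" for z a c \<omega>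
  define G where "G a c \<omega> = dentry D (V \<omega>) (contraction (V \<omega>) a c) A c a * traces D (V \<omega>) w +
      entry D (V \<omega>) A c a * dtraces D (V \<omega>) (contraction (V \<omega>) a c) w" for a c \<omega>
  have dF: "derivation z (F a c) (F' z a c)" if "fst z = t" for z a c
  proof -
    have "derivation z (\<lambda>\<omega>. entry D (V \<omega>) A c a) (\<lambda>\<omega>. dentry D (V \<omega>) (dV z \<omega>) A c a)"
      by (rule derivation_entry) (rule dV[OF that])
    moreover have "derivation z (\<lambda>\<omega>. traces D (V \<omega>) w) (\<lambda>\<omega>. dtraces D (V \<omega>) (dV z \<omega>) w)"
      by (rule derivation_traces) (rule dV[OF that])
    ultimately show ?thesis
      unfolding F_def F'_def by (rule derivation_mult)
  qed
  have intF: "integrable \<Omega> (F a c)" for a c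
    using derivation_integrable(1)[OF dF[of "(t, 0, 0)"]] by simp
  \<comment> \<open>The weighted sum over samples of partial derivatives is again a derivative, now
    along \<open>contraction\<close>, by linearity in the direction.\<close>
  have avg: "(\<Sum>i\<in>{1..b}. (1 / real b * coord (t, i, c) \<omega>) * F' (t, i, a) a c \<omega>) = 1 / real b * G a c \<omega>"
    if "a < p" "c < p" for a c \<omega>
  proof -
    have "(\<Sum>i\<in>{1..b}. (1 / real b * coord (t, i, c) \<omega>) * dV (t, i, a) \<omega> s u v) =
        1 / real b * contraction (V \<omega>) a c s u v" for s u v
      using dcov_average[OF that, of t \<omega> u v] by (simp add: dV_def contraction_def S(2))
    then have lin: "(\<Sum>i\<in>{1..b}. (1 / real b * coord (t, i, c) \<omega>) * dentry D (V \<omega>) (dV (t, i, a) \<omega>) A c a) =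
        1 / real b * dentry D (V \<omega>) (contraction (V \<omega>) a c) A c a"
      "(\<Sum>i\<in>{1..b}. (1 / real b * coord (t, i, c) \<omega>) * dtraces D (V \<omega>) (dV (t, i, a) \<omega>) w) =
        1 / real b * dtraces D (V \<omega>) (contraction (V \<omega>) a c) w"
      unfolding dentry_linear dtraces_linear by (simp_all only: dentry_scale dtraces_scale)
    have "(\<Sum>i\<in>{1..b}. (1 / real b * coord (t, i, c) \<omega>) * F' (t, i, a) a c \<omega>) =
        (\<Sum>i\<in>{1..b}. (1 / real b * coord (t, i, c) \<omega>) * dentry D (V \<omega>) (dV (t, i, a) \<omega>) A c a) * traces D (V \<omega>) w +
        entry D (V \<omega>) A c a * (\<Sum>i\<in>{1..b}. (1 / real b * coord (t, i, c) \<omega>) * dtraces D (V \<omega>) (dV (t, i, a) \<omega>) w)"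
      unfolding F'_def sum_distrib_left sum_distrib_right sum.distrib[symmetric]
      by (intro sum.cong) (simp_all add: algebra_simps)
    also have "\<dots> = 1 / real b * G a c \<omega>"
      unfolding lin G_def by (simp add: algebra_simps add_divide_distrib)
    finally show ?thesis .
  qed
  have step: "expectation (\<lambda>\<omega>. cov t \<omega> a c * F a c \<omega>) =
      of_bool (a = c) * expectation (F a c) + 1 / real b * expectation (G a c)"
    and intcF: "integrable \<Omega> (\<lambda>\<omega>. cov t \<omega> a c * F a c \<omega>)"
    and intG: "integrable \<Omega> (G a c)"
    if ac: "a < p" "c < p" for a c
  proof -
    have vars: "(t, i, a) \<in> Vars" "(t, i, c) \<in> Vars" if "i \<in> {1..b}" for i
      using that ac by (auto simp: Vars_def)
    have ca: "((t, i, c) = (t, i, a)) = (a = c)" for i by auto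
    have d: "derivation (t, i, a) (\<lambda>\<omega>. coord (t, i, c) \<omega> * F a c \<omega>)
        (\<lambda>\<omega>. of_bool ((t, i, c) = (t, i, a)) * F a c \<omega> + coord (t, i, c) \<omega> * F' (t, i, a) a c \<omega>)"
      if "i \<in> {1..b}" for i
      by (rule derivation_mult[OF derivation_coord[OF vars(2)[OF that]] dF]) simp
    have eq: "expectation (\<lambda>\<omega>. coord (t, i, a) \<omega> * (coord (t, i, c) \<omega> * F a c \<omega>)) =
        expectation (\<lambda>\<omega>. of_bool (a = c) * F a c \<omega> + coord (t, i, c) \<omega> * F' (t, i, a) a c \<omega>)"
      if "i \<in> {1..b}" for i
      using integration_by_parts[OF d[OF that] vars(1)[OF that]] by (simp only: ca)
    have int1: "integrable \<Omega> (\<lambda>\<omega>. coord (t, i, a) \<omega> * (coord (t, i, c) \<omega> * F a c \<omega>))"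
      and int2: "integrable \<Omega> (\<lambda>\<omega>. of_bool (a = c) * F a c \<omega> + coord (t, i, c) \<omega> * F' (t, i, a) a c \<omega>)"
      if "i \<in> {1..b}" for i
      using derivation_integrable(2)[OF d[OF that]] derivation_integrable(3)[OF d[OF that] vars(1)[OF that]]
      by (simp_all only: ca)
    have cov: "cov t \<omega> a c * F a c \<omega> =
        (\<Sum>i\<in>{1..b}. 1 / real b * (coord (t, i, a) \<omega> * (coord (t, i, c) \<omega> * F a c \<omega>)))" for \<omega>
      using ac by (simp add: cov_def sum_divide_distrib sum_distrib_right mult.assoc)
    show "integrable \<Omega> (\<lambda>\<omega>. cov t \<omega> a c * F a c \<omega>)"
      unfolding cov by (intro Bochner_Integration.integrable_sum integrable_mult_right int1)
    \<comment> \<open>The \<open>b\<close> copies of the first summand compensate the factor 1/b,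
      which is where a nonempty mini-batch is needed.\<close>
    have sumG: "(\<Sum>i\<in>{1..b}. 1 / real b * (of_bool (a = c) * F a c \<omega> + coord (t, i, c) \<omega> * F' (t, i, a) a c \<omega>)) =
        of_bool (a = c) * F a c \<omega> + 1 / real b * G a c \<omega>" for \<omega>
      using b avg[OF ac, of \<omega>] by (simp add: distrib_left sum.distrib mult.assoc)
    \<comment> \<open>\<open>G\<close> occurs only as part of an integrable sum; its own
      integrability follows by subtracting the part with \<open>F\<close> and undoing the factor
      1/b.\<close>
    have "integrable \<Omega> (\<lambda>\<omega>. of_bool (a = c) * F a c \<omega> + 1 / real b * G a c \<omega>)"
      unfolding sumG[symmetric] by (intro Bochner_Integration.integrable_sum integrable_mult_right int2)
    then have "integrable \<Omega> (\<lambda>\<omega>. (of_bool (a = c) * F a c \<omega> + 1 / real b * G a c \<omega>) - of_bool (a = c) * F a c \<omega>)"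
      by (intro Bochner_Integration.integrable_diff integrable_mult_right intF)
    then have "integrable \<Omega> (\<lambda>\<omega>. real b * (1 / real b * G a c \<omega>))"
      by (simp only: add_diff_cancel_left') (rule integrable_mult_right)
    moreover have "(\<lambda>\<omega>. real b * (1 / real b * G a c \<omega>)) = G a c"
      using b by auto
    ultimately show intG: "integrable \<Omega> (G a c)"
      by (simp only:)
    have "expectation (\<lambda>\<omega>. cov t \<omega> a c * F a c \<omega>) =
        (\<Sum>i\<in>{1..b}. 1 / real b * expectation (\<lambda>\<omega>. coord (t, i, a) \<omega> * (coord (t, i, c) \<omega> * F a c \<omega>)))"
      unfolding cov using int1 by (subst Bochner_Integration.integral_sum) auto
    also have "\<dots> = (\<Sum>i\<in>{1..b}. 1 / real b * expectation (\<lambda>\<omega>. of_bool (a = c) * F a c \<omega> + coord (t, i, c) \<omega> * F' (t, i, a) a c \<omega>))"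
      using eq by simp
    also have "\<dots> = expectation (\<lambda>\<omega>. \<Sum>i\<in>{1..b}. 1 / real b * (of_bool (a = c) * F a c \<omega> + coord (t, i, c) \<omega> * F' (t, i, a) a c \<omega>))"
      using int2 by (subst Bochner_Integration.integral_sum) (auto intro!: integrable_mult_right)
    also have "\<dots> = of_bool (a = c) * expectation (F a c) + 1 / real b * expectation (G a c)"
      unfolding sumG using intF intG by simp
    finally show "expectation (\<lambda>\<omega>. cov t \<omega> a c * F a c \<omega>) = \<dots>" .
  qed
  have tr: "traces D (V \<omega>) (Times (Plain S) A # w) = (\<Sum>a<p. \<Sum>c<p. cov t \<omega> a c * F a c \<omega>)" for \<omega>
    by (simp add: word_trace_def S F_def sum_distrib_right mult.assoc)
  have "expectation (\<lambda>\<omega>. traces D (V \<omega>) (Times (Plain S) A # w)) =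
      (\<Sum>a<p. \<Sum>c<p. expectation (\<lambda>\<omega>. cov t \<omega> a c * F a c \<omega>))"
    unfolding tr by (rule integral_double_sum) (rule intcF)
  then have 1: "expectation (\<lambda>\<omega>. traces D (V \<omega>) (Times (Plain S) A # w)) =
      (\<Sum>a<p. \<Sum>c<p. of_bool (a = c) * expectation (F a c) + 1 / real b * expectation (G a c))"
    using step by simp
  have 2: "(\<Sum>a<p. \<Sum>c<p. of_bool (a = c) * expectation (F a c)) =
      expectation (\<lambda>\<omega>. traces D (V \<omega>) (A # w))"
  proof -
    have "(\<Sum>a<p. \<Sum>c<p. of_bool (a = c) * expectation (F a c)) = (\<Sum>a<p. expectation (F a a))"
      by (intro sum.cong refl) (simp only: sum_delta_lessThan, simp)
    moreover have "traces D (V \<omega>) (A # w) = (\<Sum>a<p. F a a \<omega>)" for \<omega>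
      using A(2) by (simp add: word_trace_def F_def sum_distrib_right)
    ultimately show ?thesis using intF by simp
  qed
  have 3: "(\<Sum>a<p. \<Sum>c<p. expectation (G a c)) =
      (\<Sum>v\<leftarrow>contractions A w. expectation (\<lambda>\<omega>. traces D (V \<omega>) v))"
  proof -
    have "V \<omega> S u v = V \<omega> S v u" for \<omega> u v
      unfolding S(2) by (rule cov_sym)
    from contractions[of "V \<omega>" for \<omega>, OF this A]
    have "(\<Sum>a<p. \<Sum>c<p. G a c \<omega>) = (\<Sum>v\<leftarrow>contractions A w. traces D (V \<omega>) v)" for \<omega>
      unfolding G_def .
    then have "expectation (\<lambda>\<omega>. \<Sum>a<p. \<Sum>c<p. G a c \<omega>) =
        (\<Sum>v\<leftarrow>contractions A w. expectation (\<lambda>\<omega>. traces D (V \<omega>) v))"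
      using integral_sum_list(1)[where f="\<lambda>v \<omega>. traces D (V \<omega>) v", OF int] by simp
    then show ?thesis
      using integral_double_sum[of p p \<Omega> G, OF intG] by simp
  qed
  show ?thesis
    by (simp only: 1 2 3 sum.distrib flip: sum_distrib_left)
qed

end

section \<open>Counting symbols and bringing a covariance to the front\<close>

lemma weight_add: "weight (\<lambda>s. f s + g s) M = weight f M + weight g M"
  by (induction M) auto

lemma weights_add: "weights (\<lambda>s. f s + g s) w = weights f w + weights g w"
  by (induction w) (auto simp: weight_add)

lemma weight_cmult: "weight (\<lambda>s. c * f s) M = c * weight f M"
  by (induction M) (auto simp: distrib_left)

lemma weights_cmult: "weights (\<lambda>s. c * f s) w = c * weights f w"
  by (induction w) (auto simp: weight_cmult distrib_left)

lemma weight_nonneg: "(\<And>s. 0 \<le> f s) \<Longrightarrow> 0 \<le> weight f M"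
  by (induction M) auto

lemma weights_nonneg: "(\<And>s. 0 \<le> f s) \<Longrightarrow> 0 \<le> weights f w"
  by (induction w) (auto simp: weight_nonneg)

lemma weight_zeroD:
  assumes "\<And>s. 0 \<le> f s" "weight f M = 0" "s \<in> set (symbols M)"
  shows "f s = 0"
  using assms(2,3)
proof (induction M)
  case (Times A M)
  have "0 \<le> f (symbol A)" "0 \<le> weight f M"
    using assms(1) by (simp_all add: weight_nonneg)
  then have "f (symbol A) = 0" "weight f M = 0"
    using Times.prems(1) by simp_all
  then show ?case using Times by auto
qed simp

text \<open>Nonnegative contributions cannot cancel. This turns a vanishing count back into the
  absence of symbols.\<close>

lemma weights_zeroD:
  assumes "\<And>s. 0 \<le> f s" "weights f w = 0" "M \<in> set w" "s \<in> set (symbols M)"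
  shows "f s = 0"
proof -
  have "weight f M = 0"
    using assms(2,3)
  proof (induction w)
    case (Cons N w)
    have "0 \<le> weight f N" "0 \<le> weights f w"
      using assms(1) by (simp_all add: weight_nonneg weights_nonneg)
    then have "weight f N = 0" "weights f w = 0"
      using Cons.prems(1) by simp_all
    then show ?case using Cons by auto
  qed simp
  then show ?thesis using weight_zeroD[of f] assms by blast
qed

lemma weight_eq_0: "(\<And>s. s \<in> set (symbols M) \<Longrightarrow> f s = 0) \<Longrightarrow> weight f M = 0"
  by (induction M) auto

lemma weights_eq_0:
  "(\<And>M s. M \<in> set w \<Longrightarrow> s \<in> set (symbols M) \<Longrightarrow> f s = 0) \<Longrightarrow> weights f w = 0"
proof (induction w)
  case (Cons M w)
  then have "weight f M = 0" "weights f w = 0" by (auto intro!: weight_eq_0 Cons.IH)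
  then show ?case by simp
qed simp

lemma traces_cong:
  assumes "closed_words D w"
    and "\<And>M s u v. M \<in> set w \<Longrightarrow> s \<in> set (symbols M) \<Longrightarrow> V s u v = V' s u v"
  shows "traces D V w = traces D V' w"
  using assms
proof (induction w)
  case (Cons M w)
  have "entry D V M i i = entry D V' M i i" if "i < term_rows D M" for i
    using Cons.prems that by (intro entry_cong) (auto simp: square_term_def)
  then have "word_trace D V M = word_trace D V' M" by (simp add: word_trace_def)
  moreover have "traces D V w = traces D V' w"
    using Cons.prems by (intro Cons.IH) auto
  ultimately show ?case by simp
qed simp

context square_symbol
begin

lemma entry_split:
  assumes "\<And>u v. V S u v = V S v u" "(P, Q) \<in> set (splits M)"
  shows "entry D V M i j = entry D V (app P (SQ Q)) i j"
  using assms(2)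
proof (induction M arbitrary: P i)
  case (Id n)
  then show ?case by simp
next
  case (Times A M)
  show ?case
  proof (cases "symbol A = S \<and> (P, Q) = (Id p, M)")
    case True
    then have "factor_entry V A i k = V S i k" for i k
      using assms(1) by (cases A) auto
    then show ?thesis using True by (simp add: factor_dims_S)
  next
    case False
    then obtain P' where "(P', Q) \<in> set (splits M)" "P = Times A P'"
      using Times.prems by (auto split: if_splits)
    then show ?thesis using Times.IH by simp
  qed
qed

lemma splits_nonempty: "S \<in> set (symbols M) \<Longrightarrow> splits M \<noteq> []"
  by (induction M) auto

text \<open>\<open>P S Q\<close> and \<open>S Q P\<close> have the same trace, so any occurrence of
  \<open>S\<close> can be moved to the front, the position that \<open>wishart\<close> expects.
  Symmetry of \<open>S\<close> covers transposed occurrences.\<close>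

lemma rotate_word:
  assumes M: "compatible D M" "square_term D M" and "S \<in> set (symbols M)"
  obtains A where "compatible D A" "term_rows D A = p" "term_cols A = p"
    "\<And>f. weight f A + f S = weight f M"
    "\<And>V. (\<And>u v. V S u v = V S v u) \<Longrightarrow> word_trace D V M = word_trace D V (SQ A)"
proof -
  obtain P Q where PQ: "(P, Q) \<in> set (splits M)"
    using splits_nonempty[OF assms(3)] by (cases "splits M") auto
  note wf = splits_wf[OF M(1) PQ]
  have sq: "term_rows D M = term_cols M" using M(2) by (simp add: square_term_def)
  show ?thesis
  proof (rule that[of "app Q P"])
    show "compatible D (app Q P)" "term_rows D (app Q P) = p" "term_cols (app Q P) = p"
      using wf(1-6) sq by (simp_all add: compatible_app term_rows_app)
    show "weight f (app Q P) + f S = weight f M" for f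
      using wf(7)[of f] by simp
    fix V :: "'s \<Rightarrow> nat \<Rightarrow> nat \<Rightarrow> real" assume V: "\<And>u v. V S u v = V S v u"
    have "word_trace D V M = word_trace D V (app P (SQ Q))"
      unfolding word_trace_def using entry_split[of V, OF V PQ] wf(1-6) by (simp add: term_rows_app)
    also have "\<dots> = word_trace D V (app (SQ Q) P)"
      using wf(1-6) sq by (intro trace_app_commute) simp_all
    finally show "word_trace D V M = word_trace D V (SQ (app Q P))" by simp
  qed
qed

lemma rotate_words:
  assumes "closed_words D w" "weights (\<lambda>s. of_bool (s = S)) w \<noteq> 0"
  obtains A v where "compatible D A" "term_rows D A = p" "term_cols A = p" "closed_words D v"
    "\<And>f. weight f A + weights f v + f S = weights f w"
    "\<And>V. (\<And>u v. V S u v = V S v u) \<Longrightarrow> traces D V w = traces D V (SQ A # v)"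
proof -
  obtain M where M: "M \<in> set w" "S \<in> set (symbols M)"
  proof (rule ccontr)
    assume "\<not> thesis"
    with that have "\<And>M. M \<in> set w \<Longrightarrow> S \<notin> set (symbols M)" by blast
    then have "weights (\<lambda>s. of_bool (s = S)) w = 0"
      by (intro weights_eq_0) auto
    then show False using assms(2) by simp
  qed
  obtain w1 w2 where w: "w = w1 @ M # w2" using split_list[OF M(1)] by blast
  have "compatible D M" "square_term D M" using assms(1) w by auto
  then obtain A where A: "compatible D A" "term_rows D A = p" "term_cols A = p"
    "\<And>f. weight f A + f S = weight f M"
    "\<And>V. (\<And>u v. V S u v = V S v u) \<Longrightarrow> word_trace D V M = word_trace D V (SQ A)"
    using rotate_word[OF _ _ M(2)] by blast
  show ?thesis
  proof (rule that[of A "w1 @ w2"])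
    show "closed_words D (w1 @ w2)" using assms(1) w by simp
    show "weight f A + weights f (w1 @ w2) + f S = weights f w" for f
      using A(4)[of f] w by simp
    fix V :: "'s \<Rightarrow> nat \<Rightarrow> nat \<Rightarrow> real" assume "\<And>u v. V S u v = V S v u"
    then have "word_trace D V M = word_trace D V (SQ A)" by (rule A(5))
    then show "traces D V w = traces D V (SQ A # w1 @ w2)"
      unfolding w traces_simps by simp
  qed (use A in auto)
qed

end

section \<open>Stochastic gradient descent\<close>

text \<open>\<open>Hole\<close> denotes the matrix unit with a 1 in row \<open>hole_col\<close> and column \<open>hole_row\<close>, so that
  appending it to a word and taking the trace picks the entry at \<open>(hole_row, hole_col)\<close>.\<close>

datatype sym = is_Cov: Cov | is_Hole: Hole | is_Gr: Gr layer | is_Wt: Wt layer | is_Te: Te layer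

text \<open>Everything on which the expansion must not depend. Placing the choice of a list before
  the quantifier over runs expresses that its words and coefficients are independent of the batch
  size, the weights, the samples and the matrix entry in question.\<close>

record 'a run =
  init :: "layer \<Rightarrow> real mat"
  teacher :: "layer \<Rightarrow> real mat"
  batch :: nat
  omega :: "'a measure"
  sample :: "nat \<Rightarrow> nat \<Rightarrow> 'a \<Rightarrow> nat \<Rightarrow> real"
  hole_row :: nat
  hole_col :: nat

locale network =
  fixes p p1 p2 r nr nc :: nat and \<alpha> :: "nat \<Rightarrow> real"
begin

primrec dims :: "sym \<Rightarrow> nat \<times> nat" where
  "dims Cov = (p, p)"
| "dims Hole = (nc, nr)"
| "dims (Gr l) = net_dims p p1 p2 l"
| "dims (Wt l) = net_dims p p1 p2 l"
| "dims (Te l) = net_dims p r p2 l"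

text \<open>The gradient with the residual multiplied out and the batch average collected in
  \<open>Cov\<close>. Each word has one \<open>Cov\<close> and at most three weights.\<close>

primrec grad_words :: "layer \<Rightarrow> (real \<times> sym mterm) list" where
  "grad_words First =
    [(1, Times (Transp (Wt Second)) (Times (Plain (Wt Second)) (Times (Plain (Wt First)) (Times (Plain Cov) (Id p))))),
     (-1, Times (Transp (Wt Second)) (Times (Plain (Te Second)) (Times (Plain (Te First)) (Times (Plain Cov) (Id p)))))]"
| "grad_words Second =
    [(1, Times (Plain (Wt Second)) (Times (Plain (Wt First)) (Times (Plain Cov) (Times (Transp (Wt First)) (Id p1))))),
     (-1, Times (Plain (Te Second)) (Times (Plain (Te First)) (Times (Plain Cov) (Times (Transp (Wt First)) (Id p1)))))]"

primrec base_val ::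
  "'a run \<Rightarrow> (layer \<Rightarrow> nat \<Rightarrow> nat \<Rightarrow> real) \<Rightarrow> (nat \<Rightarrow> nat \<Rightarrow> real) \<Rightarrow> sym \<Rightarrow> nat \<Rightarrow> nat \<Rightarrow> real" where
  "base_val e w C Cov = C"
| "base_val e w C Hole = (\<lambda>u v. of_bool (u = hole_col e \<and> v = hole_row e))"
| "base_val e w C (Gr l) = (\<lambda>_ _. 0)"
| "base_val e w C (Wt l) = w l"
| "base_val e w C (Te l) = (\<lambda>u v. teacher e l $$ (u, v))"

definition grad_val :: "(sym \<Rightarrow> nat \<Rightarrow> nat \<Rightarrow> real) \<Rightarrow> layer \<Rightarrow> nat \<Rightarrow> nat \<Rightarrow> real" where
  "grad_val V l u v = (\<Sum>(c, N)\<leftarrow>grad_words l. c * entry dims V N u v)"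

text \<open>The constant of the locale is applied outside its assumptions, so it is defined for
  every run; its properties require \<open>admissible\<close>.\<close>

definition run_cov :: "'a run \<Rightarrow> 'a \<Rightarrow> nat \<Rightarrow> nat \<Rightarrow> nat \<Rightarrow> real" where
  "run_cov e \<omega> t = gaussian_family.cov p (batch e) (sample e) t \<omega>"

definition init_entry :: "'a run \<Rightarrow> layer \<Rightarrow> nat \<Rightarrow> nat \<Rightarrow> real" where
  "init_entry e l u v = init e l $$ (u, v)"

text \<open>The recursion of \<open>sgd\<close> entry by entry, defined at all indices so that
  derivatives exist everywhere; \<open>sgd_weight_at\<close> shows the agreement within the matrix
  sizes.\<close>

primrec weight_at :: "'a run \<Rightarrow> 'a \<Rightarrow> nat \<Rightarrow> layer \<Rightarrow> nat \<Rightarrow> nat \<Rightarrow> real" where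
  "weight_at e \<omega> 0 = init_entry e"
| "weight_at e \<omega> (Suc t) = (\<lambda>l u v. weight_at e \<omega> t l u v -
     \<alpha> t * grad_val (base_val e (weight_at e \<omega> t) (run_cov e \<omega> t)) l u v)"

text \<open>Symbols that have been eliminated are given the value 0.\<close>

definition cov_val :: "'a run \<Rightarrow> nat \<Rightarrow> 'a \<Rightarrow> sym \<Rightarrow> nat \<Rightarrow> nat \<Rightarrow> real" where
  "cov_val e t \<omega> = base_val e (weight_at e \<omega> t) (run_cov e \<omega> t)"

definition weight_val :: "'a run \<Rightarrow> nat \<Rightarrow> 'a \<Rightarrow> sym \<Rightarrow> nat \<Rightarrow> nat \<Rightarrow> real" where
  "weight_val e t \<omega> = base_val e (weight_at e \<omega> t) (\<lambda>_ _. 0)"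

text \<open>The only valuation in which all symbols have their meaning. One round goes from
  \<open>full_val\<close> by \<open>expand\<close> to \<open>cov_val\<close>, by eliminating
  \<open>Cov\<close> to \<open>weight_val\<close>, and by \<open>advance\<close> to
  \<open>full_val\<close> of the previous iteration.\<close>

definition full_val :: "'a run \<Rightarrow> nat \<Rightarrow> 'a \<Rightarrow> sym \<Rightarrow> nat \<Rightarrow> nat \<Rightarrow> real" where
  "full_val e t \<omega> s = (case s of Gr l \<Rightarrow> grad_val (cov_val e t \<omega>) l | _ \<Rightarrow> cov_val e t \<omega> s)"

definition const_val :: "'a run \<Rightarrow> sym \<Rightarrow> nat \<Rightarrow> nat \<Rightarrow> real" where
  "const_val e = base_val e (init_entry e) (\<lambda>_ _. 0)"

definition admissible :: "'a run \<Rightarrow> bool" where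
  "admissible e \<longleftrightarrow> prob_space (omega e) \<and> gaussian_samples (omega e) p (batch e) (sample e) \<and> 1 \<le> batch e"

definition keep :: "sym \<Rightarrow> (real \<times> sym mterm) list" where
  "keep s = [(1, Times (Plain s) (Id (snd (dims s))))]"

definition expand :: "sym \<Rightarrow> (real \<times> sym mterm) list" where
  "expand s = (case s of Gr l \<Rightarrow> grad_words l | _ \<Rightarrow> keep s)"

text \<open>The update rule read backwards in time. \<open>Cov\<close> and \<open>Gr\<close> receive
  empty lists, that is the value 0, in accordance with \<open>weight_val\<close>.\<close>

definition advance :: "nat \<Rightarrow> sym \<Rightarrow> (real \<times> sym mterm) list" where
  "advance t s = (case s of
     Wt l \<Rightarrow> [(1, Times (Plain (Wt l)) (Id (snd (dims s)))), (- \<alpha> t, Times (Plain (Gr l)) (Id (snd (dims s))))]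
   | Cov \<Rightarrow> [] | Gr l \<Rightarrow> [] | _ \<Rightarrow> keep s)"

lemma entry_keep: "v < n \<Longrightarrow> snd (dims s) = n \<Longrightarrow> entry dims V (Times (Plain s) (Id n)) u v = V s u v"
  by (simp add: sum_delta_lessThan)

lemma wf_expand: "wf_subst dims expand"
  unfolding wf_subst_def
proof
  fix s show "\<forall>(c, N)\<in>set (expand s). compatible dims N \<and> term_rows dims N = fst (dims s) \<and> term_cols N = snd (dims s)"
  proof (cases s)
    case (Gr l)
    then show ?thesis by (cases l) (auto simp: expand_def)
  qed (auto simp: expand_def keep_def)
qed

lemma wf_advance: "wf_subst dims (advance t)"
  unfolding wf_subst_def
proof
  fix s show "\<forall>(c, N)\<in>set (advance t s). compatible dims N \<and> term_rows dims N = fst (dims s) \<and> term_cols N = snd (dims s)"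
    by (cases s) (auto simp: advance_def keep_def)
qed

lemma expand_val:
  assumes "u < fst (dims s)" "v < snd (dims s)"
  shows "full_val e t \<omega> s u v = (\<Sum>(c, N)\<leftarrow>expand s. c * entry dims (cov_val e t \<omega>) N u v)"
proof (cases s)
  case (Gr l)
  then show ?thesis by (simp add: full_val_def expand_def grad_val_def)
qed (use assms in \<open>simp_all add: full_val_def expand_def keep_def entry_keep del: entry.simps\<close>)

lemma advance_val:
  assumes "u < fst (dims s)" "v < snd (dims s)"
  shows "weight_val e (Suc t) \<omega> s u v = (\<Sum>(c, N)\<leftarrow>advance t s. c * entry dims (full_val e t \<omega>) N u v)"
proof (cases s)
  case (Wt l)
  then show ?thesis using assms
    by (simp add: advance_def weight_val_def full_val_def cov_val_def entry_keep del: entry.simps)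
qed (use assms in \<open>simp_all add: weight_val_def advance_def full_val_def cov_val_def keep_def entry_keep del: entry.simps\<close>)

context
  fixes e :: "'a run"
  assumes e: "admissible e"
begin

interpretation gaussian_family "omega e" p "batch e" "sample e"
  using e by (simp add: admissible_def gaussian_family_def gaussian_family_axioms_def)

lemma derivation_base_val:
  assumes "\<And>l u v. derivation z (\<lambda>\<omega>. w \<omega> l u v) (\<lambda>_. 0)" and "\<And>u v. derivation z (\<lambda>\<omega>. C \<omega> u v) (\<lambda>_. 0)"
  shows "derivation z (\<lambda>\<omega>. base_val e (w \<omega>) (C \<omega>) s u v) (\<lambda>_. 0)"
  using assms by (cases s) (auto intro: derivation_const)

text \<open>The weights of iteration \<open>t\<close> are built from samples of earlier iterations
  only. This vanishing derivative plays the part of the independence between the weights and the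
  fresh samples.\<close>

lemma derivation_weight_at: "t \<le> fst z \<Longrightarrow> derivation z (\<lambda>\<omega>. weight_at e \<omega> t l u v) (\<lambda>_. 0)"
proof (induction t arbitrary: l u v)
  case 0
  then show ?case by (simp add: derivation_const)
next
  case (Suc t)
  have "derivation z (\<lambda>\<omega>. run_cov e \<omega> t u v) (\<lambda>_. 0)" for u v
    using derivation_cov[of z t u v] Suc.prems by (simp add: run_cov_def dcov_other)
  then have "derivation z (\<lambda>\<omega>. base_val e (weight_at e \<omega> t) (run_cov e \<omega> t) s u v) (\<lambda>_. 0)" for s u v
    using Suc by (intro derivation_base_val) auto
  then have entry: "derivation z (\<lambda>\<omega>. entry dims (base_val e (weight_at e \<omega> t) (run_cov e \<omega> t)) N u v) (\<lambda>_. 0)" for N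
    using derivation_entry[of z "\<lambda>\<omega>. base_val e (weight_at e \<omega> t) (run_cov e \<omega> t)" "\<lambda>_ _ _ _. 0" dims N u v]
    by (simp add: dentry_zero)
  have "derivation z (\<lambda>\<omega>. \<Sum>cN\<leftarrow>grad_words l. fst cN * entry dims (base_val e (weight_at e \<omega> t) (run_cov e \<omega> t)) (snd cN) u v)
      (\<lambda>_. \<Sum>cN\<leftarrow>grad_words l. fst cN * 0)"
    by (intro derivation_sum_list derivation_cmult entry)
  then have "derivation z (\<lambda>\<omega>. weight_at e \<omega> t l u v + (- \<alpha> t) * grad_val (base_val e (weight_at e \<omega> t) (run_cov e \<omega> t)) l u v)
      (\<lambda>_. 0 + (- \<alpha> t) * 0)"
    using Suc by (intro derivation_add derivation_cmult) (auto simp: grad_val_def case_prod_unfold)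
  then show ?case by simp
qed

lemma derivation_cov_val:
  assumes "t < fst z \<or> (t = fst z \<and> s \<noteq> Cov)"
  shows "derivation z (\<lambda>\<omega>. cov_val e t \<omega> s u v) (\<lambda>_. 0)"
proof (cases "t < fst z")
  case True
  then have "derivation z (\<lambda>\<omega>. run_cov e \<omega> t u v) (\<lambda>_. 0)" for u v
    using derivation_cov[of z t u v] by (simp add: run_cov_def dcov_other)
  then show ?thesis unfolding cov_val_def
    using derivation_weight_at True by (intro derivation_base_val) auto
next
  case False
  then have "t = fst z" "s \<noteq> Cov" using assms by auto
  then show ?thesis unfolding cov_val_def
    using derivation_weight_at[of t z] by (cases s) (auto intro: derivation_const)
qed

lemma integrable_cov_val: "integrable (omega e) (\<lambda>\<omega>. traces dims (cov_val e t \<omega>) w)"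
proof -
  \<comment> \<open>Nothing in \<open>cov_val e t\<close> involves iteration \<open>Suc t\<close>,
    so the derivative vanishes and integrability is all that is extracted.\<close>
  have "derivation (Suc t, 0, 0) (\<lambda>\<omega>. traces dims (cov_val e t \<omega>) w)
      (\<lambda>\<omega>. dtraces dims (cov_val e t \<omega>) ((\<lambda>_ _ _ _. 0) \<omega>) w)"
    by (rule derivation_traces) (simp add: derivation_cov_val)
  then show ?thesis by (rule derivation_integrable(1))
qed

lemma wishart_cov_val:
  assumes "compatible dims A" "term_rows dims A = p" "term_cols A = p" "closed_words dims w"
  shows "expectation (\<lambda>\<omega>. traces dims (cov_val e t \<omega>) (Times (Plain Cov) A # w)) =
    expectation (\<lambda>\<omega>. traces dims (cov_val e t \<omega>) (A # w)) +
    1 / real (batch e) * (\<Sum>v\<leftarrow>square_symbol.contractions dims Cov p A w.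
      expectation (\<lambda>\<omega>. traces dims (cov_val e t \<omega>) v))"
proof (rule wishart[OF _ _ _ _ assms])
  show "dims Cov = (p, p)" by simp
  show "cov_val e t \<omega> Cov = cov t \<omega>" for \<omega> by (simp add: cov_val_def run_cov_def)
  show "derivation z (\<lambda>\<omega>. cov_val e t \<omega> s u v) (\<lambda>_. 0)" if "s \<noteq> Cov" "fst z = t" for z s u v
    using that by (intro derivation_cov_val) auto
  show "1 \<le> batch e" using e by (simp add: admissible_def)
qed

lemma cov_val_sym: "cov_val e t \<omega> Cov u v = cov_val e t \<omega> Cov v u"
  using cov_sym by (simp add: cov_val_def run_cov_def)

end

end

text \<open>The one-sided bound is applied to \<open>f\<close> and \<open>g\<close> and then to
  their negatives.\<close>

lemma weights_subst_terms_eq: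
  assumes "\<And>s c N. (c, N) \<in> set (\<sigma> s) \<Longrightarrow> weight f N = g s"
    and "(c, v) \<in> set (subst_terms D \<sigma> w)"
  shows "weights f v = weights g w"
proof (rule antisym)
  show "weights f v \<le> weights g w"
    using assms by (intro weights_subst_terms[OF _ assms(2)]) auto
  have "weight (\<lambda>s. - f s) N \<le> - g s" if "(c, N) \<in> set (\<sigma> s)" for s c N
    using assms(1)[OF that] weight_cmult[of "-1" f N] by simp
  from weights_subst_terms[of \<sigma> "\<lambda>s. - f s" "\<lambda>s. - g s", OF this assms(2)] show "weights g w \<le> weights f v"
    using weights_cmult[of "-1" f v] weights_cmult[of "-1" g w] by simp
qed

lemma sum_list_concat_map: "(\<Sum>y\<leftarrow>concat (map h xs). g y) = (\<Sum>x\<leftarrow>xs. \<Sum>y\<leftarrow>h x. (g y :: real))"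
  by (induction xs) auto

lemma integral_sum_list_on:
  fixes f :: "'i \<Rightarrow> 'a \<Rightarrow> real"
  assumes "\<And>v. v \<in> set vs \<Longrightarrow> integrable M (f v)"
  shows "integral\<^sup>L M (\<lambda>\<omega>. \<Sum>v\<leftarrow>vs. f v \<omega>) = (\<Sum>v\<leftarrow>vs. integral\<^sup>L M (f v))"
proof -
  define g where "g v = (if v \<in> set vs then f v else (\<lambda>_. 0))" for v
  have "integrable M (g v)" for v using assms by (simp add: g_def)
  from integral_sum_list(1)[of M g vs, OF this]
  have "integral\<^sup>L M (\<lambda>\<omega>. \<Sum>v\<leftarrow>vs. g v \<omega>) = (\<Sum>v\<leftarrow>vs. integral\<^sup>L M (g v))" .
  moreover have "(\<Sum>v\<leftarrow>vs. g v \<omega>) = (\<Sum>v\<leftarrow>vs. f v \<omega>)" for \<omega>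
    by (intro arg_cong[where f=sum_list] map_cong) (auto simp: g_def)
  moreover have "(\<Sum>v\<leftarrow>vs. integral\<^sup>L M (g v)) = (\<Sum>v\<leftarrow>vs. integral\<^sup>L M (f v))"
    by (intro arg_cong[where f=sum_list] map_cong) (auto simp: g_def)
  ultimately show ?thesis by simp
qed

section \<open>Eliminating the covariances of one iteration\<close>

abbreviation nCov :: "sym \<Rightarrow> int" where "nCov s \<equiv> of_bool (s = Cov)"
abbreviation nHole :: "sym \<Rightarrow> int" where "nHole s \<equiv> of_bool (s = Hole)"
abbreviation nGr :: "sym \<Rightarrow> int" where "nGr s \<equiv> of_bool (is_Gr s)"
abbreviation nWt :: "sym \<Rightarrow> int" where "nWt s \<equiv> of_bool (is_Wt s)"

context network
begin

text \<open>Along each branch, an application of \<open>wishart_cov_val\<close> removes one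
  \<open>Cov\<close> and yields at most one factor 1/b, so the number of \<open>Cov\<close> bounds
  both the depth of the recursion and the power. Any count that ignores \<open>Cov\<close> is
  unchanged.\<close>

lemma eliminate:
  assumes "closed_words dims w"
  shows "\<exists>L. (\<forall>(k, v)\<in>set L. closed_words dims v \<and> int k \<le> weights nCov w \<and> weights nCov v = 0 \<and>
      (\<forall>f. f Cov = 0 \<longrightarrow> weights f v = weights f w)) \<and>
    (\<forall>(e :: 'a run) t. admissible e \<longrightarrow> integral\<^sup>L (omega e) (\<lambda>\<omega>. traces dims (cov_val e t \<omega>) w) =
      (\<Sum>(k, v)\<leftarrow>L. (1 / real (batch e)) ^ k * integral\<^sup>L (omega e) (\<lambda>\<omega>. traces dims (cov_val e t \<omega>) v)))"
    (is "\<exists>L. ?P w L")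
  using assms
proof (induction "nat (weights nCov w)" arbitrary: w rule: less_induct)
  case less
  interpret square_symbol dims Cov p by unfold_locales simp
  have nonneg: "0 \<le> weights nCov w" for w by (rule weights_nonneg) simp
  let ?E = "\<lambda>(e :: 'a run) t v. integral\<^sup>L (omega e) (\<lambda>\<omega>. traces dims (cov_val e t \<omega>) v)"
  show ?case
  proof (cases "weights nCov w = 0")
    case True
    then show ?thesis using less.prems by (intro exI[of _ "[(0, w)]"]) simp
  next
    case False
    then obtain A v where A: "compatible dims A" "term_rows dims A = p" "term_cols A = p"
      and v: "closed_words dims v"
      and wt: "\<And>f. weight f A + weights f v + f Cov = weights f w"
      and tr: "\<And>V. (\<And>u v. V Cov u v = V Cov v u) \<Longrightarrow> traces dims V w = traces dims V (SQ A # v)"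
      by (rule rotate_words[OF less.prems]) blast
    \<comment> \<open>Power 0 goes with the word from which \<open>Cov\<close> has simply been
      deleted, power 1 with each contraction.\<close>
    define U where "U = (0::nat, A # v) # map (Pair 1) (contractions A v)"
    have U: "closed_words dims u \<and> (\<forall>f. weights f u = weight f A + weights f v) \<and> k \<le> 1" if "(k, u) \<in> set U" for k u
      using that A v contractions_wf[OF A v] by (auto simp: U_def square_term_def)
    have Cov: "weights nCov u = weights nCov w - 1" if "(k, u) \<in> set U" for k u
      using U[OF that] wt[of nCov] by simp
    have "\<exists>L. ?P u L" if "(k, u) \<in> set U" for k u
      using Cov[OF that] nonneg[of u] U[OF that] by (intro less.hyps) auto
    then have "\<exists>L. ?P (snd ku) L" if "ku \<in> set U" for ku
      using that by (cases ku) auto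
    then obtain Lf where "\<forall>ku\<in>set U. ?P (snd ku) (Lf ku)"
      using bchoice[of "set U" "\<lambda>ku L. ?P (snd ku) L"] by blast
    then have L1: "\<And>k u k' u'. (k, u) \<in> set U \<Longrightarrow> (k', u') \<in> set (Lf (k, u)) \<Longrightarrow>
        closed_words dims u' \<and> int k' \<le> weights nCov u \<and> weights nCov u' = 0 \<and>
        (\<forall>f. f Cov = 0 \<longrightarrow> weights f u' = weights f u)"
      and L2: "\<And>ku e t. ku \<in> set U \<Longrightarrow> admissible e \<Longrightarrow> ?E e t (snd ku) =
        (\<Sum>(k, v)\<leftarrow>Lf ku. (1 / real (batch e)) ^ k * ?E e t v)"
      by fastforce+
    define L where "L = concat (map (\<lambda>ku. map (\<lambda>(k', u'). (fst ku + k', u')) (Lf ku)) U)"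
    have "?P w L"
    proof (intro conjI ballI allI impI)
      fix x assume "x \<in> set L"
      then obtain k u k' u' where x: "x = (k + k', u')" and ku: "(k, u) \<in> set U" and ku': "(k', u') \<in> set (Lf (k, u))"
        unfolding L_def by auto
      have "weights f u' = weights f w" if "f Cov = 0" for f
        using L1[OF ku ku'] U[OF ku] wt[of f] that by simp
      then show "case x of (k, v) \<Rightarrow> closed_words dims v \<and> int k \<le> weights nCov w \<and> weights nCov v = 0 \<and>
          (\<forall>f. f Cov = 0 \<longrightarrow> weights f v = weights f w)"
        using L1[OF ku ku'] U[OF ku] Cov[OF ku] by (simp add: x)
    next
      fix e :: "'a run" and t assume e: "admissible e"
      have "?E e t w = ?E e t (SQ A # v)"
        using tr[of "cov_val e t \<omega>" for \<omega>, OF cov_val_sym[OF e]] by (simp only:)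
      also have "\<dots> = ?E e t (A # v) + 1 / real (batch e) * (\<Sum>u\<leftarrow>contractions A v. ?E e t u)"
        by (rule wishart_cov_val[OF e A v])
      also have "\<dots> = (\<Sum>ku\<leftarrow>U. (1 / real (batch e)) ^ fst ku * ?E e t (snd ku))"
        by (simp add: U_def comp_def divide_inverse mult.commute[of _ "inverse _"] sum_list_const_mult)
      also have "\<dots> = (\<Sum>ku\<leftarrow>U. (1 / real (batch e)) ^ fst ku * (\<Sum>(k, v)\<leftarrow>Lf ku. (1 / real (batch e)) ^ k * ?E e t v))"
        using L2[OF _ e] by (intro arg_cong[where f=sum_list] map_cong refl) simp
      also have "\<dots> = (\<Sum>(k, v)\<leftarrow>L. (1 / real (batch e)) ^ k * ?E e t v)"
        unfolding L_def sum_list_concat_map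
        by (simp add: comp_def case_prod_unfold power_add mult.assoc sum_list_const_mult)
      finally show "?E e t w = \<dots>" .
    qed
    then show ?thesis by blast
  qed
qed

lemma weight_expand:
  assumes "(c, N) \<in> set (expand s)"
  shows "weight nCov N \<le> nGr s + nCov s" "weight nWt N \<le> 3 * nGr s + nWt s"
    "weight nHole N = nHole s" "weight nGr N = 0"
proof -
  have "weight nCov N \<le> nGr s + nCov s \<and> weight nWt N \<le> 3 * nGr s + nWt s \<and>
    weight nHole N = nHole s \<and> weight nGr N = 0"
  proof (cases s)
    case (Gr l)
    then show ?thesis using assms by (cases l) (auto simp: expand_def)
  qed (use assms in \<open>auto simp: expand_def keep_def\<close>)
  then show "weight nCov N \<le> nGr s + nCov s" "weight nWt N \<le> 3 * nGr s + nWt s"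
    "weight nHole N = nHole s" "weight nGr N = 0" by auto
qed

lemma weight_advance:
  assumes "(c, N) \<in> set (advance t s)"
  shows "weight nCov N = 0" "weight (\<lambda>s. nGr s + nWt s) N = nWt s" "weight nHole N = nHole s"
proof -
  have "weight nCov N = 0 \<and> weight (\<lambda>s. nGr s + nWt s) N = nWt s \<and> weight nHole N = nHole s"
    by (cases s) (use assms in \<open>auto simp: advance_def keep_def\<close>)
  then show "weight nCov N = 0" "weight (\<lambda>s. nGr s + nWt s) N = nWt s" "weight nHole N = nHole s" by auto
qed

lemma weights_zero_fun [simp]: "weights (\<lambda>_. 0) w = 0"
  by (rule weights_eq_0) simp

text \<open>Every gradient brings one \<open>Cov\<close>, whence the bound on the power, and at most
  three weights, whence the factor 3.\<close>

lemma one_step: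
  assumes "closed_words dims w" "weights nCov w = 0"
  shows "\<exists>L. (\<forall>(c, k, v)\<in>set L. closed_words dims v \<and> int k \<le> weights nGr w \<and> weights nCov v = 0 \<and>
      weights nGr v = 0 \<and> weights nHole v = weights nHole w \<and>
      weights nWt v \<le> 3 * weights nGr w + weights nWt w) \<and>
    (\<forall>(e :: 'a run) t. admissible e \<longrightarrow> integrable (omega e) (\<lambda>\<omega>. traces dims (full_val e t \<omega>) w) \<and>
      integral\<^sup>L (omega e) (\<lambda>\<omega>. traces dims (full_val e t \<omega>) w) =
      (\<Sum>(c, k, v)\<leftarrow>L. c * (1 / real (batch e)) ^ k * integral\<^sup>L (omega e) (\<lambda>\<omega>. traces dims (weight_val e t \<omega>) v)))"
proof -
  let ?E = "\<lambda>(e :: 'a run) t v. integral\<^sup>L (omega e) (\<lambda>\<omega>. traces dims (cov_val e t \<omega>) v)"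
  define U where "U = subst_terms dims expand w"
  have U: "closed_words dims u" "weights nCov u \<le> weights nGr w"
    "weights nWt u \<le> 3 * weights nGr w + weights nWt w"
    "weights nHole u = weights nHole w" "weights nGr u = 0"
    if "(c, u) \<in> set U" for c u
  proof -
    note cu = that[unfolded U_def]
    show "closed_words dims u" by (rule subst_terms_closed[OF wf_expand assms(1) cu])
    show "weights nCov u \<le> weights nGr w"
      using weights_subst_terms[of expand nCov "\<lambda>s. nGr s + nCov s", OF weight_expand(1) cu] assms(2)
      by (simp add: weights_add)
    show "weights nWt u \<le> 3 * weights nGr w + weights nWt w"
      using weights_subst_terms[of expand nWt "\<lambda>s. 3 * nGr s + nWt s", OF weight_expand(2) cu]
      by (simp only: weights_add weights_cmult)
    show "weights nHole u = weights nHole w"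
      by (rule weights_subst_terms_eq[of expand, OF weight_expand(3) cu])
    show "weights nGr u = 0"
      using weights_subst_terms_eq[of expand nGr "\<lambda>_. 0", OF weight_expand(4) cu] by simp
  qed
  define P where "P u L \<longleftrightarrow> (\<forall>(k, v)\<in>set L. closed_words dims v \<and> int k \<le> weights nCov u \<and> weights nCov v = 0 \<and>
      (\<forall>f. f Cov = 0 \<longrightarrow> weights f v = weights f u)) \<and>
    (\<forall>(e :: 'a run) t. admissible e \<longrightarrow> ?E e t u = (\<Sum>(k, v)\<leftarrow>L. (1 / real (batch e)) ^ k * ?E e t v))" for u L
  have "\<exists>L. P (snd cu) L" if "cu \<in> set U" for cu
    using eliminate[OF U(1)[of "fst cu" "snd cu"]] that by (simp add: P_def)
  then obtain Lf where Lf: "\<And>cu. cu \<in> set U \<Longrightarrow> P (snd cu) (Lf cu)"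
    by metis
  define L where "L = concat (map (\<lambda>cu. map (\<lambda>(k, v). (fst cu, k, v)) (Lf cu)) U)"
  show ?thesis
  proof (rule exI[of _ L], intro conjI ballI allI impI)
    fix x assume "x \<in> set L"
    then obtain c u k v where x: "x = (c, k, v)" and cu: "(c, u) \<in> set U" and kv: "(k, v) \<in> set (Lf (c, u))"
      unfolding L_def by auto
    have "closed_words dims v \<and> int k \<le> weights nCov u \<and> weights nCov v = 0 \<and>
        (\<forall>f. f Cov = 0 \<longrightarrow> weights f v = weights f u)"
      using Lf[OF cu] kv by (auto simp: P_def)
    moreover from this have "weights nWt v = weights nWt u" "weights nHole v = weights nHole u" "weights nGr v = weights nGr u"
      by simp_all
    ultimately show "case x of (c, k, v) \<Rightarrow> closed_words dims v \<and> int k \<le> weights nGr w \<and> weights nCov v = 0 \<and>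
      weights nGr v = 0 \<and> weights nHole v = weights nHole w \<and> weights nWt v \<le> 3 * weights nGr w + weights nWt w"
      using U[OF cu] by (simp add: x)
  next
    fix e :: "'a run" and t assume e: "admissible e"
    have full: "traces dims (full_val e t \<omega>) w = (\<Sum>cu\<leftarrow>U. fst cu * traces dims (cov_val e t \<omega>) (snd cu))" for \<omega>
      using traces_subst_terms[OF wf_expand expand_val assms(1), of e t \<omega>]
      by (simp add: U_def case_prod_unfold)
    have int: "integrable (omega e) (\<lambda>\<omega>. fst cu * traces dims (cov_val e t \<omega>) (snd cu))" for cu :: "real \<times> sym mterm list"
      by (intro integrable_mult_right integrable_cov_val[OF e])
    show "integrable (omega e) (\<lambda>\<omega>. traces dims (full_val e t \<omega>) w)"
      unfolding full by (rule integral_sum_list(2)[OF int])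
    have "integral\<^sup>L (omega e) (\<lambda>\<omega>. traces dims (full_val e t \<omega>) w) = (\<Sum>cu\<leftarrow>U. fst cu * ?E e t (snd cu))"
      unfolding full integral_sum_list(1)[where f="\<lambda>cu \<omega>. fst cu * traces dims (cov_val e t \<omega>) (snd cu)", OF int]
      by simp
    also have "\<dots> = (\<Sum>cu\<leftarrow>U. fst cu * (\<Sum>(k, v)\<leftarrow>Lf cu. (1 / real (batch e)) ^ k * ?E e t v))"
      using Lf e by (intro arg_cong[where f=sum_list] map_cong refl) (simp add: P_def)
    also have "\<dots> = (\<Sum>cu\<leftarrow>U. \<Sum>(k, v)\<leftarrow>Lf cu. fst cu * (1 / real (batch e)) ^ k *
        integral\<^sup>L (omega e) (\<lambda>\<omega>. traces dims (weight_val e t \<omega>) v))"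
    proof (intro arg_cong[where f=sum_list] map_cong refl)
      fix cu assume cu: "cu \<in> set U"
      have "?E e t v = integral\<^sup>L (omega e) (\<lambda>\<omega>. traces dims (weight_val e t \<omega>) v)" if "(k, v) \<in> set (Lf cu)" for k v
      proof -
        have v: "closed_words dims v" "weights nCov v = 0" using Lf[OF cu] that by (auto simp: P_def)
        \<comment> \<open>The two valuations differ only at \<open>Cov\<close>, which no longer
          occurs.\<close>
        have "traces dims (cov_val e t \<omega>) v = traces dims (weight_val e t \<omega>) v" for \<omega>
        proof (rule traces_cong[OF v(1)])
          fix M s i j assume "M \<in> set v" "s \<in> set (symbols M)"
          then have "s \<noteq> Cov" using weights_zeroD[of nCov v M s] v(2) by auto
          then show "cov_val e t \<omega> s i j = weight_val e t \<omega> s i j"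
            by (cases s) (simp_all add: cov_val_def weight_val_def)
        qed
        then show ?thesis by simp
      qed
      then have "(\<Sum>(k, v)\<leftarrow>Lf cu. fst cu * ((1 / real (batch e)) ^ k * ?E e t v)) = (\<Sum>(k, v)\<leftarrow>Lf cu. fst cu * (1 / real (batch e)) ^ k *
          integral\<^sup>L (omega e) (\<lambda>\<omega>. traces dims (weight_val e t \<omega>) v))"
        by (intro arg_cong[where f=sum_list] map_cong refl) auto
      then show "fst cu * (\<Sum>(k, v)\<leftarrow>Lf cu. (1 / real (batch e)) ^ k * ?E e t v) =
          (\<Sum>(k, v)\<leftarrow>Lf cu. fst cu * (1 / real (batch e)) ^ k *
          integral\<^sup>L (omega e) (\<lambda>\<omega>. traces dims (weight_val e t \<omega>) v))"
        by (simp add: case_prod_unfold flip: sum_list_const_mult)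
    qed
    also have "\<dots> = (\<Sum>(c, k, v)\<leftarrow>L. c * (1 / real (batch e)) ^ k * integral\<^sup>L (omega e) (\<lambda>\<omega>. traces dims (weight_val e t \<omega>) v))"
      unfolding L_def sum_list_concat_map by (simp add: comp_def case_prod_unfold)
    finally show "integral\<^sup>L (omega e) (\<lambda>\<omega>. traces dims (full_val e t \<omega>) w) = \<dots>" .
  qed
qed

text \<open>The value is (3^t - 1)/2; the geometric sum keeps the bound on the powers within the
  integers.\<close>

definition geo :: "nat \<Rightarrow> int" where
  "geo t = (\<Sum>i<t. 3 ^ i)"

lemma geo_Suc: "geo (Suc t) = 3 * geo t + 1" "geo t \<le> geo (Suc t)" "0 \<le> geo t"
proof -
  have "2 * geo t + 1 = 3 ^ t" for t
    by (induction t) (auto simp: geo_def)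
  from this[of t] show "geo (Suc t) = 3 * geo t + 1" by (simp add: geo_def)
  show "geo t \<le> geo (Suc t)" by (simp add: geo_def)
  show "0 \<le> geo t" by (simp add: geo_def sum_nonneg)
qed

text \<open>With G gradients and W weights, one round costs at most G powers of 1/b and leaves at
  most 3G + W weights. Rewritten in the previous iteration, each of these is a weight or a gradient,
  and the worst case is that all are gradients. This gives the recursion
  \<open>geo (Suc t) = 3 * geo t + 1\<close> for the powers and one factor 3 per iteration for the
  degree.\<close>

theorem expectation_expansion:
  assumes "closed_words dims w" "weights nCov w = 0"
  shows "\<exists>L. (\<forall>(c, k, v)\<in>set L. closed_words dims v \<and> weights nCov v = 0 \<and> weights nGr v = 0 \<and>
      weights nHole v = weights nHole w \<and>
      int k \<le> geo (Suc t) * weights nGr w + geo t * weights nWt w \<and>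
      weights nWt v \<le> 3 ^ t * (3 * weights nGr w + weights nWt w)) \<and>
    (\<forall>e :: 'a run. admissible e \<longrightarrow> integrable (omega e) (\<lambda>\<omega>. traces dims (full_val e t \<omega>) w) \<and>
      integral\<^sup>L (omega e) (\<lambda>\<omega>. traces dims (full_val e t \<omega>) w) =
      (\<Sum>(c, k, v)\<leftarrow>L. c * (1 / real (batch e)) ^ k * traces dims (const_val e) v))"
  using assms
proof (induction t arbitrary: w)
  \<comment> \<open>The weights of iteration 0 are deterministic, so after one step the remaining
    integrands are constants.\<close>
  case 0
  obtain L where L: "\<forall>(c, k, v)\<in>set L. closed_words dims v \<and> int k \<le> weights nGr w \<and> weights nCov v = 0 \<and>
      weights nGr v = 0 \<and> weights nHole v = weights nHole w \<and>
      weights nWt v \<le> 3 * weights nGr w + weights nWt w"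
    and E: "\<And>(e :: 'a run) t. admissible e \<Longrightarrow> integrable (omega e) (\<lambda>\<omega>. traces dims (full_val e t \<omega>) w) \<and>
      integral\<^sup>L (omega e) (\<lambda>\<omega>. traces dims (full_val e t \<omega>) w) =
      (\<Sum>(c, k, v)\<leftarrow>L. c * (1 / real (batch e)) ^ k * integral\<^sup>L (omega e) (\<lambda>\<omega>. traces dims (weight_val e t \<omega>) v))"
    using one_step[OF 0] by blast
  have "integral\<^sup>L (omega e) (\<lambda>\<omega>. traces dims (weight_val e 0 \<omega>) v) = traces dims (const_val e) v"
    if "admissible e" for e :: "'a run" and v
    using that by (simp add: weight_val_def const_val_def admissible_def prob_space.prob_space)
  then show ?case using L E by (intro exI[of _ L]) (auto simp: geo_def)
next
  case (Suc t)
  let ?G = "weights nGr w" and ?W = "weights nWt w"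
  have nonneg: "0 \<le> weights nGr w" "0 \<le> weights nWt w" "0 \<le> weights nCov w" for w
    by (rule weights_nonneg, simp)+
  obtain L1 where L1: "\<And>c k v. (c, k, v) \<in> set L1 \<Longrightarrow> closed_words dims v \<and> int k \<le> ?G \<and> weights nCov v = 0 \<and>
      weights nGr v = 0 \<and> weights nHole v = weights nHole w \<and> weights nWt v \<le> 3 * ?G + ?W"
    and E1: "\<And>(e :: 'a run) t. admissible e \<Longrightarrow> integrable (omega e) (\<lambda>\<omega>. traces dims (full_val e t \<omega>) w) \<and>
      integral\<^sup>L (omega e) (\<lambda>\<omega>. traces dims (full_val e t \<omega>) w) =
      (\<Sum>(c, k, v)\<leftarrow>L1. c * (1 / real (batch e)) ^ k * integral\<^sup>L (omega e) (\<lambda>\<omega>. traces dims (weight_val e t \<omega>) v))"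
    using one_step[OF Suc.prems] by fastforce
  define U where "U v = subst_terms dims (advance t) v" for v
  define B where "B u \<longleftrightarrow> closed_words dims u \<and> weights nCov u = 0 \<and> weights nHole u = weights nHole w \<and>
    weights nGr u + weights nWt u \<le> 3 * ?G + ?W" for u
  have U: "B u" if "(c, k, v) \<in> set L1" "(c', u) \<in> set (U v)" for c k v c' u
  proof -
    note v = L1[OF that(1)] and cu = that(2)[unfolded U_def]
    have "closed_words dims u"
      using subst_terms_closed[OF wf_advance _ cu] v by blast
    moreover have "weights nCov u = 0"
      using weights_subst_terms_eq[of "advance t" nCov "\<lambda>_. 0", OF weight_advance(1) cu] by simp
    moreover have "weights nHole u = weights nHole v"
      by (rule weights_subst_terms_eq[of "advance t", OF weight_advance(3) cu])
    moreover have "weights nGr u + weights nWt u = weights nWt v"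
      using weights_subst_terms_eq[of "advance t" "\<lambda>s. nGr s + nWt s" nWt, OF weight_advance(2) cu]
      by (simp only: weights_add)
    ultimately show ?thesis using v by (simp add: B_def)
  qed
  define P where "P u L \<longleftrightarrow> (\<forall>(c, k, v)\<in>set L. closed_words dims v \<and> weights nCov v = 0 \<and> weights nGr v = 0 \<and>
      weights nHole v = weights nHole u \<and>
      int k \<le> geo (Suc t) * weights nGr u + geo t * weights nWt u \<and>
      weights nWt v \<le> 3 ^ t * (3 * weights nGr u + weights nWt u)) \<and>
    (\<forall>e :: 'a run. admissible e \<longrightarrow> integrable (omega e) (\<lambda>\<omega>. traces dims (full_val e t \<omega>) u) \<and>
      integral\<^sup>L (omega e) (\<lambda>\<omega>. traces dims (full_val e t \<omega>) u) =
      (\<Sum>(c, k, v)\<leftarrow>L. c * (1 / real (batch e)) ^ k * traces dims (const_val e) v))" for u L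
  have "\<exists>L. P u L" if "B u" for u
    using Suc.IH[of u] that by (simp add: P_def B_def)
  then obtain Lf where Lf: "\<And>u. B u \<Longrightarrow> P u (Lf u)"
    by metis
  define L where "L = concat (map (\<lambda>(c, k, v). concat (map (\<lambda>(c', u).
    map (\<lambda>(c'', k'', x). (c * c' * c'', k + k'', x)) (Lf u)) (U v))) L1)"
  show ?case
  proof (rule exI[of _ L], intro conjI ballI allI impI)
    fix y assume "y \<in> set L"
    then obtain c k v c' u c'' k'' x where y: "y = (c * c' * c'', k + k'', x)"
      and kv: "(c, k, v) \<in> set L1" and cu: "(c', u) \<in> set (U v)" and x: "(c'', k'', x) \<in> set (Lf u)"
      unfolding L_def by auto
    have u: "B u" by (rule U[OF kv cu])
    have X: "closed_words dims x \<and> weights nCov x = 0 \<and> weights nGr x = 0 \<and>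
        weights nHole x = weights nHole u \<and>
        int k'' \<le> geo (Suc t) * weights nGr u + geo t * weights nWt u \<and>
        weights nWt x \<le> 3 ^ t * (3 * weights nGr u + weights nWt u)"
      using Lf[OF u] x by (auto simp: P_def)
    \<comment> \<open>A remaining weight is charged at the rate of a gradient, so that only the sum
      of both counts, bounded in \<open>B\<close>, matters.\<close>
    have "geo t * weights nWt u \<le> geo (Suc t) * weights nWt u"
      using geo_Suc(2) nonneg(2) by (rule mult_right_mono)
    moreover have "geo (Suc t) * (weights nGr u + weights nWt u) \<le> geo (Suc t) * (3 * ?G + ?W)"
      using u geo_Suc(3) by (intro mult_left_mono) (auto simp: B_def)
    ultimately have "int k'' \<le> geo (Suc t) * (3 * ?G + ?W)"
      using X by (simp add: distrib_left)
    \<comment> \<open>\<open>k\<close> is at most \<open>?G\<close>; adding this turns the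
      coefficient \<open>3 * geo (Suc t)\<close> of \<open>?G\<close> into
      \<open>geo (Suc (Suc t))\<close>.\<close>
    then have k: "int (k + k'') \<le> geo (Suc (Suc t)) * ?G + geo (Suc t) * ?W"
      using L1[OF kv] by (simp add: geo_Suc(1)[of "Suc t"] algebra_simps)
    have "3 * weights nGr u + weights nWt u \<le> 3 * (3 * ?G + ?W)"
    proof -
      have "weights nGr u + weights nWt u \<le> 3 * ?G + ?W" using u by (simp add: B_def)
      moreover have "g + v \<le> n \<Longrightarrow> 0 \<le> v \<Longrightarrow> 3 * g + v \<le> 3 * n" for g v n :: int
        by simp
      ultimately show ?thesis using nonneg(2)[of u] by blast
    qed
    then have "3 ^ t * (3 * weights nGr u + weights nWt u) \<le> 3 ^ t * (3 * (3 * ?G + ?W))"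
      by (intro mult_left_mono) auto
    then have "weights nWt x \<le> 3 ^ Suc t * (3 * ?G + ?W)"
      using X by (simp add: algebra_simps)
    then show "case y of (c, k, v) \<Rightarrow> closed_words dims v \<and> weights nCov v = 0 \<and> weights nGr v = 0 \<and>
        weights nHole v = weights nHole w \<and>
        int k \<le> geo (Suc (Suc t)) * ?G + geo (Suc t) * ?W \<and>
        weights nWt v \<le> 3 ^ Suc t * (3 * ?G + ?W)"
      using X k u by (simp add: y B_def)
  next
    fix e :: "'a run" assume e: "admissible e"
    show "integrable (omega e) (\<lambda>\<omega>. traces dims (full_val e (Suc t) \<omega>) w)"
      using E1[OF e] by blast
    let ?b = "1 / real (batch e)"
    have v: "integral\<^sup>L (omega e) (\<lambda>\<omega>. traces dims (weight_val e (Suc t) \<omega>) v) =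
        (\<Sum>(c', u)\<leftarrow>U v. c' * (\<Sum>(c'', k'', x)\<leftarrow>Lf u. c'' * ?b ^ k'' * traces dims (const_val e) x))"
      if kv: "(c, k, v) \<in> set L1" for c k v
    proof -
      have *: "integrable (omega e) (\<lambda>\<omega>. traces dims (full_val e t \<omega>) (snd cu))"
        "integral\<^sup>L (omega e) (\<lambda>\<omega>. traces dims (full_val e t \<omega>) (snd cu)) =
          (\<Sum>(c, k, v)\<leftarrow>Lf (snd cu). c * ?b ^ k * traces dims (const_val e) v)"
        if "cu \<in> set (U v)" for cu
        using Lf[OF U[OF kv, of "fst cu" "snd cu"]] that e by (simp_all add: P_def)
      have "traces dims (weight_val e (Suc t) \<omega>) v = (\<Sum>cu\<leftarrow>U v. fst cu * traces dims (full_val e t \<omega>) (snd cu))" for \<omega>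
        using traces_subst_terms[OF wf_advance advance_val, of v e t \<omega>] L1[OF kv]
        by (simp add: U_def case_prod_unfold)
      then have "integral\<^sup>L (omega e) (\<lambda>\<omega>. traces dims (weight_val e (Suc t) \<omega>) v) =
          integral\<^sup>L (omega e) (\<lambda>\<omega>. \<Sum>cu\<leftarrow>U v. fst cu * traces dims (full_val e t \<omega>) (snd cu))"
        by simp
      also have "\<dots> = (\<Sum>cu\<leftarrow>U v. fst cu * integral\<^sup>L (omega e) (\<lambda>\<omega>. traces dims (full_val e t \<omega>) (snd cu)))"
        using *(1) by (subst integral_sum_list_on) auto
      also have "\<dots> = (\<Sum>cu\<leftarrow>U v. fst cu * (\<Sum>(c, k, v)\<leftarrow>Lf (snd cu). c * ?b ^ k * traces dims (const_val e) v))"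
        using *(2) by (intro arg_cong[where f=sum_list] map_cong refl) simp
      finally show ?thesis by (simp add: case_prod_unfold)
    qed
    have "integral\<^sup>L (omega e) (\<lambda>\<omega>. traces dims (full_val e (Suc t) \<omega>) w) =
      (\<Sum>(c, k, v)\<leftarrow>L1. c * ?b ^ k * (\<Sum>(c', u)\<leftarrow>U v. c' * (\<Sum>(c'', k'', x)\<leftarrow>Lf u. c'' * ?b ^ k'' * traces dims (const_val e) x)))"
      using E1[OF e, of "Suc t"] v by (auto intro!: arg_cong[where f=sum_list] map_cong)
    also have "\<dots> = (\<Sum>(c, k, v)\<leftarrow>L. c * ?b ^ k * traces dims (const_val e) v)"
      unfolding L_def
      by (simp add: sum_list_concat_map comp_def case_prod_unfold power_add mult_ac flip: sum_list_const_mult)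
    finally show "integral\<^sup>L (omega e) (\<lambda>\<omega>. traces dims (full_val e (Suc t) \<omega>) w) = \<dots>" .
  qed
qed

end

section \<open>From words back to matrices and conditional expectations\<close>

lemma term_val_carrier:
  assumes "compatible D M" "\<And>s. s \<in> set (symbols M) \<Longrightarrow> V s \<in> carrier_mat (fst (D s)) (snd (D s))"
  shows "term_val V M \<in> carrier_mat (term_rows D M) (term_cols M)"
  using assms
proof (induction M)
  case (Times A M)
  have "factor_val V A \<in> carrier_mat (fst (factor_dims D A)) (snd (factor_dims D A))"
    using Times.prems(2)[of "symbol A"] by (cases A) auto
  then show ?case using Times by (auto intro: mult_carrier_mat)
qed simp

lemma term_val_entry:
  assumes "compatible D M" "\<And>s. s \<in> set (symbols M) \<Longrightarrow> V s \<in> carrier_mat (fst (D s)) (snd (D s))"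
    and "i < term_rows D M" "j < term_cols M"
  shows "term_val V M $$ (i, j) = entry D (\<lambda>s u v. V s $$ (u, v)) M i j"
  using assms
proof (induction M arbitrary: i)
  case (Times A M)
  let ?n = "snd (factor_dims D A)"
  have A: "factor_val V A \<in> carrier_mat (fst (factor_dims D A)) ?n"
    using Times.prems(2)[of "symbol A"] by (cases A) auto
  have M: "term_val V M \<in> carrier_mat ?n (term_cols M)"
    using term_val_carrier[of D M V] Times.prems by auto
  have fac: "factor_val V A $$ (i, k) = factor_entry (\<lambda>s u v. V s $$ (u, v)) A i k" if "k < ?n" for k
    using Times.prems(2)[of "symbol A"] Times.prems(3) that by (cases A) auto
  have "term_val V (Times A M) $$ (i, j) = (\<Sum>k<?n. factor_val V A $$ (i, k) * term_val V M $$ (k, j))"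
    using A M Times.prems by (simp add: scalar_prod_def lessThan_atLeast0)
  also have "\<dots> = (\<Sum>k<?n. factor_entry (\<lambda>s u v. V s $$ (u, v)) A i k * entry D (\<lambda>s u v. V s $$ (u, v)) M k j)"
    using fac Times by (intro sum.cong refl arg_cong2[where f="(*)"]) auto
  finally show ?case by simp
qed simp

lemma mat_trace_term_val:
  assumes "compatible D M" "square_term D M"
    and "\<And>s. s \<in> set (symbols M) \<Longrightarrow> V s \<in> carrier_mat (fst (D s)) (snd (D s))"
  shows "mat_trace (term_val V M) = word_trace D (\<lambda>s u v. V s $$ (u, v)) M"
  using term_val_carrier[OF assms(1,3)] assms
  by (auto simp: mat_trace_def word_trace_def square_term_def intro!: sum.cong term_val_entry)

lemma set_mterm_symbols: "set_mterm M = set (symbols M)"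
proof (induction M)
  case (Times A M)
  then show ?case by (cases A) auto
qed simp

lemma map_mterm_simps [simp]:
  "symbols (map_mterm f M) = map f (symbols M)"
  "term_rows D (map_mterm f M) = term_rows (\<lambda>s. D (f s)) M"
  "term_cols (map_mterm f M) = term_cols M"
  "compatible D (map_mterm f M) = compatible (\<lambda>s. D (f s)) M"
  "square_term D (map_mterm f M) = square_term (\<lambda>s. D (f s)) M"
proof -
  have A: "factor_dims D (map_factor f A) = factor_dims (\<lambda>s. D (f s)) A" for A
    by (cases A) auto
  have B: "symbol (map_factor f A) = f (symbol A)" for A
    by (cases A) auto
  show "symbols (map_mterm f M) = map f (symbols M)" by (induction M) (auto simp: B)
  show rows: "term_rows D (map_mterm f M) = term_rows (\<lambda>s. D (f s)) M" for M by (cases M) (auto simp: A)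
  show cols: "term_cols (map_mterm f M) = term_cols M" by (induction M) auto
  show "compatible D (map_mterm f M) = compatible (\<lambda>s. D (f s)) M" by (induction M) (auto simp: A rows)
  show "square_term D (map_mterm f M) = square_term (\<lambda>s. D (f s)) M" by (simp add: square_term_def rows cols)
qed

lemma entry_map_mterm: "entry D V (map_mterm f M) i j = entry (\<lambda>s. D (f s)) (\<lambda>s. V (f s)) M i j"
proof (induction M arbitrary: i)
  case (Times A M)
  have "factor_dims D (map_factor f A) = factor_dims (\<lambda>s. D (f s)) A"
    "factor_entry V (map_factor f A) i k = factor_entry (\<lambda>s. V (f s)) A i k" for k
    by (cases A; simp)+
  then show ?case using Times by simp
qed simp

lemma word_trace_map_mterm: "word_trace D V (map_mterm f M) = word_trace (\<lambda>s. D (f s)) (\<lambda>s. V (f s)) M"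
  by (simp add: word_trace_def entry_map_mterm)

lemma weight_map_mterm: "weight f (map_mterm g M) = weight (\<lambda>s. f (g s)) M"
  by (simp add: weight_def comp_def)

lemma weight_count: "weight (\<lambda>s. of_bool (P s)) M = int (length (filter P (symbols M)))"
  by (induction M) auto

lemma degree_weight: "int (degree X M) = weight (\<lambda>s. of_bool (s \<in> X)) M"
  by (simp add: degree_def weight_count)

lemma deg_weight: "int (deg Y M) = weight (\<lambda>s. of_bool (s = Y)) M"
  by (simp add: deg_def weight_count)

lemma outer_carrier: "dim_vec x = n \<Longrightarrow> outer x \<in> carrier_mat n n"
  by (simp add: outer_def)

text \<open>The fixed outer factors are pulled out of the mini-batch average, which leaves the
  sample covariance between them.\<close>

lemma average_outer:
  assumes x: "\<And>i. dim_vec (x i) = n" and A: "A \<in> carrier_mat nr n" and B: "B \<in> carrier_mat n nc"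
  shows "c \<cdot>\<^sub>m mat_sum nr nc (\<lambda>i. A * outer (x i) * B) I =
    A * (mat n n (\<lambda>(u, v). c * (\<Sum>i\<in>I. x i $ u * x i $ v)) * B)"
proof (rule eq_matI)
  fix u v assume "u < dim_row (A * (mat n n (\<lambda>(u, v). c * (\<Sum>i\<in>I. x i $ u * x i $ v)) * B))"
    "v < dim_col (A * (mat n n (\<lambda>(u, v). c * (\<Sum>i\<in>I. x i $ u * x i $ v)) * B))"
  then have uv: "u < nr" "v < nc" using A B by auto
  have "(A * outer (x i) * B) $$ (u, v) = (\<Sum>k<n. \<Sum>l<n. A $$ (u, k) * (x i $ k * x i $ l * B $$ (l, v)))" for i
  proof -
    have "A * outer (x i) * B = A * (outer (x i) * B)"
      by (rule assoc_mult_mat[OF A outer_carrier[OF x] B])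
    then show ?thesis using A B uv x
      by (simp add: scalar_prod_def lessThan_atLeast0 outer_def sum_distrib_left)
  qed
  then have "(c \<cdot>\<^sub>m mat_sum nr nc (\<lambda>i. A * outer (x i) * B) I) $$ (u, v) =
      (\<Sum>i\<in>I. \<Sum>k<n. \<Sum>l<n. c * (A $$ (u, k) * (x i $ k * x i $ l * B $$ (l, v))))"
    using uv by (simp add: mat_sum_def sum_distrib_left)
  also have "\<dots> = (\<Sum>k<n. \<Sum>i\<in>I. \<Sum>l<n. c * (A $$ (u, k) * (x i $ k * x i $ l * B $$ (l, v))))"
    by (rule sum.swap)
  also have "\<dots> = (\<Sum>k<n. \<Sum>l<n. \<Sum>i\<in>I. c * (A $$ (u, k) * (x i $ k * x i $ l * B $$ (l, v))))"
    by (intro sum.cong refl sum.swap)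
  also have "\<dots> = (A * (mat n n (\<lambda>(u, v). c * (\<Sum>i\<in>I. x i $ u * x i $ v)) * B)) $$ (u, v)"
    using A B uv
    by (simp add: scalar_prod_def lessThan_atLeast0 sum_distrib_left sum_distrib_right mult_ac)
  finally show "(c \<cdot>\<^sub>m mat_sum nr nc (\<lambda>i. A * outer (x i) * B) I) $$ (u, v) = \<dots>" .
qed (use A B in \<open>auto simp: mat_sum_def\<close>)

text \<open>A constant map generates the trivial sigma-algebra, and conditioning on it is taking the
  expectation.\<close>

lemma cond_exp_initial_info:
  assumes "prob_space \<Omega>" "integrable \<Omega> f" "\<And>\<omega>. W \<omega> 0 = W0"
  shows "AE \<omega> in \<Omega>. real_cond_exp \<Omega> (initial_info \<Omega> W) f \<omega> = integral\<^sup>L \<Omega> f"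
proof -
  interpret prob_space \<Omega> by fact
  have sets: "sets (initial_info \<Omega> W) = {{}, space \<Omega>}"
  proof -
    have "sets (initial_info \<Omega> W) = {(\<lambda>_. W0) -` A \<inter> space \<Omega> | A. A \<in> UNIV}"
      unfolding initial_info_def assms(3) by (simp add: sets_vimage_algebra2)
    also have "\<dots> = {{}, space \<Omega>}"
    proof (intro equalityI subsetI)
      fix B assume "B \<in> {(\<lambda>_. W0) -` A \<inter> space \<Omega> | A. A \<in> UNIV}"
      then show "B \<in> {{}, space \<Omega>}" by (auto simp: vimage_def split: if_splits)
    next
      fix B assume "B \<in> {{}, space \<Omega>}"
      then have "B = (\<lambda>_. W0) -` {} \<inter> space \<Omega> \<or> B = (\<lambda>_. W0) -` UNIV \<inter> space \<Omega>" by auto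
      then show "B \<in> {(\<lambda>_. W0) -` A \<inter> space \<Omega> | A. A \<in> UNIV}" by blast
    qed
    finally show ?thesis .
  qed
  have "subalgebra \<Omega> (initial_info \<Omega> W)"
    by (simp add: subalgebra_def sets) (simp add: initial_info_def)
  then have "finite_measure_subalgebra \<Omega> (initial_info \<Omega> W)"
    by unfold_locales
  then interpret sigma_finite_subalgebra \<Omega> "initial_info \<Omega> W"
    by (rule finite_measure_subalgebra_is_sigma_finite)
  show ?thesis
  proof (rule real_cond_exp_charact)
    fix A assume "A \<in> sets (initial_info \<Omega> W)"
    then have "A = {} \<or> A = space \<Omega>" by (simp add: sets)
    then show "(\<integral>\<omega>\<in>A. f \<omega> \<partial>\<Omega>) = (\<integral>\<omega>\<in>A. integral\<^sup>L \<Omega> f \<partial>\<Omega>)"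
    proof
      assume "A = space \<Omega>"
      then show ?thesis using assms(2) by (simp add: set_integral_space prob_space)
    qed (simp add: set_lebesgue_integral_def)
  qed (use assms(2) in auto)
qed

text \<open>Used to collect terms by their power of 1/b; powers that do not occur give empty
  sums.\<close>

lemma sum_list_by_key:
  assumes "\<And>x. x \<in> set L \<Longrightarrow> key x \<le> (q :: nat)"
  shows "(\<Sum>x\<leftarrow>L. (g x :: real)) = (\<Sum>k\<in>{0..q}. \<Sum>x\<leftarrow>filter (\<lambda>x. key x = k) L. g x)"
  using assms
proof (induction L)
  case (Cons a L)
  have "(\<Sum>k\<in>{0..q}. \<Sum>x\<leftarrow>filter (\<lambda>x. key x = k) (a # L). g x) =
      (\<Sum>k\<in>{0..q}. (if key a = k then g a else 0) + (\<Sum>x\<leftarrow>filter (\<lambda>x. key x = k) L. g x))"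
    by (intro sum.cong) auto
  then show ?case using Cons by (simp add: sum.distrib)
qed simp

lemma sum_list_one_based: "(\<Sum>x\<leftarrow>xs. (g x :: real)) = (\<Sum>i\<in>{1..length xs}. g (xs ! (i - 1)))"
proof -
  have "(\<Sum>x\<leftarrow>xs. g x) = (\<Sum>i<length xs. g (xs ! i))"
    by (simp add: sum_list_sum_nth lessThan_atLeast0)
  also have "\<dots> = (\<Sum>i\<in>{1..length xs}. g (xs ! (i - 1)))"
    by (rule sum.reindex_bij_witness[of _ "\<lambda>i. i - 1" Suc]) auto
  finally show ?thesis .
qed

text \<open>The arbitrary head \<open>a\<close> occupies index 0, the place of the matrix factor, so
  that the traces are numbered from 1.\<close>

lemma prod_list_one_based: "(\<Prod>x\<leftarrow>zs. (f x :: real)) = (\<Prod>l\<in>{1..length zs}. f ((a # zs) ! l))"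
proof -
  have "(\<Prod>x\<leftarrow>zs. f x) = (\<Prod>l<length zs. f (zs ! l))"
    by (simp add: prod.list_conv_set_nth lessThan_atLeast0)
  also have "\<dots> = (\<Prod>l\<in>{1..length zs}. f ((a # zs) ! l))"
    by (rule prod.reindex_bij_witness[of _ "\<lambda>i. i - 1" Suc]) auto
  finally show ?thesis .
qed

lemma trace_product_index:
  assumes "compatible D M" "\<And>N. N \<in> set zs \<Longrightarrow> compatible D N \<and> square_term D N"
    and V: "\<And>s. V s \<in> carrier_mat (fst (D s)) (snd (D s))"
    and "i < term_rows D M" "j < term_cols M"
  shows "trace_product V (length zs) (\<lambda>l. (M # zs) ! l) $$ (i, j) =
    entry D (\<lambda>s u v. V s $$ (u, v)) M i j * traces D (\<lambda>s u v. V s $$ (u, v)) zs"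
proof -
  have "trace_product V (length zs) (\<lambda>l. (M # zs) ! l) $$ (i, j) =
      (\<Prod>l\<in>{1..length zs}. mat_trace (term_val V ((M # zs) ! l))) * term_val V M $$ (i, j)"
    using term_val_carrier[of D M V] assms by (auto simp: trace_product_def)
  also have "(\<Prod>l\<in>{1..length zs}. mat_trace (term_val V ((M # zs) ! l))) = (\<Prod>N\<leftarrow>zs. mat_trace (term_val V N))"
    by (rule prod_list_one_based[symmetric])
  also have "\<dots> = traces D (\<lambda>s u v. V s $$ (u, v)) zs"
    unfolding traces_def using assms by (intro arg_cong[where f=prod_list] map_cong refl mat_trace_term_val) auto
  finally show ?thesis using term_val_entry[of D M V i j] assms by simp
qed

lemma trace_product_cong:
  "(\<And>l. l \<le> m \<Longrightarrow> T l = T' l) \<Longrightarrow> trace_product V m T = trace_product V m T'"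
  unfolding trace_product_def by (intro arg_cong2[where f="(\<cdot>\<^sub>m)"] prod.cong arg_cong[where f=mat_trace]) auto

text \<open>Unlike \<open>splits\<close>, this keeps the orientation of the factor: it is meant for
  the hole, which is not symmetric in general.\<close>

lemma split_factor:
  assumes "s \<in> set (symbols M)" "compatible D M"
  obtains P A Q where "M = app P (Times A Q)" "symbol A = s" "compatible D P" "compatible D (Times A Q)"
    "term_cols P = fst (factor_dims D A)" "term_rows D P = term_rows D M"
proof -
  have "\<exists>P A Q. M = app P (Times A Q) \<and> symbol A = s \<and> compatible D P \<and> compatible D (Times A Q) \<and>
    term_cols P = fst (factor_dims D A) \<and> term_rows D P = term_rows D M"
    using assms
  proof (induction M)
    case (Times B M)
    show ?case
    proof (cases "symbol B = s")
      case True
      then show ?thesis using Times.prems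
        by (intro exI[of _ "Id (fst (factor_dims D B))"] exI[of _ B] exI[of _ M]) simp
    next
      case False
      then obtain P A Q where "M = app P (Times A Q)" "symbol A = s" "compatible D P" "compatible D (Times A Q)"
        "term_cols P = fst (factor_dims D A)" "term_rows D P = term_rows D M"
        using Times by auto
      then show ?thesis using Times.prems
        by (intro exI[of _ "Times B P"] exI[of _ A] exI[of _ Q]) simp
    qed
  qed simp
  then show ?thesis using that by blast
qed

primrec embed :: "step_symbol \<Rightarrow> sym" where
  "embed (Grad l) = Gr l"
| "embed (Weight l) = Wt l"
| "embed (Teacher l) = Te l"

primrec lift_init :: "init_symbol \<Rightarrow> sym" where
  "lift_init (Init l) = Wt l"
| "lift_init (Teacher0 l) = Te l"

text \<open>Inverse to \<open>lift_init\<close> on weights and teachers; it is unspecified on the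
  other symbols, which have to be excluded beforehand.\<close>

definition lower :: "sym \<Rightarrow> init_symbol" where
  "lower s = (case s of Wt l \<Rightarrow> Init l | Te l \<Rightarrow> Teacher0 l)"

context network
begin

lemma dims_embed: "(\<lambda>s. dims (embed s)) = step_dims p p1 p2 r"
proof
  fix s show "dims (embed s) = step_dims p p1 p2 r s" by (cases s) auto
qed

lemma dims_lift_init: "(\<lambda>s. dims (lift_init s)) = init_dims p p1 p2 r"
proof
  fix s show "dims (lift_init s) = init_dims p p1 p2 r s" by (cases s) auto
qed

lemma gradient_entry:
  fixes e :: "'a run"
  assumes W: "net_weights p p1 p2 W" and T: "net_weights p r p2 (teacher e)" and x: "\<And>i. dim_vec (x i) = p"
    and w: "\<And>l u v. u < fst (net_dims p p1 p2 l) \<Longrightarrow> v < snd (net_dims p p1 p2 l) \<Longrightarrow> w l u v = W l $$ (u, v)"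
    and C: "\<And>u v. u < p \<Longrightarrow> v < p \<Longrightarrow> C u v = 1 / real b * (\<Sum>i\<in>{1..b}. x i $ u * x i $ v)"
  shows "gradient p p1 p2 b (teacher e) W x l \<in> carrier_mat (fst (net_dims p p1 p2 l)) (snd (net_dims p p1 p2 l))"
    and "u < fst (net_dims p p1 p2 l) \<Longrightarrow> v < snd (net_dims p p1 p2 l) \<Longrightarrow>
      gradient p p1 p2 b (teacher e) W x l $$ (u, v) = grad_val (base_val e w C) l u v"
proof -
  let ?T = "teacher e"
  define S where "S = mat p p (\<lambda>(u, v). 1 / real b * (\<Sum>i\<in>{1..b}. x i $ u * x i $ v))"
  \<comment> \<open>\<open>Hole\<close> and \<open>Gr\<close> receive a dummy matrix: they do not
    occur in \<open>grad_words\<close>, and sizes are required only for symbols that occur.\<close>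
  define V where "V s = (case s of Cov \<Rightarrow> S | Wt l \<Rightarrow> W l | Te l \<Rightarrow> ?T l | _ \<Rightarrow> 0\<^sub>m 0 0)" for s
  have W1: "W First \<in> carrier_mat p1 p" and W2: "W Second \<in> carrier_mat p2 p1"
    using W by (auto simp: net_weights_def dest: spec[of _ First] spec[of _ Second])
  have T1: "?T First \<in> carrier_mat r p" and T2: "?T Second \<in> carrier_mat p2 r"
    using T by (auto simp: net_weights_def dest: spec[of _ First] spec[of _ Second])
  have S: "S \<in> carrier_mat p p" by (simp add: S_def)
  let ?R = "W Second * W First - ?T Second * ?T First"
  have R: "?R \<in> carrier_mat p2 p" using W1 W2 T1 T2 by auto
  have Vs: "V s \<in> carrier_mat (fst (dims s)) (snd (dims s))" if "s = Cov \<or> is_Wt s \<or> is_Te s" for s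
    using that W T S by (cases s) (auto simp: V_def net_weights_def)
  have entry: "term_val V N $$ (u, v) = entry dims (base_val e w C) N u v"
    if "compatible dims N" "u < term_rows dims N" "v < term_cols N" "\<forall>s\<in>set (symbols N). s = Cov \<or> is_Wt s \<or> is_Te s"
    for N u v
  proof -
    have "term_val V N $$ (u, v) = entry dims (\<lambda>s u v. V s $$ (u, v)) N u v"
      using that Vs by (intro term_val_entry) auto
    also have "\<dots> = entry dims (base_val e w C) N u v"
    proof (rule entry_cong)
      fix s i j assume "s \<in> set (symbols N)" "i < fst (dims s)" "j < snd (dims s)"
      moreover from this have "s = Cov \<or> is_Wt s \<or> is_Te s" using that(4) by blast
      ultimately show "V s $$ (i, j) = base_val e w C s i j"
        using w C by - (cases s, auto simp: V_def S_def)
    qed (use that in auto)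
    finally show ?thesis .
  qed
  \<comment> \<open>The gradient of the first layer has nothing to the right of the outer product.
    The identity matrix fills this place in \<open>average_outer\<close> and matches the end
    \<open>Id p\<close> of the words.\<close>
  have First: "gradient p p1 p2 b ?T W x First =
    (W Second)\<^sup>T * (W Second * (W First * (S * 1\<^sub>m p))) - (W Second)\<^sup>T * (?T Second * (?T First * (S * 1\<^sub>m p)))"
  proof -
    have A: "(W Second)\<^sup>T * ?R \<in> carrier_mat p1 p" using W2 R by auto
    have "(W Second)\<^sup>T * ?R * outer (x i) = (W Second)\<^sup>T * ?R * outer (x i) * 1\<^sub>m p" for i
      by (rule right_mult_one_mat[OF mult_carrier_mat[OF A outer_carrier[OF x]], symmetric])
    then have "gradient p p1 p2 b ?T W x First = (W Second)\<^sup>T * ?R * S * 1\<^sub>m p"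
      unfolding gradient.simps S_def using average_outer[of x p, OF x A one_carrier_mat] by simp
    also have "\<dots> = (W Second)\<^sup>T * (?R * (S * 1\<^sub>m p))"
      using W2 R S by (simp add: assoc_mult_mat[of _ p1 p2 _ p _ p])
    also have "?R * (S * 1\<^sub>m p) = W Second * (W First * (S * 1\<^sub>m p)) - ?T Second * (?T First * (S * 1\<^sub>m p))"
      using W1 W2 T1 T2 S
      by (simp add: minus_mult_distrib_mat[of _ p2 p _ _ p] assoc_mult_mat[of _ p2 p1 _ p _ p] assoc_mult_mat[of _ p2 r _ p _ p])
    also have "(W Second)\<^sup>T * \<dots> = (W Second)\<^sup>T * (W Second * (W First * (S * 1\<^sub>m p))) - (W Second)\<^sup>T * (?T Second * (?T First * (S * 1\<^sub>m p)))"
      using W1 W2 T1 T2 S by (intro mult_minus_distrib_mat[of _ p1 p2 _ p]) auto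
    finally show ?thesis .
  qed
  have Second: "gradient p p1 p2 b ?T W x Second =
    W Second * (W First * (S * ((W First)\<^sup>T * 1\<^sub>m p1))) - ?T Second * (?T First * (S * ((W First)\<^sup>T * 1\<^sub>m p1)))"
  proof -
    have B: "(W First)\<^sup>T \<in> carrier_mat p p1" using W1 by simp
    have "gradient p p1 p2 b ?T W x Second = ?R * (S * (W First)\<^sup>T)"
      unfolding gradient.simps S_def using average_outer[of x p, OF x R B] by blast
    also have "\<dots> = ?R * (S * ((W First)\<^sup>T * 1\<^sub>m p1))"
      using R S B by (simp add: assoc_mult_mat[of _ p2 p _ p _ p1])
    also have "\<dots> = W Second * (W First * (S * ((W First)\<^sup>T * 1\<^sub>m p1))) - ?T Second * (?T First * (S * ((W First)\<^sup>T * 1\<^sub>m p1)))"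
      using W1 W2 T1 T2 S B
      by (simp add: minus_mult_distrib_mat[of _ p2 p _ _ p1] assoc_mult_mat[of _ p2 p1 _ p _ p1] assoc_mult_mat[of _ p2 r _ p _ p1])
    finally show ?thesis .
  qed
  show "gradient p p1 p2 b ?T W x l \<in> carrier_mat (fst (net_dims p p1 p2 l)) (snd (net_dims p p1 p2 l))"
    by (cases l) (auto simp: mat_sum_def)
  have words: "gradient p p1 p2 b ?T W x l =
    term_val V (snd (grad_words l ! 0)) - term_val V (snd (grad_words l ! 1))"
    using First Second by (cases l) (simp_all add: V_def del: gradient.simps)
  show "gradient p p1 p2 b ?T W x l $$ (u, v) = grad_val (base_val e w C) l u v"
    if uv: "u < fst (net_dims p p1 p2 l)" "v < snd (net_dims p p1 p2 l)"
  proof -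
    have N: "compatible dims N \<and> term_rows dims N = fst (net_dims p p1 p2 l) \<and> term_cols N = snd (net_dims p p1 p2 l) \<and>
        (\<forall>s\<in>set (symbols N). s = Cov \<or> is_Wt s \<or> is_Te s)" if "N \<in> {snd (grad_words l ! 0), snd (grad_words l ! 1)}" for N
      using that by (cases l) auto
    have "term_val V (snd (grad_words l ! 1)) \<in> carrier_mat (fst (net_dims p p1 p2 l)) (snd (net_dims p p1 p2 l))"
      using term_val_carrier[of dims "snd (grad_words l ! 1)" V] N[of "snd (grad_words l ! 1)"] Vs by simp
    then have "gradient p p1 p2 b ?T W x l $$ (u, v) =
        term_val V (snd (grad_words l ! 0)) $$ (u, v) - term_val V (snd (grad_words l ! 1)) $$ (u, v)"
      unfolding words using uv by (intro index_minus_mat) auto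
    also have "\<dots> = entry dims (base_val e w C) (snd (grad_words l ! 0)) u v -
        entry dims (base_val e w C) (snd (grad_words l ! 1)) u v"
      using uv N by (intro arg_cong2[where f="(-)"] entry) auto
    also have "\<dots> = grad_val (base_val e w C) l u v"
      by (cases l) (simp_all add: grad_val_def del: entry.simps)
    finally show ?thesis .
  qed
qed

lemma sgd_weight_at:
  fixes e :: "'a run"
  assumes e: "admissible e" and W: "net_weights p p1 p2 (init e)" and T: "net_weights p r p2 (teacher e)"
  defines "w t \<omega> \<equiv> sgd p p1 p2 (batch e) \<alpha> (teacher e) (init e) (sample_path p (sample e) \<omega>) t"
  shows "net_weights p p1 p2 (w t \<omega>)"
    and "u < fst (net_dims p p1 p2 l) \<Longrightarrow> v < snd (net_dims p p1 p2 l) \<Longrightarrow> w t \<omega> l $$ (u, v) = weight_at e \<omega> t l u v"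
    and "u < fst (net_dims p p1 p2 l) \<Longrightarrow> v < snd (net_dims p p1 p2 l) \<Longrightarrow>
      gradient p p1 p2 (batch e) (teacher e) (w t \<omega>) (sample_path p (sample e) \<omega> t) l $$ (u, v) =
      grad_val (cov_val e t \<omega>) l u v"
    and "gradient p p1 p2 (batch e) (teacher e) (w t \<omega>) (sample_path p (sample e) \<omega> t) l
      \<in> carrier_mat (fst (net_dims p p1 p2 l)) (snd (net_dims p p1 p2 l))"
proof -
  interpret gaussian_family "omega e" p "batch e" "sample e"
    using e by (simp add: admissible_def gaussian_family_def gaussian_family_axioms_def)
  let ?g = "\<lambda>t. gradient p p1 p2 (batch e) (teacher e) (w t \<omega>) (sample_path p (sample e) \<omega> t)"
  have C: "run_cov e \<omega> t u v = 1 / real (batch e) * (\<Sum>i\<in>{1..batch e}. sample_path p (sample e) \<omega> t i $ u * sample_path p (sample e) \<omega> t i $ v)"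
    if "u < p" "v < p" for t u v
    using that by (simp add: run_cov_def cov_def coord_def sample_path_def)
  have x: "dim_vec (sample_path p (sample e) \<omega> t i) = p" for t i by (simp add: sample_path_def)
  have main: "net_weights p p1 p2 (w t \<omega>) \<and> (\<forall>l u v. u < fst (net_dims p p1 p2 l) \<longrightarrow> v < snd (net_dims p p1 p2 l) \<longrightarrow>
      weight_at e \<omega> t l u v = w t \<omega> l $$ (u, v))" for t
  proof (induction t)
    case 0
    then show ?case using W by (simp add: w_def init_entry_def)
  next
    case (Suc t)
    have g: "?g t l \<in> carrier_mat (fst (net_dims p p1 p2 l)) (snd (net_dims p p1 p2 l))"
      "u < fst (net_dims p p1 p2 l) \<Longrightarrow> v < snd (net_dims p p1 p2 l) \<Longrightarrow>
       ?g t l $$ (u, v) = grad_val (base_val e (weight_at e \<omega> t) (run_cov e \<omega> t)) l u v" for l u v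
      using gradient_entry[where x="sample_path p (sample e) \<omega> t" and w="weight_at e \<omega> t" and C="run_cov e \<omega> t" and e=e and W="w t \<omega>" and b="batch e"]
        Suc T x C by blast+
    have wS: "w (Suc t) \<omega> l = w t \<omega> l - \<alpha> t \<cdot>\<^sub>m ?g t l" for l
      by (simp add: w_def)
    have "w (Suc t) \<omega> l \<in> carrier_mat (fst (net_dims p p1 p2 l)) (snd (net_dims p p1 p2 l))" for l
      unfolding wS using g(1)[of l] by (intro minus_carrier_mat smult_carrier_mat)
    moreover have "weight_at e \<omega> (Suc t) l u v = w (Suc t) \<omega> l $$ (u, v)"
      if "u < fst (net_dims p p1 p2 l)" "v < snd (net_dims p p1 p2 l)" for l u v
    proof -
      have "w (Suc t) \<omega> l $$ (u, v) = w t \<omega> l $$ (u, v) - \<alpha> t * ?g t l $$ (u, v)"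
        unfolding wS using g(1)[of l] that by (simp del: gradient.simps)
      then show ?thesis using g(2)[OF that] Suc that by simp
    qed
    ultimately show ?case by (simp add: net_weights_def)
  qed
  show "net_weights p p1 p2 (w t \<omega>)" using main by blast
  show "u < fst (net_dims p p1 p2 l) \<Longrightarrow> v < snd (net_dims p p1 p2 l) \<Longrightarrow> w t \<omega> l $$ (u, v) = weight_at e \<omega> t l u v"
    using main by simp
  show "u < fst (net_dims p p1 p2 l) \<Longrightarrow> v < snd (net_dims p p1 p2 l) \<Longrightarrow> ?g t l $$ (u, v) = grad_val (cov_val e t \<omega>) l u v"
    "?g t l \<in> carrier_mat (fst (net_dims p p1 p2 l)) (snd (net_dims p p1 p2 l))"
    unfolding cov_val_def
    using gradient_entry[where x="sample_path p (sample e) \<omega> t" and w="weight_at e \<omega> t" and C="run_cov e \<omega> t" and e=e and W="w t \<omega>" and b="batch e"]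
      main T x C by blast+
qed

lemma sgd_term_traces:
  fixes e :: "'a run"
  assumes e: "admissible e" and W: "net_weights p p1 p2 (init e)" and T: "net_weights p r p2 (teacher e)"
    and M: "\<And>i. i \<le> m \<Longrightarrow> compatible (step_dims p p1 p2 r) (M i)"
      "\<And>i. i \<in> {1..m} \<Longrightarrow> square_term (step_dims p p1 p2 r) (M i)"
    and nr: "nr = term_rows (step_dims p p1 p2 r) (M 0)" and nc: "nc = term_cols (M 0)"
    and rc: "hole_row e < nr" "hole_col e < nc"
  shows "sgd_term p p1 p2 (batch e) \<alpha> (teacher e) (init e) t m M (sample_path p (sample e) \<omega>) $$ (hole_row e, hole_col e) =
    traces dims (full_val e t \<omega>) (app (map_mterm embed (M 0)) (Times (Plain Hole) (Id nr)) #
      map (\<lambda>i. map_mterm embed (M i)) [1..<Suc m])"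
proof -
  let ?D = "step_dims p p1 p2 r"
  define w where "w = sgd p p1 p2 (batch e) \<alpha> (teacher e) (init e) (sample_path p (sample e) \<omega>) t"
  define V where "V = step_val (gradient p p1 p2 (batch e) (teacher e) w (sample_path p (sample e) \<omega> t)) w (teacher e)"
  note sgd = sgd_weight_at[OF e W T, where t=t and \<omega>=\<omega>, folded w_def]
  have Vc: "V s \<in> carrier_mat (fst (?D s)) (snd (?D s))" for s
    using sgd(1,4) T by (cases s) (simp_all add: V_def net_weights_def del: gradient.simps)
  have val: "V s $$ (u, v) = full_val e t \<omega> (embed s) u v" if "u < fst (?D s)" "v < snd (?D s)" for s u v
    using that sgd(2,3) by (cases s) (simp_all add: V_def full_val_def cov_val_def del: gradient.simps)
  let ?V = "\<lambda>s u v. V s $$ (u, v)" and ?F = "\<lambda>s. full_val e t \<omega> (embed s)"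
  have entry: "entry ?D ?V N i j = entry ?D ?F N i j" if "compatible ?D N" "i < term_rows ?D N" "j < term_cols N" for N i j
    using that val by (intro entry_cong) auto
  have "sgd_term p p1 p2 (batch e) \<alpha> (teacher e) (init e) t m M (sample_path p (sample e) \<omega>) = trace_product V m M"
    by (simp add: sgd_term_def w_def V_def Let_def)
  also have "\<dots> = trace_product V (length (map M [1..<Suc m])) (\<lambda>l. (M 0 # map M [1..<Suc m]) ! l)"
    by (simp del: upt_Suc, rule trace_product_cong) (auto simp: nth_Cons' simp del: upt_Suc)
  also have "\<dots> $$ (hole_row e, hole_col e) =
      entry ?D ?V (M 0) (hole_row e) (hole_col e) * traces ?D ?V (map M [1..<Suc m])"
    using M rc nr nc Vc by (intro trace_product_index) auto
  also have "entry ?D ?V (M 0) (hole_row e) (hole_col e) = entry ?D ?F (M 0) (hole_row e) (hole_col e)"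
    using M(1)[of 0] rc nr nc by (intro entry) auto
  also have "\<dots> = word_trace dims (full_val e t \<omega>) (app (map_mterm embed (M 0)) (Times (Plain Hole) (Id nr)))"
  proof -
    let ?N = "map_mterm embed (M 0)"
    have N: "compatible dims ?N" "term_rows dims ?N = nr" "term_cols ?N = nc"
      using M(1)[of 0] by (simp_all only: map_mterm_simps dims_embed flip: nr nc)
    have hole: "entry dims (full_val e t \<omega>) (Times (Plain Hole) (Id nr)) k i = of_bool (k = hole_col e) * of_bool (i = hole_row e)"
      if "i < nr" for k i
      using that by (simp add: entry_keep del: entry.simps) (simp add: full_val_def cov_val_def)
    have "word_trace dims (full_val e t \<omega>) (app ?N (Times (Plain Hole) (Id nr))) =
        (\<Sum>i<nr. \<Sum>k<nc. entry dims (full_val e t \<omega>) ?N i k * (of_bool (k = hole_col e) * of_bool (i = hole_row e)))"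
      using N hole by (simp add: trace_app del: entry.simps)
    also have "\<dots> = (\<Sum>i<nr. (\<Sum>k<nc. entry dims (full_val e t \<omega>) ?N i k * of_bool (k = hole_col e)) * of_bool (i = hole_row e))"
      by (simp only: sum_distrib_right mult.assoc)
    also have "\<dots> = entry dims (full_val e t \<omega>) ?N (hole_row e) (hole_col e)"
      using rc by (simp only: sum_delta_lessThan if_True)
    finally show ?thesis by (simp add: entry_map_mterm dims_embed)
  qed
  also have "traces ?D ?V (map M [1..<Suc m]) = traces dims (full_val e t \<omega>) (map (\<lambda>i. map_mterm embed (M i)) [1..<Suc m])"
  proof -
    have "word_trace ?D ?V (M i) = word_trace dims (full_val e t \<omega>) (map_mterm embed (M i))" if "i \<in> {1..m}" for i
      using M(1)[of i] M(2)[of i] that entry[of "M i"]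
      by (simp add: word_trace_map_mterm dims_embed) (simp add: word_trace_def square_term_def)
    then show ?thesis
      unfolding traces_def by (auto simp del: upt_Suc intro!: arg_cong[where f=prod_list])
  qed
  finally show ?thesis by simp
qed

text \<open>The trace of a matrix unit times \<open>N\<close> is one entry of \<open>N\<close>. For
  a transposed hole the two indices are exchanged, which is undone by transposing \<open>N\<close>;
  this case arises because contractions may reverse the word carrying the hole.\<close>

lemma word_trace_hole:
  assumes "compatible dims N" "symbol A = Hole"
    and N: "term_rows dims N = snd (factor_dims dims A)" "term_cols N = fst (factor_dims dims A)"
    and rc: "hole_row e < nr" "hole_col e < nc"
  shows "word_trace dims (const_val e) (Times A N) =
    entry dims (const_val e) (case A of Plain _ \<Rightarrow> N | Transp _ \<Rightarrow> word_transp dims N) (hole_row e) (hole_col e)"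
proof -
  have swap: "(\<Sum>i<n. \<Sum>k<n'. (of_bool (i = a) * of_bool (k = c)) * f k i) = (if a < n \<and> c < n' then f c a else (0::real))"
    for n n' a c :: nat and f
  proof -
    have "(\<Sum>k<n'. (of_bool (i = a) * of_bool (k = c)) * f k i) = (\<Sum>k<n'. f k i * of_bool (k = c)) * of_bool (i = a)" for i
      unfolding sum_distrib_right by (intro sum.cong refl) (simp only: mult_ac)
    then show ?thesis by (simp only: sum_delta_lessThan) auto
  qed
  show ?thesis
  proof (cases A)
    case (Plain s)
    then have "word_trace dims (const_val e) (Times A N) =
        (\<Sum>i<nc. \<Sum>k<nr. (of_bool (i = hole_col e) * of_bool (k = hole_row e)) * entry dims (const_val e) N k i)"
      using assms(2) by (simp add: word_trace_def const_val_def of_bool_conj)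
    then show ?thesis unfolding swap using rc Plain by simp
  next
    case (Transp s)
    then have "word_trace dims (const_val e) (Times A N) =
        (\<Sum>i<nr. \<Sum>k<nc. (of_bool (i = hole_row e) * of_bool (k = hole_col e)) * entry dims (const_val e) N k i)"
      using assms(2) by (simp add: word_trace_def const_val_def of_bool_conj mult.commute[of "of_bool (_ = hole_col e)"])
    then show ?thesis unfolding swap using rc Transp N assms(1,2) by (simp add: entry_transp)
  qed
qed

text \<open>Rotated so that the hole comes first, the rest of the word is, up to transposition, the
  matrix whose entry the trace picks.\<close>

lemma remove_hole:
  assumes "compatible dims M" "square_term dims M" "Hole \<in> set (symbols M)"
  obtains N where "compatible dims N" "term_rows dims N = nr" "term_cols N = nc"
    "\<And>f. weight f N + f Hole = weight f M"
    "\<And>e. hole_row e < nr \<Longrightarrow> hole_col e < nc \<Longrightarrow>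
      word_trace dims (const_val e) M = entry dims (const_val e) N (hole_row e) (hole_col e)"
proof -
  obtain P A Q where M: "M = app P (Times A Q)" "symbol A = Hole" "compatible dims P" "compatible dims (Times A Q)"
    "term_cols P = fst (factor_dims dims A)" "term_rows dims P = term_rows dims M"
    using split_factor[OF assms(3,1)] .
  have sq: "term_cols Q = term_rows dims P" using assms(2) M by (simp add: square_term_def)
  let ?K = "app Q P"
  have K: "compatible dims ?K" "term_rows dims ?K = snd (factor_dims dims A)" "term_cols ?K = fst (factor_dims dims A)"
    using M sq by (auto simp: compatible_app term_rows_app)
  define N where "N = (case A of Plain _ \<Rightarrow> ?K | Transp _ \<Rightarrow> word_transp dims ?K)"
  show ?thesis
  proof (rule that[of N])
    show "compatible dims N" "term_rows dims N = nr" "term_cols N = nc"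
      using K M(2) by (cases A; simp add: N_def compatible_transp term_rows_transp)+
    show "weight f N + f Hole = weight f M" for f
      using M(1,2) by (cases A) (auto simp: N_def)
    fix e :: "'c run" assume rc: "hole_row e < nr" "hole_col e < nc"
    have "word_trace dims (const_val e) M = word_trace dims (const_val e) (app (Times A Q) P)"
      unfolding M(1) using M sq by (intro trace_app_commute) auto
    also have "\<dots> = entry dims (const_val e) N (hole_row e) (hole_col e)"
      using word_trace_hole[OF K(1) M(2) K(2,3) rc] by (simp add: N_def del: entry.simps)
    finally show "word_trace dims (const_val e) M = \<dots>" .
  qed
qed

lemma lift_lower:
  assumes "\<And>s. s \<in> set (symbols K) \<Longrightarrow> is_Wt s \<or> is_Te s"
  shows "map_mterm lift_init (map_mterm lower K) = K"
  unfolding mterm.map_comp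
proof (rule mterm.map_ident_strong)
  fix s assume "s \<in> set_mterm K"
  then have "is_Wt s \<or> is_Te s" using assms by (simp add: set_mterm_symbols)
  then show "(lift_init \<circ> lower) s = s" by (cases s) (auto simp: lower_def)
qed

text \<open>The result of erasing the hole: a list whose head is the matrix factor of the term and whose
  tail consists of the traces.\<close>

definition erases :: "sym mterm list \<Rightarrow> init_symbol mterm list \<Rightarrow> bool" where
  "erases v us \<longleftrightarrow> us \<noteq> [] \<and>
    (\<forall>K\<in>set us. mult_term (init_dims p p1 p2 r) {Init First, Init Second} {Teacher0 First, Teacher0 Second} K) \<and>
    (\<forall>K\<in>set (tl us). square_term (init_dims p p1 p2 r) K) \<and>
    term_rows (init_dims p p1 p2 r) (hd us) = nr \<and> term_cols (hd us) = nc \<and>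
    int (\<Sum>K\<leftarrow>us. degree {Init First, Init Second} K) = weights nWt v"

text \<open>Hole count 1 means that exactly one word carries the hole; it becomes the matrix factor,
  and all other words stay traces. The list \<open>us\<close> is determined before the run.\<close>

lemma exists_erasure:
  assumes v: "closed_words dims v" "weights nCov v = 0" "weights nGr v = 0" "weights nHole v = 1"
  shows "\<exists>us. erases v us \<and> (\<forall>e :: 'a run. net_weights p p1 p2 (init e) \<longrightarrow> net_weights p r p2 (teacher e) \<longrightarrow>
    hole_row e < nr \<longrightarrow> hole_col e < nc \<longrightarrow> traces dims (const_val e) v =
      trace_product (init_val (init e) (teacher e)) (length us - 1) (\<lambda>l. us ! l) $$ (hole_row e, hole_col e))"
proof -
  have "\<exists>M\<in>set v. Hole \<in> set (symbols M)"
  proof (rule ccontr)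
    assume "\<not> ?thesis"
    then have "weights nHole v = 0" by (intro weights_eq_0) auto
    then show False using v(4) by simp
  qed
  then obtain M v1 v2 where M: "Hole \<in> set (symbols M)" and v12: "v = v1 @ M # v2"
    by (metis split_list)
  obtain N where N: "compatible dims N" "term_rows dims N = nr" "term_cols N = nc"
    "\<And>f. weight f N + f Hole = weight f M"
    "\<And>e. hole_row (e :: 'a run) < nr \<Longrightarrow> hole_col e < nc \<Longrightarrow>
      word_trace dims (const_val e) M = entry dims (const_val e) N (hole_row e) (hole_col e)"
    using remove_hole[of M] M v(1) v12 by auto
  define zs where "zs = v1 @ v2"
  have weights: "weights f (N # zs) + f Hole = weights f v" for f
    using N(4)[of f] by (simp add: v12 zs_def)
  \<comment> \<open>All other counts vanish once the hole is gone, so \<open>lower\<close> meets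
    only symbols on which it is specified.\<close>
  have Wt_Te: "is_Wt s \<or> is_Te s" if "K \<in> set (N # zs)" "s \<in> set (symbols K)" for K s
  proof -
    have "nCov s = 0" "nGr s = 0" "nHole s = 0"
      using weights_zeroD[of nCov "N # zs" K s] weights_zeroD[of nGr "N # zs" K s] weights_zeroD[of nHole "N # zs" K s]
        weights[of nCov] weights[of nGr] weights[of nHole] v(2-4) that by simp_all
    then show ?thesis by (cases s) auto
  qed
  let ?low = "map_mterm lower"
  have ll: "map_mterm lift_init (?low K) = K" if "K \<in> set (N # zs)" for K
    using Wt_Te[OF that] by (rule lift_lower)
  have zs: "compatible dims K \<and> square_term dims K" if "K \<in> set zs" for K
    using v(1) that by (auto simp: v12 zs_def closed_words_def)
  let ?D = "init_dims p p1 p2 r"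
  have low: "compatible ?D (?low K) = compatible dims K" "square_term ?D (?low K) = square_term dims K"
    "term_rows ?D (?low K) = term_rows dims K" "term_cols (?low K) = term_cols K"
    if "K \<in> set (N # zs)" for K
  proof -
    have "compatible dims (map_mterm lift_init (?low K)) = compatible ?D (?low K)"
      "square_term dims (map_mterm lift_init (?low K)) = square_term ?D (?low K)"
      "term_rows dims (map_mterm lift_init (?low K)) = term_rows ?D (?low K)"
      by (simp_all only: map_mterm_simps dims_lift_init)
    then show "compatible ?D (?low K) = compatible dims K" "square_term ?D (?low K) = square_term dims K"
      "term_rows ?D (?low K) = term_rows dims K" by (simp_all only: ll[OF that])
    show "term_cols (?low K) = term_cols K" by simp
  qed
  define us where "us = map ?low (N # zs)"
  have layers: "{Init First, Init Second} = range Init" "{Teacher0 First, Teacher0 Second} = range Teacher0"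
    using layer.exhaust by auto
  have degree: "int (degree {Init First, Init Second} (?low K)) = weight nWt K" if "K \<in> set (N # zs)" for K
  proof -
    have "weight nWt (map_mterm lift_init (?low K)) = weight (\<lambda>s. nWt (lift_init s)) (?low K)"
      by (rule weight_map_mterm)
    also have "(\<lambda>s. nWt (lift_init s)) = (\<lambda>s. of_bool (s \<in> {Init First, Init Second}))"
    proof
      fix s show "nWt (lift_init s) = of_bool (s \<in> {Init First, Init Second})"
        unfolding layers by (cases s) auto
    qed
    finally show ?thesis by (simp only: ll[OF that] degree_weight)
  qed
  have mult: "mult_term ?D {Init First, Init Second} {Teacher0 First, Teacher0 Second} (?low K)"
    if "K \<in> set (N # zs)" for K
  proof -
    have "s \<in> range Init \<union> range Teacher0" for s by (cases s) auto
    then show ?thesis unfolding mult_term_def layers using low(1)[OF that] that N(1) zs by auto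
  qed
  have "int (\<Sum>K\<leftarrow>us. degree {Init First, Init Second} K) = (\<Sum>K\<leftarrow>N # zs. weight nWt K)"
  proof -
    have "int (\<Sum>K\<leftarrow>map ?low xs. degree {Init First, Init Second} K) = (\<Sum>K\<leftarrow>xs. weight nWt K)"
      if "set xs \<subseteq> set (N # zs)" for xs
      using that
    proof (induction xs)
      case (Cons K xs)
      then have "K \<in> set (N # zs)" "set xs \<subseteq> set (N # zs)" by auto
      then show ?case using degree[of K] Cons.IH by simp
    qed simp
    from this[of "N # zs"] show ?thesis unfolding us_def by simp
  qed
  also have "\<dots> = weights nWt v"
    using weights[of nWt] by (simp add: weights_def)
  finally have "erases v us"
    unfolding erases_def us_def using mult low N zs by (auto simp del: map_mterm_simps)
  moreover have "traces dims (const_val e) v =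
      trace_product (init_val (init e) (teacher e)) (length us - 1) (\<lambda>l. us ! l) $$ (hole_row e, hole_col e)"
    if e: "net_weights p p1 p2 (init e)" "net_weights p r p2 (teacher e)" "hole_row e < nr" "hole_col e < nc" for e :: "'a run"
  proof -
    let ?V = "init_val (init e) (teacher e)"
    have V: "?V s \<in> carrier_mat (fst (?D s)) (snd (?D s))" for s
      using e by (cases s) (auto simp: net_weights_def)
    have cv: "(\<lambda>s. const_val e (lift_init s)) = (\<lambda>s u v. ?V s $$ (u, v))"
    proof
      fix s show "const_val e (lift_init s) = (\<lambda>u v. ?V s $$ (u, v))"
        by (cases s) (auto simp: const_val_def init_entry_def[abs_def])
    qed
    have entry: "entry dims (const_val e) K i j = entry ?D (\<lambda>s u v. ?V s $$ (u, v)) (?low K) i j"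
      if "K \<in> set (N # zs)" for K i j
      using entry_map_mterm[of dims "const_val e" lift_init "?low K" i j]
      by (simp only: ll[OF that] dims_lift_init cv)
    have tr: "word_trace dims (const_val e) K = word_trace ?D (\<lambda>s u v. ?V s $$ (u, v)) (?low K)"
      if "K \<in> set (N # zs)" for K
      unfolding word_trace_def using entry[OF that] low(3)[OF that] by simp
    have "traces dims (const_val e) v = word_trace dims (const_val e) M * traces dims (const_val e) zs"
      by (simp add: v12 zs_def)
    also have "\<dots> = entry dims (const_val e) N (hole_row e) (hole_col e) * traces dims (const_val e) zs"
      using N(5) e by simp
    also have "traces dims (const_val e) zs = traces ?D (\<lambda>s u v. ?V s $$ (u, v)) (map ?low zs)"
      unfolding traces_def using tr by (auto intro!: arg_cong[where f=prod_list])
    also have "entry dims (const_val e) N (hole_row e) (hole_col e) = entry ?D (\<lambda>s u v. ?V s $$ (u, v)) (?low N) (hole_row e) (hole_col e)"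
      by (rule entry) simp
    also have "\<dots> * traces ?D (\<lambda>s u v. ?V s $$ (u, v)) (map ?low zs) =
        trace_product ?V (length (map ?low zs)) (\<lambda>l. (?low N # map ?low zs) ! l) $$ (hole_row e, hole_col e)"
      using N zs low e V by (intro trace_product_index[symmetric]) (auto simp del: map_mterm_simps)
    finally show ?thesis by (simp add: us_def)
  qed
  ultimately show ?thesis by blast
qed

lemma real_geo: "real_of_int (geo t) = 1 / 2 * (3 ^ t - 1)"
proof -
  have "2 * geo t + 1 = 3 ^ t" by (induction t) (auto simp: geo_def)
  then have "real_of_int (2 * geo t + 1) = real_of_int (3 ^ t)" by (simp only:)
  then show ?thesis by simp
qed

end

section \<open>Assembling the expansion in powers of 1/b\<close>

theorem theorem3:
  fixes p p1 p2 r t m d d' nr nc :: nat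
    and \<alpha> :: "nat \<Rightarrow> real"
    and M :: "nat \<Rightarrow> step_symbol mterm"
  assumes "\<And>s. 0 < \<alpha> s"
    and "\<And>i. i \<le> m \<Longrightarrow>
      mult_term (step_dims p p1 p2 r) {Grad First, Grad Second}
        {Weight First, Weight Second, Teacher First, Teacher Second} (M i)"
    and "\<And>i. i \<in> {1..m} \<Longrightarrow> square_term (step_dims p p1 p2 r) (M i)"
    and "nr = term_rows (step_dims p p1 p2 r) (M 0)" and "nc = term_cols (M 0)"
    and "d = (\<Sum>i\<le>m. degree {Grad First, Grad Second} (M i))"
    and "d' = (\<Sum>i\<le>m. deg (Weight First) (M i) + deg (Weight Second) (M i))"
  shows "\<exists>(q :: nat) (mk :: nat \<Rightarrow> nat) (mki :: nat \<Rightarrow> nat \<Rightarrow> nat)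
      (c :: nat \<Rightarrow> nat \<Rightarrow> real) (T :: nat \<Rightarrow> nat \<Rightarrow> nat \<Rightarrow> init_symbol mterm).
    real q \<le> 1/2 * (3 ^ (t + 1) - 1) * real d + 1/2 * (3 ^ t - 1) * real d' \<and>
    (\<forall>k\<le>q. \<forall>i\<in>{1..mk k}.
      (\<forall>j\<le>mki k i. mult_term (init_dims p p1 p2 r) {Init First, Init Second}
         {Teacher0 First, Teacher0 Second} (T k i j)) \<and>
      (\<forall>j\<in>{1..mki k i}. square_term (init_dims p p1 p2 r) (T k i j)) \<and>
      term_rows (init_dims p p1 p2 r) (T k i 0) = nr \<and> term_cols (T k i 0) = nc \<and>
      (\<Sum>j\<le>mki k i. degree {Init First, Init Second} (T k i j)) \<le> 3 ^ t * (3 * d + d')) \<and>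
    (\<forall>W0 Wstar (b :: nat) (\<Omega> :: 'a measure) x.
      net_weights p p1 p2 W0 \<longrightarrow> net_weights p r p2 Wstar \<longrightarrow> 1 \<le> b \<longrightarrow>
      prob_space \<Omega> \<longrightarrow> gaussian_samples \<Omega> p b x \<longrightarrow>
      (let X = (\<lambda>\<omega>. sgd_term p p1 p2 b \<alpha> Wstar W0 t m M (sample_path p x \<omega>));
           F0 = initial_info \<Omega> (\<lambda>\<omega>. sgd p p1 p2 b \<alpha> Wstar W0 (sample_path p x \<omega>));
           N = (\<lambda>k. mat_sum nr nc
                  (\<lambda>i. c k i \<cdot>\<^sub>m trace_product (init_val W0 Wstar) (mki k i) (T k i)) {1..mk k})
       in (\<forall>i<nr. \<forall>j<nc. integrable \<Omega> (\<lambda>\<omega>. X \<omega> $$ (i, j))) \<and>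
          (AE \<omega> in \<Omega>. mat_cond_exp \<Omega> F0 nr nc X \<omega> =
             mat_sum nr nc (\<lambda>k. (1 / real b ^ k) \<cdot>\<^sub>m N k) {0..q})))"
proof -
  interpret network p p1 p2 r nr nc \<alpha> .
  let ?D = "step_dims p p1 p2 r" and ?I = "init_dims p p1 p2 r"
  have comp: "compatible ?D (M i)" if "i \<le> m" for i
    using assms(2)[OF that] by (simp add: mult_term_def)
  \<comment> \<open>The hole has \<open>nc\<close> rows and \<open>nr\<close> columns, so it closes
    \<open>M 0\<close> to a square word even if \<open>M 0\<close> is rectangular.\<close>
  define w where "w = app (map_mterm embed (M 0)) (Times (Plain Hole) (Id nr)) #
      map (\<lambda>i. map_mterm embed (M i)) [1..<Suc m]"
  have closed: "closed_words dims w"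
  proof -
    have "compatible dims (map_mterm embed (M i))" if "i \<le> m" for i
      using comp[OF that] by (simp only: map_mterm_simps dims_embed)
    moreover have "square_term dims (map_mterm embed (M i))" if "i \<in> {1..m}" for i
      using assms(3)[OF that] by (simp only: map_mterm_simps dims_embed)
    moreover have "term_rows dims (map_mterm embed (M 0)) = nr" "term_cols (map_mterm embed (M 0)) = nc"
      unfolding assms(4,5) by (simp_all only: map_mterm_simps dims_embed[unfolded assms(4,5)])
    ultimately show ?thesis
      by (auto simp: w_def closed_words_def square_term_def compatible_app term_rows_app simp del: map_mterm_simps upt_Suc)
  qed
  have weights_w: "weights f w = f Hole + (\<Sum>i\<le>m. weight (\<lambda>s. f (embed s)) (M i))" for f
  proof -
    have "(\<Sum>i\<le>m. weight (\<lambda>s. f (embed s)) (M i)) =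
        weight (\<lambda>s. f (embed s)) (M 0) + (\<Sum>i\<in>{1..m}. weight (\<lambda>s. f (embed s)) (M i))"
      by (simp add: atMost_atLeast0 sum.atLeast_Suc_atMost)
    also have "(\<Sum>i\<in>{1..m}. weight (\<lambda>s. f (embed s)) (M i)) = (\<Sum>i\<leftarrow>[1..<Suc m]. weight (\<lambda>s. f (embed s)) (M i))"
      by (simp add: sum_list_distinct_conv_sum_set atLeastLessThanSuc_atLeastAtMost del: upt_Suc)
    finally show ?thesis
      by (simp add: w_def weights_def comp_def weight_map_mterm del: upt_Suc)
  qed
  have Cov0: "weights nCov w = 0" and Hole1: "weights nHole w = 1"
  proof -
    have "(\<lambda>s. nCov (embed s)) = (\<lambda>_. 0)" "(\<lambda>s. nHole (embed s)) = (\<lambda>_. 0)"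
      by (rule ext, case_tac s, auto)+
    then show "weights nCov w = 0" "weights nHole w = 1"
      by (simp_all only: weights_w weight_eq_0) simp_all
  qed
  have Gr: "weights nGr w = int d"
  proof -
    have "(\<lambda>s. nGr (embed s)) = (\<lambda>s. of_bool (s \<in> {Grad First, Grad Second}))"
    proof
      fix s show "nGr (embed s) = of_bool (s \<in> {Grad First, Grad Second})"
        by (cases s) (auto intro: layer.exhaust)
    qed
    then show ?thesis by (simp only: weights_w assms(6) of_nat_sum degree_weight) simp
  qed
  have Wt: "weights nWt w = int d'"
  proof -
    have "(\<lambda>s. nWt (embed s)) = (\<lambda>s. of_bool (s = Weight First) + of_bool (s = Weight Second))"
    proof
      fix s show "nWt (embed s) = of_bool (s = Weight First) + of_bool (s = Weight Second)"
      proof (cases s)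
        case (Weight l)
        then show ?thesis by (cases l) auto
      qed auto
    qed
    then show ?thesis by (simp only: weights_w assms(7) of_nat_sum of_nat_add deg_weight weight_add) simp
  qed
  obtain L where L: "\<And>c k v. (c, k, v) \<in> set L \<Longrightarrow> closed_words dims v \<and> weights nCov v = 0 \<and> weights nGr v = 0 \<and>
      weights nHole v = 1 \<and> int k \<le> geo (Suc t) * int d + geo t * int d' \<and>
      weights nWt v \<le> 3 ^ t * (3 * int d + int d')"
    and E: "\<And>e :: 'a run. admissible e \<Longrightarrow> integrable (omega e) (\<lambda>\<omega>. traces dims (full_val e t \<omega>) w) \<and>
      integral\<^sup>L (omega e) (\<lambda>\<omega>. traces dims (full_val e t \<omega>) w) =
      (\<Sum>(c, k, v)\<leftarrow>L. c * (1 / real (batch e)) ^ k * traces dims (const_val e) v)"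
    using expectation_expansion[OF closed Cov0, of t] unfolding Gr Wt Hole1 by (fastforce)
  \<comment> \<open>The run is quantified inside the choice, so the chosen terms depend on the word
    \<open>v\<close> only and serve all batch sizes, weights and entries.\<close>
  define F where "F v = (SOME us. erases v us \<and> (\<forall>e :: 'a run. net_weights p p1 p2 (init e) \<longrightarrow> net_weights p r p2 (teacher e) \<longrightarrow>
    hole_row e < nr \<longrightarrow> hole_col e < nc \<longrightarrow> traces dims (const_val e) v =
      trace_product (init_val (init e) (teacher e)) (length us - 1) (\<lambda>l. us ! l) $$ (hole_row e, hole_col e)))" for v
  have F: "erases v (F v)"
    "\<And>e :: 'a run. net_weights p p1 p2 (init e) \<Longrightarrow> net_weights p r p2 (teacher e) \<Longrightarrow>
    hole_row e < nr \<Longrightarrow> hole_col e < nc \<Longrightarrow> traces dims (const_val e) v =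
      trace_product (init_val (init e) (teacher e)) (length (F v) - 1) (\<lambda>l. F v ! l) $$ (hole_row e, hole_col e)"
    if "(c, k, v) \<in> set L" for c k v
    using someI_ex[OF exists_erasure[of v]] L[OF that] unfolding F_def by blast+
  \<comment> \<open>\<open>q\<close> is the bound itself, not the largest power that occurs. For a
    power without terms \<open>Lk\<close> is empty and the corresponding coefficient is the zero
    matrix.\<close>
  define q where "q = nat (geo (Suc t) * int d + geo t * int d')"
  define Lk where "Lk k = filter (\<lambda>x. fst (snd x) = k) L" for k
  define mk where "mk k = length (Lk k)" for k
  \<comment> \<open>Summands are numbered from 1 but list positions from 0. The head of each list is
    the matrix factor, hence \<open>mki\<close> is the length minus one.\<close>
  define us where "us k i = F (snd (snd (Lk k ! (i - 1))))" for k i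
  define mki where "mki k i = length (us k i) - 1" for k i
  define c where "c k i = fst (Lk k ! (i - 1))" for k i
  define T where "T k i j = us k i ! j" for k i j
  have q: "int q = geo (Suc t) * int d + geo t * int d'"
    unfolding q_def using geo_Suc(3) by (intro nat_0_le add_nonneg_nonneg mult_nonneg_nonneg) auto
  have mem: "(c k i, k, snd (snd (Lk k ! (i - 1)))) \<in> set L" if "i \<in> {1..mk k}" for k i
  proof -
    obtain a k' v where x: "Lk k ! (i - 1) = (a, k', v)" by (cases "Lk k ! (i - 1)") auto
    have "Lk k ! (i - 1) \<in> set (Lk k)" using that by (intro nth_mem) (auto simp: mk_def)
    then have "(a, k', v) \<in> set L" "k' = k" unfolding x by (auto simp: Lk_def)
    then show ?thesis unfolding c_def x by simp
  qed
  have "real q \<le> 1/2 * (3 ^ (t + 1) - 1) * real d + 1/2 * (3 ^ t - 1) * real d'"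
  proof -
    have "real_of_int (int q) = real_of_int (geo (Suc t)) * real d + real_of_int (geo t) * real d'"
      unfolding q by simp
    then show ?thesis by (simp add: real_geo)
  qed
  moreover have "(\<forall>j\<le>mki k i. mult_term ?I {Init First, Init Second} {Teacher0 First, Teacher0 Second} (T k i j)) \<and>
      (\<forall>j\<in>{1..mki k i}. square_term ?I (T k i j)) \<and>
      term_rows ?I (T k i 0) = nr \<and> term_cols (T k i 0) = nc \<and>
      (\<Sum>j\<le>mki k i. degree {Init First, Init Second} (T k i j)) \<le> 3 ^ t * (3 * d + d')"
    if i: "i \<in> {1..mk k}" for k i
  proof -
    let ?v = "snd (snd (Lk k ! (i - 1)))"
    have er: "erases ?v (us k i)" using F(1)[OF mem[OF i]] by (simp add: us_def)
    then have ne: "us k i \<noteq> []" by (simp add: erases_def)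
    then obtain K zs where K: "us k i = K # zs" by (cases "us k i") auto
    have "T k i j \<in> set (us k i)" if "j \<le> mki k i" for j
      using that ne unfolding T_def mki_def by (intro nth_mem) (auto simp: K)
    moreover have "T k i j \<in> set (tl (us k i))" if "j \<in> {1..mki k i}" for j
      using that by (cases j) (auto simp: T_def mki_def K intro!: nth_mem)
    moreover have "T k i 0 = hd (us k i)" by (simp add: T_def K)
    moreover have "(\<Sum>j\<le>mki k i. degree {Init First, Init Second} (T k i j)) \<le> 3 ^ t * (3 * d + d')"
    proof -
      have "{..mki k i} = {0..<length (us k i)}" using ne by (auto simp: mki_def K)
      then have "(\<Sum>j\<le>mki k i. degree {Init First, Init Second} (T k i j)) = (\<Sum>K\<leftarrow>us k i. degree {Init First, Init Second} K)"
        by (simp add: sum_list_sum_nth T_def)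
      then have "int (\<Sum>j\<le>mki k i. degree {Init First, Init Second} (T k i j)) = weights nWt ?v"
        using er by (simp only: erases_def)
      also have "\<dots> \<le> 3 ^ t * (3 * int d + int d')" using L[OF mem[OF i]] by blast
      also have "\<dots> = int (3 ^ t * (3 * d + d'))" by simp
      finally show ?thesis by (simp only: of_nat_le_iff)
    qed
    ultimately show ?thesis using er unfolding erases_def by auto
  qed
  moreover have "(\<forall>i<nr. \<forall>j<nc. integrable \<Omega> (\<lambda>\<omega>. sgd_term p p1 p2 b \<alpha> Wstar W0 t m M (sample_path p x \<omega>) $$ (i, j))) \<and>
      (AE \<omega> in \<Omega>. mat_cond_exp \<Omega> (initial_info \<Omega> (\<lambda>\<omega>. sgd p p1 p2 b \<alpha> Wstar W0 (sample_path p x \<omega>))) nr nc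
          (\<lambda>\<omega>. sgd_term p p1 p2 b \<alpha> Wstar W0 t m M (sample_path p x \<omega>)) \<omega> =
        mat_sum nr nc (\<lambda>k. (1 / real b ^ k) \<cdot>\<^sub>m mat_sum nr nc
          (\<lambda>i. c k i \<cdot>\<^sub>m trace_product (init_val W0 Wstar) (mki k i) (T k i)) {1..mk k}) {0..q})"
    if W: "net_weights p p1 p2 W0" "net_weights p r p2 Wstar" and b: "1 \<le> b"
      and \<Omega>: "prob_space \<Omega>" "gaussian_samples \<Omega> p b x"
    for W0 Wstar b and \<Omega> :: "'a measure" and x
  proof -
    let ?X = "\<lambda>\<omega>. sgd_term p p1 p2 b \<alpha> Wstar W0 t m M (sample_path p x \<omega>)"
    let ?F0 = "initial_info \<Omega> (\<lambda>\<omega>. sgd p p1 p2 b \<alpha> Wstar W0 (sample_path p x \<omega>))"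
    let ?tp = "\<lambda>k i. trace_product (init_val W0 Wstar) (mki k i) (T k i)"
    let ?R = "mat_sum nr nc (\<lambda>k. (1 / real b ^ k) \<cdot>\<^sub>m mat_sum nr nc (\<lambda>i. c k i \<cdot>\<^sub>m ?tp k i) {1..mk k}) {0..q}"
    \<comment> \<open>One run per matrix entry: only the position of the hole varies, so
      \<open>L\<close> and the terms built from it are the same for all entries.\<close>
    define e where "e i j = \<lparr>init = W0, teacher = Wstar, batch = b, omega = \<Omega>, sample = x, hole_row = i, hole_col = j\<rparr>" for i j
    have adm: "admissible (e i j)" for i j
      using b \<Omega> by (simp add: e_def admissible_def)
    have tpc: "dim_row (?tp k i) = nr" "dim_col (?tp k i) = nc" if "i \<in> {1..mk k}" for k i
    proof -
      have er: "erases (snd (snd (Lk k ! (i - 1)))) (us k i)" using F(1)[OF mem[OF that]] by (simp add: us_def)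
      then obtain K zs where K: "us k i = K # zs" by (cases "us k i") (auto simp: erases_def)
      have "init_val W0 Wstar s \<in> carrier_mat (fst (?I s)) (snd (?I s))" for s
        using W by (cases s) (auto simp: net_weights_def)
      then have "term_val (init_val W0 Wstar) (T k i 0) \<in> carrier_mat nr nc"
        using er term_val_carrier[of ?I K "init_val W0 Wstar"] by (auto simp: erases_def T_def K mult_term_def)
      then show "dim_row (?tp k i) = nr" "dim_col (?tp k i) = nc" by (auto simp: trace_product_def)
    qed
    have int: "integrable \<Omega> (\<lambda>\<omega>. ?X \<omega> $$ (i, j))" and eq: "integral\<^sup>L \<Omega> (\<lambda>\<omega>. ?X \<omega> $$ (i, j)) = ?R $$ (i, j)"
      if ij: "i < nr" "j < nc" for i j
    proof -
      have X: "?X \<omega> $$ (i, j) = traces dims (full_val (e i j) t \<omega>) w" for \<omega>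
        using sgd_term_traces[OF adm[of i j], of m M t \<omega>] W ij comp assms(3-5)
        by (simp add: e_def w_def del: upt_Suc)
      show "integrable \<Omega> (\<lambda>\<omega>. ?X \<omega> $$ (i, j))"
        unfolding X using E[OF adm[of i j]] by (simp add: e_def)
      have "integral\<^sup>L \<Omega> (\<lambda>\<omega>. ?X \<omega> $$ (i, j)) =
          (\<Sum>x\<leftarrow>L. fst x * (1 / real b) ^ fst (snd x) * traces dims (const_val (e i j)) (snd (snd x)))"
        unfolding X using E[OF adm[of i j]] by (simp add: e_def case_prod_unfold)
      also have "\<dots> = (\<Sum>k\<in>{0..q}. \<Sum>x\<leftarrow>Lk k. fst x * (1 / real b) ^ fst (snd x) * traces dims (const_val (e i j)) (snd (snd x)))"
        unfolding Lk_def
      proof (rule sum_list_by_key)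
        fix x assume "x \<in> set L"
        then have "int (fst (snd x)) \<le> int q" using L[of "fst x" "fst (snd x)" "snd (snd x)"] by (simp add: q)
        then show "fst (snd x) \<le> q" by simp
      qed
      also have "\<dots> = (\<Sum>k\<in>{0..q}. 1 / real b ^ k * (\<Sum>l\<in>{1..mk k}. c k l * ?tp k l $$ (i, j)))"
      proof (intro sum.cong refl)
        fix k
        have "fst (Lk k ! (l - 1)) * (1 / real b) ^ fst (snd (Lk k ! (l - 1))) * traces dims (const_val (e i j)) (snd (snd (Lk k ! (l - 1)))) =
            1 / real b ^ k * (c k l * ?tp k l $$ (i, j))" if l: "l \<in> {1..mk k}" for l
        proof -
          have "fst (snd (Lk k ! (l - 1))) = k"
            using l nth_mem[of "l - 1" "Lk k"] by (auto simp: mk_def Lk_def)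
          moreover have "traces dims (const_val (e i j)) (snd (snd (Lk k ! (l - 1)))) = ?tp k l $$ (i, j)"
            using F(2)[OF mem[OF l], of "e i j"] W ij by (simp add: e_def mki_def us_def T_def[abs_def])
          ultimately show ?thesis by (simp add: c_def power_one_over)
        qed
        then show "(\<Sum>x\<leftarrow>Lk k. fst x * (1 / real b) ^ fst (snd x) * traces dims (const_val (e i j)) (snd (snd x))) =
            1 / real b ^ k * (\<Sum>l\<in>{1..mk k}. c k l * ?tp k l $$ (i, j))"
          unfolding sum_list_one_based mk_def[symmetric] sum_distrib_left by (intro sum.cong refl)
      qed
      also have "\<dots> = ?R $$ (i, j)"
        using ij tpc by (simp add: mat_sum_def)
      finally show "integral\<^sup>L \<Omega> (\<lambda>\<omega>. ?X \<omega> $$ (i, j)) = ?R $$ (i, j)" .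
    qed
    \<comment> \<open>There are finitely many entries, so the entrywise null sets can be combined
      into one.\<close>
    have "AE \<omega> in \<Omega>. \<forall>ij\<in>{..<nr} \<times> {..<nc}. real_cond_exp \<Omega> ?F0 (\<lambda>\<omega>. ?X \<omega> $$ ij) \<omega> = ?R $$ ij"
    proof (rule AE_finite_allI)
      fix ij assume "ij \<in> {..<nr} \<times> {..<nc}"
      then obtain i j where ij: "ij = (i, j)" "i < nr" "j < nc" by auto
      show "AE \<omega> in \<Omega>. real_cond_exp \<Omega> ?F0 (\<lambda>\<omega>. ?X \<omega> $$ ij) \<omega> = ?R $$ ij"
        using cond_exp_initial_info[OF \<Omega>(1) int[OF ij(2,3)], of "\<lambda>\<omega>. sgd p p1 p2 b \<alpha> Wstar W0 (sample_path p x \<omega>)" W0]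
        unfolding ij(1) eq[OF ij(2,3)] by simp
    qed simp
    then have "AE \<omega> in \<Omega>. mat_cond_exp \<Omega> ?F0 nr nc ?X \<omega> = ?R"
    proof (rule AE_mp, intro AE_I2 impI)
      fix \<omega> assume "\<forall>ij\<in>{..<nr} \<times> {..<nc}. real_cond_exp \<Omega> ?F0 (\<lambda>\<omega>. ?X \<omega> $$ ij) \<omega> = ?R $$ ij"
      then show "mat_cond_exp \<Omega> ?F0 nr nc ?X \<omega> = ?R"
        by (intro eq_matI) (auto simp: mat_cond_exp_def mat_sum_def)
    qed
    then show ?thesis using int by blast
  qed
  ultimately show ?thesis
    unfolding Let_def
    by (intro exI[of _ q] exI[of _ mk] exI[of _ mki] exI[of _ c] exI[of _ T]) blast
qed

end
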